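(* Let $m\ge1$ and $1\le i\le p$. The $\mathcal W(p)^{A_m}$-modules $\Lambda(i)_0$, $\Lambda(i)^{\pm}_j$ ($1\le j\le\lfloor (m-1)/2\rfloor$) and, for $m$ even, $\Lambda(i)_m$, are irreducible. In particular (taking $i=1$, $\Lambda(1)_0=\mathcal W(p)^{A_m}$) the vertex algebra $\mathcal W(p)^{A_m}$ is simple.
   Context: Fix an integer $p\ge 2$. Let $L=\mathbb Z\alpha$ with $\langle\alpha,\alpha\rangle=2p$, $M(1)$ the Heisenberg vertex algebra, $V_L=M(1)\otimes\mathbb C[L]$ the lattice vertex algebra with conformal vector $\omega=\frac{1}{4p}\alpha(-1)^2\mathbf 1+\frac{p-1}{2p}\alpha(-2)\mathbf 1$; for $\gamma\in\mathbb Q\alpha$, $V_{L+\gamma}=M(1)\otimes\mathbb C[L+\gamma]$ is the usual $V_L$-module. $Q=e^{\alpha}_0$ is the screening operator. The triplet vertex algebra $\mathcal W(p)$ is the Virasoro submodule of $V_L$ generated by the singular vectors $Q^ie^{-n\alpha}$ ($n\ge0$, $0\le i\le2n$); it is a vertex subalgebra. For $m\ge1$ let $\sigma=\exp(\pi i\,\alpha(0)/(pm))$ (acting on $M(1)\otimes e^{n\alpha}$ by $e^{2\pi in/m}$) and $\mathcal W(p)^{A_m}=\mathcal W(p)\cap V_L^\sigma$. For $1\le i\le p$ let $\beta_i=\frac{i-1}{2p}\alpha$ and $\Lambda(i)=\mathcal W(p)\cdot e^{\beta_i}\subset V_{L+\beta_i}$; these are irreducible $\mathcal W(p)$-modules.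 Define the $\mathcal W(p)^{A_m}$-submodules: $\Lambda(i)_0=\mathcal W(p)^{A_m}\cdot e^{\beta_i}$; for $1\le j\le\lfloor (m-1)/2\rfloor$, $\Lambda(i)^-_j=\mathcal W(p)^{A_m}\cdot e^{-j\alpha+\beta_i}$, $\Lambda(i)^+_j=\mathcal W(p)^{A_m}\cdot Q^{2j}e^{-j\alpha+\beta_i}$; for $m$ even, $\Lambda(i)_m=\mathcal W(p)^{A_m}\cdot e^{-\frac m2\alpha+\beta_i}$. *)

theory Defs
  imports Complex_Main "HOL-Library.Poly_Mapping"
begin

text \<open>
Concrete model of the lattice vertex algebra V_L (L = Z alpha, <alpha,alpha> = 2p) and of
its modules V_{L+gamma}, gamma in (1/(2p)) Z alpha.

A basis vector is a pair (a, nu) with a :: int and nu :: nat =>0 nat, and stands for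
  alpha(-1)^(nu 1) alpha(-2)^(nu 2) ... (x) e^((a/(2p)) alpha).
(The key 0 of nu is never used.)  So V_L is spanned by the pairs with 2p dvd a and
V_{L+beta_i} (beta_i = (i-1)/(2p) alpha) by those with a = i-1 (mod 2p).
A vector is a finitely supported function from basis pairs to complex numbers.
\<close>

type_synonym mon = "nat \<Rightarrow>\<^sub>0 nat"
type_synonym vec = "int \<times> mon \<Rightarrow> complex"

definition vzero :: vec where "vzero = (\<lambda>_. 0)"
definition vadd :: "vec \<Rightarrow> vec \<Rightarrow> vec" where "vadd v w = (\<lambda>y. v y + w y)"
definition vscale :: "complex \<Rightarrow> vec \<Rightarrow> vec" where "vscale c v = (\<lambda>y. c * v y)"

definition bv :: "int \<Rightarrow> mon \<Rightarrow> vec" where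
  "bv a nu = (\<lambda>y. if y = (a, nu) then 1 else 0)"

definition ee :: "int \<Rightarrow> vec" where "ee a = bv a 0"

definition lin :: "(int \<times> mon \<Rightarrow> vec) \<Rightarrow> vec \<Rightarrow> vec" where
  "lin f v = (\<lambda>y. \<Sum>x\<in>{x. v x \<noteq> 0}. v x * f x y)"

text \<open>Heisenberg mode alpha(m): creation (multiplication by x_{-m}) for m<0,
  multiplication by <alpha, beta> = a on the sector e^beta (beta = (a/2p) alpha) for m = 0,
  and 2p m d/dx_m for m > 0.\<close>
definition heis :: "nat \<Rightarrow> int \<Rightarrow> vec \<Rightarrow> vec" where
  "heis p m = lin (\<lambda>(a, nu).
     if m < 0 then bv a (nu + Poly_Mapping.single (nat (- m)) 1)
     else if m = 0 then vscale (of_int a) (bv a nu)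
     else vscale (of_nat (2 * p * nat m * Poly_Mapping.lookup nu (nat m))) (bv a (nu - Poly_Mapping.single (nat m) 1)))"

definition apply_ops :: "nat \<Rightarrow> int list \<Rightarrow> vec \<Rightarrow> vec" where
  "apply_ops p ops v = foldr (heis p) ops v"

text \<open>e_beta with beta = (b/2p) alpha (trivial cocycle, legitimate as <alpha,alpha> is even)\<close>
definition shift :: "int \<Rightarrow> vec \<Rightarrow> vec" where
  "shift b v = (\<lambda>(a, nu). v (a - b, nu))"

definition factors :: "mon \<Rightarrow> nat list" where
  "factors mu = concat (map (\<lambda>n. replicate (Poly_Mapping.lookup mu n) n) (sorted_list_of_set (Poly_Mapping.keys mu)))"

definition deg :: "mon \<Rightarrow> nat" where
  "deg mu = (\<Sum>n\<in>Poly_Mapping.keys mu. n * Poly_Mapping.lookup mu n)"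

text \<open>a finite set of exponent vectors that contains every lambda with deg lambda <= D\<close>
definition bnd :: "nat \<Rightarrow> mon set" where
  "bnd D = {lam. Poly_Mapping.keys lam \<subseteq> {1..D} \<and> (\<forall>n. Poly_Mapping.lookup lam n \<le> D)}"

text \<open>
Coefficient of z^N in Y(u,z)w for basis vectors u = alpha(-n_1)...alpha(-n_r) e^(k alpha)
(so u is in V_L, b = 2pk) and w = alpha(-nu) e^((a/2p) alpha), where
  Y(u,z) = : d^(n_1-1)alpha(z) ... d^(n_r-1)alpha(z) E^-(-beta,z) E^+(-beta,z) e_beta z^(beta(0)) :
with d^(n-1)alpha(z) = sum_m binom(-m-1, n-1) alpha(m) z^(-m-n) (divided powers of the
derivative), E^-(-beta,z) = exp(sum_{n>0} beta(-n) z^n / n),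
E^+(-beta,z) = exp(- sum_{n>0} beta(n) z^(-n) / n), and the normal ordering placing all
alpha(m), m >= 0, to the right of e_beta.  A choice of modes cs (one per factor), and of
exponent vectors lam (for E^+) and kap (for E^-) gives one term; the index set below is a
finite superset of all choices giving a nonzero contribution to z^N.
\<close>
definition Ybasis :: "nat \<Rightarrow> int \<times> mon \<Rightarrow> int \<times> mon \<Rightarrow> int \<Rightarrow> vec" where
  "Ybasis p u w N = (case u of (b, mu) \<Rightarrow> case w of (a, nu) \<Rightarrow>
     (let k = b div (2 * int p); ns = factors mu; r = length ns; D = deg nu;
          B = nat (N - k * a) + r * D + sum_list ns + D
      in (\<lambda>y. \<Sum>(cs, lam, kap) \<in>
               {cs. length cs = r \<and> (\<forall>i<r. - (int (ns ! i) + int B) \<le> cs ! i \<and> cs ! i \<le> int D)}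
               \<times> bnd D \<times> bnd B.
             if (\<Sum>i<r. - cs ! i - int (ns ! i)) - int (deg lam) + int (deg kap) + k * a = N
             then (\<Prod>i<r. (of_int (- cs ! i - 1) :: complex) gchoose (ns ! i - 1))
                * (\<Prod>n\<in>Poly_Mapping.keys lam. (of_int (- k) / of_nat n) ^ Poly_Mapping.lookup lam n / fact (Poly_Mapping.lookup lam n))
                * (\<Prod>n\<in>Poly_Mapping.keys kap. (of_int k / of_nat n) ^ Poly_Mapping.lookup kap n / fact (Poly_Mapping.lookup kap n))
                * apply_ops p (filter (\<lambda>c. c < 0) cs @ map (\<lambda>n. - int n) (factors kap))
                    (shift b (apply_ops p (filter (\<lambda>c. 0 \<le> c) cs @ map int (factors lam)) (bv a nu))) y
             else 0)))"

definition Ycoef :: "nat \<Rightarrow> vec \<Rightarrow> vec \<Rightarrow> int \<Rightarrow> vec" where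
  "Ycoef p u w N = (\<lambda>y. \<Sum>x\<in>{x. u x \<noteq> 0}. \<Sum>x'\<in>{x'. w x' \<noteq> 0}. u x * w x' * Ybasis p x x' N y)"

text \<open>the mode u_n, Y(u,z) = sum_n u_n z^(-n-1)\<close>
definition vmode :: "nat \<Rightarrow> vec \<Rightarrow> int \<Rightarrow> vec \<Rightarrow> vec" where
  "vmode p u n w = Ycoef p u w (- n - 1)"

definition vac :: vec where "vac = ee 0"

definition omega :: "nat \<Rightarrow> vec" where
  "omega p = vadd (vscale (1 / (4 * of_nat p)) (bv 0 (Poly_Mapping.single 1 2)))
                  (vscale ((of_nat p - 1) / (2 * of_nat p)) (bv 0 (Poly_Mapping.single 2 1)))"

definition Vir :: "nat \<Rightarrow> int \<Rightarrow> vec \<Rightarrow> vec" where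
  "Vir p n = vmode p (omega p) (n + 1)"

definition Qscr :: "nat \<Rightarrow> vec \<Rightarrow> vec" where
  "Qscr p = vmode p (ee (2 * int p)) 0"

inductive_set vir_span :: "nat \<Rightarrow> vec set \<Rightarrow> vec set" for p S where
  base: "v \<in> S \<Longrightarrow> v \<in> vir_span p S"
| zero: "vzero \<in> vir_span p S"
| add: "v \<in> vir_span p S \<Longrightarrow> w \<in> vir_span p S \<Longrightarrow> vadd v w \<in> vir_span p S"
| scale: "v \<in> vir_span p S \<Longrightarrow> vscale c v \<in> vir_span p S"
| vir: "v \<in> vir_span p S \<Longrightarrow> Vir p n v \<in> vir_span p S"

definition triplet :: "nat \<Rightarrow> vec set" where
  "triplet p = vir_span p {(Qscr p ^^ i) (ee (- 2 * int p * int n)) | n i. i \<le> 2 * n}"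

text \<open>sigma = exp(pi i alpha(0) / (p m))\<close>
definition sigma :: "nat \<Rightarrow> nat \<Rightarrow> vec \<Rightarrow> vec" where
  "sigma p m v = (\<lambda>(a, nu). cis (pi * of_int a / (of_nat p * of_nat m)) * v (a, nu))"

definition tripletA :: "nat \<Rightarrow> nat \<Rightarrow> vec set" where
  "tripletA p m = triplet p \<inter> {v. sigma p m v = v}"

inductive_set gen_sub :: "nat \<Rightarrow> vec set \<Rightarrow> vec \<Rightarrow> vec set" for p U w where
  base: "w \<in> gen_sub p U w"
| zero: "vzero \<in> gen_sub p U w"
| add: "v \<in> gen_sub p U w \<Longrightarrow> v' \<in> gen_sub p U w \<Longrightarrow> vadd v v' \<in> gen_sub p U w"
| scale: "v \<in> gen_sub p U w \<Longrightarrow> vscale c v \<in> gen_sub p U w"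
| mode: "u \<in> U \<Longrightarrow> v \<in> gen_sub p U w \<Longrightarrow> vmode p u n v \<in> gen_sub p U w"

definition is_submod :: "nat \<Rightarrow> vec set \<Rightarrow> vec set \<Rightarrow> bool" where
  "is_submod p U N \<longleftrightarrow> vzero \<in> N \<and> (\<forall>v\<in>N. \<forall>v'\<in>N. vadd v v' \<in> N)
     \<and> (\<forall>c. \<forall>v\<in>N. vscale c v \<in> N) \<and> (\<forall>u\<in>U. \<forall>n. \<forall>v\<in>N. vmode p u n v \<in> N)"

definition irreducible_mod :: "nat \<Rightarrow> vec set \<Rightarrow> vec set \<Rightarrow> bool" where
  "irreducible_mod p U M \<longleftrightarrow> is_submod p U M \<and> M \<noteq> {vzero}
     \<and> (\<forall>N. N \<subseteq> M \<longrightarrow> is_submod p U N \<longrightarrow> N = {vzero} \<or> N = M)"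

definition simple_va :: "nat \<Rightarrow> vec set \<Rightarrow> bool" where
  "simple_va p U \<longleftrightarrow> U \<noteq> {vzero}
     \<and> (\<forall>I. I \<subseteq> U \<longrightarrow> is_submod p U I \<longrightarrow> I = {vzero} \<or> I = U)"

end

theory Submission
  imports Defs "HOL-Computational_Algebra.Computational_Algebra"
begin

text \<open>
  Let \<open>U\<close> be a nonzero submodule of one of the modules in question. The modes of \<open>e\<^bsup>-m\<alpha>\<^esup>\<close> lower the
  polynomial degree of the component of highest charge and push the other components to zero, so \<open>U\<close>
  contains \<open>e\<^bsup>-N\<alpha>+\<beta>\<^esup>\<close> for all large \<open>N\<close> in the right class modulo \<open>m\<close>.

  To climb back one uses the modes of \<open>Q\<^bsup>2n\<^esup>e\<^bsup>-n\<alpha>\<^esup>\<close> with \<open>m | n\<close>. Since \<open>Q\<close> is a derivation, such a mode applied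
  to \<open>e\<^bsup>-N\<alpha>+\<beta>\<^esup>\<close> is an alternating sum of the vectors \<open>Q\<^bsup>2n-r\<^esup>(e\<^bsup>-n\<alpha>\<^esup>)\<^sub>k Q\<^sup>r e\<^bsup>-N\<alpha>+\<beta>\<^esup>\<close>, and for the right \<open>k\<close> only one
  term survives for degree reasons: it is a binomial coefficient times a constant \<open>c\<close> times
  \<open>Q\<^bsup>2n-r\<^esup>e\<^bsup>-j\<alpha>+\<beta>\<^esup>\<close>. With \<open>N = n + j\<close>, \<open>r = 2n\<close> or \<open>N = n - j\<close>, \<open>r = 2N\<close> this reaches either kind of generator.

  The constant \<open>c\<close> is the value of the polynomial \<open>Q\<^sup>r e\<^bsup>-N\<alpha>+\<beta>\<^esup>\<close> at the point where all \<open>\<alpha>(-l)\<close> equal \<open>2pn\<close>,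
  a constant term of Morris type. It does not vanish by Aomoto's argument: if \<open>E\<^sub>k\<close> denotes the modes of
  \<open>e\<^sup>\<alpha>\<close>, the values of \<open>E\<^sub>1\<^sup>r E\<^sub>0\<^bsup>s-r\<^esup> e\<^sub>a\<close> satisfy a first-order recursion in \<open>r\<close>, which moves \<open>a\<close> to a boundary
  value where the constant reduces to one with fewer screenings.
\<close>

section \<open>The Fock space as a polynomial ring\<close>

text \<open>That Q is a derivation is an instance of the Borcherds identity and is derived here from
  the explicit formula for \<open>Ybasis\<close>. The products of Y(e^alpha, x) and Y(v, z) in the
  two orders involve the same powers (x - z)^L, expanded for |x| > |z| and for |x| < |z|. The
  difference of their residues in x is a divided derivative at x = z, which turns out to be Y(Qv,
  z).

  Aomoto's recursion closes because all variables are evaluated at the same number: the Euler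
  identities for E_1 and E_0 then contain the same tail of values of E_2, E_3, ..., which cancels on
  subtraction. The remaining quadratic sums in the modes follow from e^alpha(z) e^alpha(z) = 0, that
  is, from the vanishing of (x - z)^(2p) on the diagonal.

  The boundary value of a is the one at which Q^s e_a has degree 0, so that the point of evaluation
  no longer matters. There the last screening is itself an evaluation, at -2p, of a vector with one
  screening less; this drives the induction on the number of screenings.\<close>

declare One_nat_def [simp del]

type_synonym pol = "mon \<Rightarrow>\<^sub>0 complex"

abbreviation (input) "lkp \<equiv> Poly_Mapping.lookup"
abbreviation (input) "pkeys \<equiv> Poly_Mapping.keys"
abbreviation (input) "sgl \<equiv> Poly_Mapping.single"

definition Cn :: "complex \<Rightarrow> pol" where "Cn c = sgl 0 c"
definition Mo :: "mon \<Rightarrow> pol" where "Mo nu = sgl nu 1"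
definition Xv :: "nat \<Rightarrow> pol" where "Xv n = Mo (sgl n 1)"

lemma Cn_add: "Cn (a + b) = Cn a + Cn b" by (simp add: Cn_def single_add)
lemma Cn_mult: "Cn (a * b) = Cn a * Cn b" by (simp add: Cn_def mult_single)
lemma Cn_0 [simp]: "Cn 0 = 0" by (simp add: Cn_def)
lemma Cn_1 [simp]: "Cn 1 = 1" by (simp add: Cn_def)
lemma Cn_uminus: "Cn (- a) = - Cn a" by (simp add: Cn_def single_uminus)
lemma Cn_diff: "Cn (a - b) = Cn a - Cn b" by (simp add: Cn_def single_diff)
lemma Cn_sum: "Cn (sum f A) = (\<Sum>x\<in>A. Cn (f x))"
  by (induction A rule: infinite_finite_induct) (auto simp: Cn_add)
lemma Cn_of_nat: "Cn (of_nat n) = of_nat n" by (simp add: Cn_def)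
lemma Cn_of_int: "Cn (of_int n) = of_int n" by (simp add: Cn_def)
lemma Cn_numeral: "Cn (numeral n) = numeral n" by (simp add: Cn_def)
lemma Cn_eq_iff [simp]: "Cn a = Cn b \<longleftrightarrow> a = b"
  by (metis Cn_def lookup_single_eq)
lemma Cn_eq_0_iff [simp]: "Cn a = 0 \<longleftrightarrow> a = 0"
  using Cn_eq_iff[of a 0] by simp
lemma Cn_mult_single: "Cn c * sgl nu d = sgl nu (c * d)"
  by (simp add: Cn_def mult_single)
lemma lookup_Cn_mult [simp]: "lkp (Cn c * q) nu = c * lkp q nu"
  unfolding Cn_def mult_map_scale_conv_mult[symmetric]
  by (simp add: Poly_Mapping.map.rep_eq when_def)
lemma Mo_0 [simp]: "Mo 0 = 1" by (simp add: Mo_def)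
lemma Mo_add: "Mo (a + b) = Mo a * Mo b" by (simp add: Mo_def mult_single)
lemma sgl_eq: "sgl nu c = Cn c * Mo nu" by (simp add: Mo_def Cn_mult_single)

lemma pol_expand: "(q :: pol) = (\<Sum>nu\<in>pkeys q. sgl nu (lkp q nu))"
  by (rule poly_mapping_eqI)
     (auto simp: lookup_sum lookup_single when_def sum.delta in_keys_iff)

lemma pol_add_induct [case_names single add]:
  assumes "\<And>nu c. P (sgl nu c)" "\<And>q r. P q \<Longrightarrow> P r \<Longrightarrow> P (q + r)"
  shows "P (q :: pol)"
proof -
  have "P (\<Sum>nu\<in>B. sgl nu (lkp q nu))" if "finite B" for B
    using that assms(1)[of 0 0] by (induction B rule: finite_induct) (auto intro: assms)
  then show ?thesis using pol_expand[of q] by (metis finite_keys)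
qed

lemma mon_induct_in [consumes 1, case_names zero add]:
  fixes nu :: mon
  assumes "pkeys nu \<subseteq> A" and z: "P 0"
    and s: "\<And>n mu. n \<in> A \<Longrightarrow> pkeys mu \<subseteq> A \<Longrightarrow> P mu \<Longrightarrow> P (mu + sgl n 1)"
  shows "P nu"
  using assms(1)
proof (induction "\<Sum>n\<in>pkeys nu. lkp nu n" arbitrary: nu)
  case 0
  have "pkeys nu = {}"
  proof (rule ccontr)
    assume "pkeys nu \<noteq> {}"
    then obtain n where "n \<in> pkeys nu" by blast
    with 0(1) show False by (simp add: in_keys_iff)
  qed
  then show ?case using z by simp
next
  case (Suc s')
  then have "nu \<noteq> 0" by (metis keys_zero nat.distinct(1) sum.empty)
  then obtain n where n: "n \<in> pkeys nu" by (metis all_not_in_conv keys_eq_empty)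
  define mu where "mu = nu - sgl n 1"
  have l: "lkp mu x = (if x = n then lkp nu n - 1 else lkp nu x)" for x
    by (auto simp: mu_def lookup_minus lookup_single when_def)
  have eq: "nu = mu + sgl n 1"
    using n by (intro poly_mapping_eqI) (auto simp: l lookup_add lookup_single when_def in_keys_iff)
  have ks: "pkeys mu \<subseteq> pkeys nu" by (auto simp: in_keys_iff l split: if_splits)
  have "(\<Sum>x\<in>pkeys nu. lkp nu x) = Suc (\<Sum>x\<in>pkeys nu. lkp mu x)"
    using n by (simp add: sum.remove[OF _ n] l in_keys_iff)
  moreover have "(\<Sum>x\<in>pkeys nu. lkp mu x) = (\<Sum>x\<in>pkeys mu. lkp mu x)"
    using ks by (intro sum.mono_neutral_right) (auto simp: in_keys_iff)
  ultimately have "s' = (\<Sum>x\<in>pkeys mu. lkp mu x)" using Suc by simp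
  with Suc ks have "P mu" by blast
  then show ?case using s[of n mu] n Suc ks eq by auto
qed

text \<open>The type of exponents allows a variable of index 0, which the model never uses;
  \<open>vin {1..}\<close> is the condition that excludes it.\<close>

definition vin :: "nat set \<Rightarrow> pol \<Rightarrow> bool" where
  "vin A q \<longleftrightarrow> (\<forall>nu\<in>pkeys q. pkeys nu \<subseteq> A)"

lemma vin_UNIV [simp]: "vin UNIV q" by (simp add: vin_def)
lemma vin_0 [simp]: "vin A 0" by (simp add: vin_def)
lemma vin_add: "vin A q \<Longrightarrow> vin A r \<Longrightarrow> vin A (q + r)"
  unfolding vin_def using keys_add[of q r] by blast
lemma vin_sum: "(\<And>x. x \<in> B \<Longrightarrow> vin A (f x)) \<Longrightarrow> vin A (sum f B)"
  by (induction B rule: infinite_finite_induct) (auto simp: vin_add)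
lemma vin_mult: assumes "vin A q" "vin A r" shows "vin A (q * r)"
  unfolding vin_def
proof
  fix nu assume "nu \<in> pkeys (q * r)"
  then obtain a b where "a \<in> pkeys q" "b \<in> pkeys r" "nu = a + b" using keys_mult[of q r] by blast
  then show "pkeys nu \<subseteq> A" using assms keys_add[of a b] unfolding vin_def by blast
qed
lemma vin_Cn [simp]: "vin A (Cn c)" by (simp add: vin_def Cn_def)
lemma vin_1 [simp]: "vin A 1" using vin_Cn[of A 1] by (simp del: vin_Cn)
lemma vin_uminus: "vin A q \<Longrightarrow> vin A (- q)"
  using vin_mult[of A "Cn (-1)" q] vin_Cn[of A "-1"] by (simp add: Cn_uminus del: vin_Cn)
lemma vin_diff: "vin A q \<Longrightarrow> vin A r \<Longrightarrow> vin A (q - r)"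
  using vin_add[of A q "- r"] vin_uminus by simp
lemma vin_Mo: "pkeys nu \<subseteq> A \<Longrightarrow> vin A (Mo nu)" by (simp add: vin_def Mo_def)
lemma vin_Xv: "n \<in> A \<Longrightarrow> vin A (Xv n)" by (simp add: Xv_def vin_Mo)

text \<open>The working induction of the development: an additive operator is controlled by its
  value on constants and its commutation with one variable \<open>Xv n\<close>.\<close>

lemma pol_induct_in [consumes 1, case_names const add mult]:
  assumes v: "vin A q" and c: "\<And>c. P (Cn c)"
    and a: "\<And>q r. vin A q \<Longrightarrow> vin A r \<Longrightarrow> P q \<Longrightarrow> P r \<Longrightarrow> P (q + r)"
    and m: "\<And>n q. n \<in> A \<Longrightarrow> vin A q \<Longrightarrow> P q \<Longrightarrow> P (Xv n * q)"
  shows "P q"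
proof -
  have mono: "P (sgl nu d) \<and> vin A (sgl nu d)" if "pkeys nu \<subseteq> A" for nu d
    using that
  proof (induction nu rule: mon_induct_in)
    case zero then show ?case using c[of d] vin_Cn[of A d] by (simp add: Cn_def)
  next
    case (add n mu)
    have "sgl (mu + sgl n 1) d = Xv n * sgl mu d"
      by (simp add: Xv_def Mo_def mult_single add.commute)
    then show ?case using m[of n "sgl mu d"] add vin_mult[OF vin_Xv] by auto
  qed
  have "P (\<Sum>nu\<in>B. sgl nu (lkp q nu)) \<and> vin A (\<Sum>nu\<in>B. sgl nu (lkp q nu))"
    if "B \<subseteq> pkeys q" "finite B" for B using that(2,1)
  proof (induction B rule: finite_induct)
    case empty then show ?case using c[of 0] by simp
  next
    case (insert x F)
    then have "pkeys x \<subseteq> A" using v by (auto simp: vin_def)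
    then show ?case using insert mono[of x] a vin_add by auto
  qed
  from this[of "pkeys q"] show ?thesis using pol_expand[of q] by simp
qed

lemmas pol_induct = pol_induct_in[OF vin_UNIV, simplified, case_names const add mult]

section \<open>Ring homomorphisms and substitutions into polynomials\<close>

definition rhom :: "('a::comm_ring_1 \<Rightarrow> 'b::comm_ring_1) \<Rightarrow> bool" where
  "rhom h \<longleftrightarrow> h 1 = 1 \<and> (\<forall>a b. h (a + b) = h a + h b) \<and> (\<forall>a b. h (a * b) = h a * h b)"

lemma rhomD: assumes "rhom h"
  shows "h 1 = 1" "h (a + b) = h a + h b" "h (a * b) = h a * h b" "h 0 = 0"
proof -
  show "h 1 = 1" and ad: "h (a + b) = h a + h b" and "h (a * b) = h a * h b" using assms by (auto simp: rhom_def)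
  have "h (0 + 0) = h 0 + h 0" using assms unfolding rhom_def by blast
  then show "h 0 = 0" by simp
qed

lemma rhom_Cn: "rhom Cn" by (simp add: rhom_def Cn_add Cn_mult)
lemma rhom_id: "rhom (\<lambda>x. x)" by (simp add: rhom_def)
lemma rhom_pCn: "rhom (\<lambda>c. [:Cn c:])" by (simp add: rhom_def Cn_add Cn_mult)
lemma rhom_fCn: "rhom (\<lambda>c. fls_const (Cn c))"
  by (simp add: rhom_def Cn_add Cn_mult fls_plus_const fls_const_mult_const)

text \<open>Extension of a map on monomials, where \<open>h\<close> carries the scalars into the
  target: the polynomial ring itself, polynomials or Laurent series over it, or the complex
  numbers.\<close>

definition lext :: "(complex \<Rightarrow> 'b::comm_ring_1) \<Rightarrow> (mon \<Rightarrow> 'b) \<Rightarrow> pol \<Rightarrow> 'b" where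
  "lext h f q = (\<Sum>nu\<in>pkeys q. h (lkp q nu) * f nu)"

lemma lext_superset: assumes "rhom h" "finite B" "pkeys q \<subseteq> B"
  shows "lext h f q = (\<Sum>nu\<in>B. h (lkp q nu) * f nu)"
  unfolding lext_def using assms rhomD(4)[OF assms(1)]
  by (intro sum.mono_neutral_left) (auto simp: in_keys_iff)

lemma lext_add: assumes "rhom h" shows "lext h f (q + r) = lext h f q + lext h f r"
proof -
  let ?B = "pkeys q \<union> pkeys r"
  have "lext h f (q + r) = (\<Sum>nu\<in>?B. h (lkp (q + r) nu) * f nu)"
    using keys_add[of q r] by (intro lext_superset assms) auto
  also have "\<dots> = (\<Sum>nu\<in>?B. h (lkp q nu) * f nu) + (\<Sum>nu\<in>?B. h (lkp r nu) * f nu)"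
    by (simp add: lookup_add rhomD[OF assms] distrib_right sum.distrib)
  also have "\<dots> = lext h f q + lext h f r"
    by (simp add: lext_superset[OF assms, of ?B])
  finally show ?thesis .
qed

lemma lext_0 [simp]: "lext h f 0 = 0" by (simp add: lext_def)

lemma lext_sum: assumes "rhom h" shows "lext h f (\<Sum>x\<in>A. q x) = (\<Sum>x\<in>A. lext h f (q x))"
  by (induction A rule: infinite_finite_induct) (auto simp: lext_add[OF assms])

lemma lext_single: assumes "rhom h" shows "lext h f (sgl nu c) = h c * f nu"
  by (cases "c = 0") (auto simp: lext_def rhomD[OF assms])

lemma lext_Cn_mult: assumes "rhom h" shows "lext h f (Cn c * q) = h c * lext h f q"
proof -
  have "lext h f (Cn c * q) = (\<Sum>nu\<in>pkeys q. h (lkp (Cn c * q) nu) * f nu)"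
    by (rule lext_superset[OF assms]) (auto simp: in_keys_iff)
  then show ?thesis by (simp add: lext_def rhomD[OF assms] sum_distrib_left mult.assoc)
qed

lemma lext_mult: assumes h: "rhom h" and f: "\<And>a b. f (a + b) = f a * f b"
  shows "lext h f (q * r) = lext h f q * lext h f r"
proof -
  have "q * r = (\<Sum>nu\<in>pkeys q. \<Sum>mu\<in>pkeys r. sgl (nu + mu) (lkp q nu * lkp r mu))"
    by (subst pol_expand[of q], subst pol_expand[of r]) (simp add: sum_product mult_single)
  then have "lext h f (q * r) = (\<Sum>nu\<in>pkeys q. \<Sum>mu\<in>pkeys r. h (lkp q nu * lkp r mu) * f (nu + mu))"
    by (simp add: lext_sum[OF h] lext_single[OF h])
  also have "\<dots> = lext h f q * lext h f r"
    by (simp add: lext_def sum_product rhomD[OF h] f algebra_simps)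
  finally show ?thesis .
qed

definition mprod :: "(nat \<Rightarrow> 'b::comm_ring_1) \<Rightarrow> mon \<Rightarrow> 'b" where
  "mprod g nu = (\<Prod>n\<in>pkeys nu. g n ^ lkp nu n)"

lemma mprod_superset: "finite B \<Longrightarrow> pkeys nu \<subseteq> B \<Longrightarrow> mprod g nu = (\<Prod>n\<in>B. g n ^ lkp nu n)"
  unfolding mprod_def by (intro prod.mono_neutral_left) (auto simp: in_keys_iff)

lemma mprod_add: "mprod g (a + b) = mprod g a * mprod g b"
  using keys_add[of a b]
  by (simp add: mprod_superset[of "pkeys a \<union> pkeys b"] lookup_add power_add prod.distrib)

lemma mprod_0 [simp]: "mprod g 0 = 1" by (simp add: mprod_def)
lemma mprod_single [simp]: "mprod g (sgl n 1) = g n" by (simp add: mprod_def)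

definition subst :: "(complex \<Rightarrow> 'b::comm_ring_1) \<Rightarrow> (nat \<Rightarrow> 'b) \<Rightarrow> pol \<Rightarrow> 'b" where
  "subst h g = lext h (mprod g)"

lemma rhom_subst: assumes "rhom h" shows "rhom (subst h g)"
proof -
  have "lext h (mprod g) 1 = 1"
    using lext_single[OF assms, of "mprod g" 0 1] by (simp add: rhomD(1)[OF assms])
  then show ?thesis
    by (auto simp: rhom_def subst_def lext_add[OF assms] lext_mult[OF assms mprod_add])
qed

lemma subst_Cn: "rhom h \<Longrightarrow> subst h g (Cn c) = h c"
  by (simp add: subst_def Cn_def lext_single)
lemma subst_Xv: "rhom h \<Longrightarrow> subst h g (Xv n) = g n"
  by (simp add: subst_def Xv_def Mo_def lext_single rhomD)

section \<open>Degrees, annihilation operators and the operator E^+\<close>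

lemma deg_add: "deg (a + b) = deg a + deg b"
  unfolding deg_def by (rule setsum_keys_plus_distrib) (auto simp: algebra_simps)
lemma deg_0 [simp]: "deg 0 = 0" by (simp add: deg_def)
lemma deg_single [simp]: "deg (sgl n k) = n * k" by (simp add: deg_def)

lemma lookup_Xv_mult: "lkp (Xv n * q) nu = (if lkp nu n = 0 then 0 else lkp q (nu - sgl n 1))"
proof -
  have m: "lkp (Xv n * sgl mu c) nu = (if lkp nu n = 0 then 0 else lkp (sgl mu c) (nu - sgl n 1))" for mu c
  proof -
    have "(sgl n 1 + mu = nu) \<longleftrightarrow> (lkp nu n \<noteq> 0 \<and> mu = nu - sgl n 1)"
    proof
      assume "sgl n 1 + mu = nu"
      then show "lkp nu n \<noteq> 0 \<and> mu = nu - sgl n 1" by (auto simp: lookup_add)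
    next
      assume a: "lkp nu n \<noteq> 0 \<and> mu = nu - sgl n 1"
      then show "sgl n 1 + mu = nu"
        by (intro poly_mapping_eqI) (auto simp: lookup_add lookup_minus lookup_single when_def)
    qed
    then show ?thesis by (auto simp: Xv_def Mo_def mult_single lookup_single when_def)
  qed
  show ?thesis
    by (subst (1 2) pol_expand[of q]) (simp add: sum_distrib_left lookup_sum m)
qed

lemma lookup_sub_single: "lkp (nu - sgl n (1::nat)) x = (if x = n then lkp nu n - 1 else lkp nu x)"
  by (auto simp: lookup_minus lookup_single when_def)

lemma sub_single_add: "lkp nu n \<noteq> 0 \<Longrightarrow> (nu - sgl n (1::nat)) + sgl n 1 = nu"
  by (intro poly_mapping_eqI) (auto simp: lookup_add lookup_single when_def lookup_sub_single)

text \<open>The annihilation operator alpha(c) = 2pc d/dx_c. The factor c makes it zero for c = 0;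
  the zero mode, which depends on the charge, is supplied by \<open>al0\<close>.\<close>

definition al :: "nat \<Rightarrow> nat \<Rightarrow> pol \<Rightarrow> pol" where
  "al p c = lext Cn (\<lambda>nu. Cn (of_nat (2 * p * c * lkp nu c)) * Mo (nu - sgl c 1))"

lemma al_add: "al p c (q + r) = al p c q + al p c r"
  by (simp add: al_def lext_add rhom_Cn)
lemma al_0 [simp]: "al p c 0 = 0" by (simp add: al_def)
lemma al_Cn_mult: "al p c (Cn d * q) = Cn d * al p c q"
  by (simp add: al_def lext_Cn_mult rhom_Cn)
lemma al_sum: "al p c (\<Sum>x\<in>A. q x) = (\<Sum>x\<in>A. al p c (q x))"
  by (simp add: al_def lext_sum rhom_Cn)
lemma al_Cn [simp]: "al p c (Cn d) = 0"
  using lext_single[OF rhom_Cn, of _ 0 d] by (simp add: al_def Cn_def)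
lemma al_1 [simp]: "al p c 1 = 0" using al_Cn[of p c 1] by (simp del: al_Cn)
lemma al_uminus: "al p c (- q) = - al p c q"
  using al_Cn_mult[of p c "-1" q] by (simp add: Cn_uminus)
lemma al_diff: "al p c (q - r) = al p c q - al p c r"
  using al_add[of p c q "- r"] by (simp add: al_uminus)

text \<open>The Heisenberg commutation relation. The product rule and the commutativity of
  annihilation operators are deduced from it by induction on the polynomial.\<close>

lemma al_Xv: "al p c (Xv j * q) = Xv j * al p c q + (if j = c then of_nat (2 * p * c) * q else 0)"
proof -
  have m: "al p c (Xv j * sgl mu d) = Xv j * al p c (sgl mu d) + (if j = c then of_nat (2 * p * c) * sgl mu d else 0)" for mu d
  proof -
    have e1: "Xv j * sgl mu d = sgl (sgl j 1 + mu) d" by (simp add: Xv_def Mo_def mult_single)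
    have e2: "al p c (sgl nu d) = sgl (nu - sgl c 1) (d * of_nat (2 * p * c * lkp nu c))" for nu
      by (simp add: al_def lext_single rhom_Cn Mo_def Cn_mult_single Cn_mult[symmetric] mult.assoc[symmetric])
    have e3: "Xv j * sgl nu e = sgl (sgl j 1 + nu) e" for nu e by (simp add: Xv_def Mo_def mult_single)
    have e4: "of_nat k * sgl nu e = sgl nu (of_nat k * e)" for k and nu :: mon and e :: complex
      using Cn_mult_single[of "of_nat k" nu e] by (simp add: Cn_of_nat)
    show ?thesis
    proof (cases "j = c")
      case False
      have "sgl j 1 + mu - sgl c 1 = sgl j (1::nat) + (mu - sgl c 1)" 
        using False by (intro poly_mapping_eqI) (auto simp: lookup_add lookup_minus lookup_single when_def)
      then show ?thesis using False by (simp add: e2 e3 lookup_add lookup_single when_def)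
    next
      case True
      have "sgl c 1 + mu - sgl c 1 = mu"
        by (intro poly_mapping_eqI) (auto simp: lookup_add lookup_minus lookup_single when_def)
      then have A: "al p c (Xv c * sgl mu d) = sgl mu (d * of_nat (2 * p * c * (1 + lkp mu c)))"
        by (simp only: e3[unfolded True] e2 lookup_add) simp
      have B: "Xv c * al p c (sgl mu d) = sgl mu (d * of_nat (2 * p * c * lkp mu c))"
      proof (cases "lkp mu c = 0")
        case False
        have "sgl c 1 + (mu - sgl c 1) = mu" using sub_single_add[OF False] by (simp add: add.commute)
        then show ?thesis by (simp only: e2 e3[unfolded True])
      qed (simp add: e2)
      show ?thesis unfolding True A B
        by (simp only: e4 single_add[symmetric] refl if_True) (rule arg_cong[where f = "sgl mu"], simp add: algebra_simps)
    qed
  qed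
  show ?thesis
  proof (induction q rule: pol_add_induct)
    case (add q r)
    then show ?case by (simp add: distrib_left al_add)
  qed (rule m)
qed

lemma al_mult: "al p c (q * r) = al p c q * r + q * al p c r"
proof (induction q rule: pol_induct)
  case (const d) then show ?case by (simp add: al_Cn_mult)
next
  case (add q r) then show ?case by (simp add: al_add algebra_simps)
next
  case (mult n q) then show ?case by (simp add: al_Xv mult.assoc distrib_left distrib_right)
qed

lemma al_commute: "al p c (al p d q) = al p d (al p c q)"
proof (induction q rule: pol_induct)
  case (const c) then show ?case by simp
next
  case (add q r) then show ?case by (simp add: al_add)
next
  case (mult n q)
  have n: "al p c (of_nat k * q) = of_nat k * al p c q" for k c q
    using al_Cn_mult[of p c "of_nat k" q] by (simp add: Cn_of_nat)
  show ?case using mult by (simp add: al_Xv al_add n del: of_nat_mult)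
qed

definition al0 :: "nat \<Rightarrow> int \<Rightarrow> nat \<Rightarrow> pol \<Rightarrow> pol" where
  "al0 p a c q = (if c = 0 then of_int a * q else al p c q)"

lemma al_of_int: "al p c (of_int k * q) = of_int k * al p c q"
  using al_Cn_mult[of p c "of_int k" q] by (simp add: Cn_of_int)
lemma al0_add: "al0 p a c (q + r) = al0 p a c q + al0 p a c r" by (simp add: al0_def al_add algebra_simps)
lemma al0_0 [simp]: "al0 p a c 0 = 0" by (simp add: al0_def)
lemma al0_Cn_mult: "al0 p a c (Cn d * q) = Cn d * al0 p a c q" by (simp add: al0_def al_Cn_mult mult.left_commute)
lemma al0_commute: "al0 p a c (al0 p a d q) = al0 p a d (al0 p a c q)"
  by (simp add: al0_def al_commute al_of_int)

text \<open>The annihilating half of \<open>Y(e\<^bsup>k\<alpha>\<^esup>, z)\<close> is the ring homomorphism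
  \<open>\<alpha>(-n) \<mapsto> \<alpha>(-n) - 2pk z\<^bsup>-n\<^esup>\<close>; \<open>Gm p k f\<close> is its coefficient of \<open>z\<^bsup>-f\<^esup>\<close>.\<close>
definition shv :: "nat \<Rightarrow> int \<Rightarrow> nat \<Rightarrow> pol poly" where
  "shv p k n = (if n = 0 then [:Xv 0:] else [:Xv n:] - monom (of_int (2 * int p * k)) n)"

definition Gm :: "nat \<Rightarrow> int \<Rightarrow> nat \<Rightarrow> pol \<Rightarrow> pol" where
  "Gm p k f q = coeff (subst (\<lambda>c. [:Cn c:]) (shv p k) q) f"

lemmas sh_hom = rhomD[OF rhom_subst[OF rhom_pCn]]

lemma Gm_add: "Gm p k f (q + r) = Gm p k f q + Gm p k f r" by (simp add: Gm_def sh_hom)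
lemma Gm_0 [simp]: "Gm p k f 0 = 0" by (simp add: Gm_def sh_hom)
lemma Gm_Cn: "Gm p k f (Cn c) = (if f = 0 then Cn c else 0)"
  by (auto simp: Gm_def subst_Cn rhom_pCn coeff_eq_0)
lemma Gm_1: "Gm p k f 1 = (if f = 0 then 1 else 0)" using Gm_Cn[of p k f 1] by simp
lemma Gm_mult: "Gm p k f (q * r) = (\<Sum>i\<le>f. Gm p k i q * Gm p k (f - i) r)"
  by (simp add: Gm_def sh_hom coeff_mult)
lemma Gm_Cn_mult: "Gm p k f (Cn c * q) = Cn c * Gm p k f q"
  by (simp add: Gm_def sh_hom subst_Cn rhom_pCn)
lemma Gm_sum: "Gm p k f (\<Sum>x\<in>A. q x) = (\<Sum>x\<in>A. Gm p k f (q x))"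
  by (induction A rule: infinite_finite_induct) (auto simp: Gm_add)
lemma Gm_uminus: "Gm p k f (- q) = - Gm p k f q"
  using Gm_Cn_mult[of p k f "-1" q] by (simp add: Cn_uminus)
lemma Gm_diff: "Gm p k f (q - r) = Gm p k f q - Gm p k f r"
  using Gm_add[of p k f q "- r"] by (simp add: Gm_uminus)
lemma Gm_Xv: "Gm p k f (Xv j * q) = Xv j * Gm p k f q
    - (if 1 \<le> j \<and> j \<le> f then of_int (2 * int p * k) * Gm p k (f - j) q else 0)"
  by (auto simp: Gm_def sh_hom subst_Xv rhom_pCn shv_def left_diff_distrib coeff_monom_mult simp del: of_int_mult)
lemma Gm_bound: "\<exists>F. \<forall>f>F. Gm p k f q = 0"
  unfolding Gm_def using coeff_eq_0 by blast

lemma Gm_zero_idx: "Gm p k 0 q = q"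
proof (induction q rule: pol_induct)
  case (const c) then show ?case by (simp add: Gm_Cn)
next
  case (add q r) then show ?case by (simp add: Gm_add)
next
  case (mult n q) then show ?case by (simp add: Gm_Xv)
qed

lemma Gm_of_int: "Gm p k f (of_int c * q) = of_int c * Gm p k f q"
  using Gm_Cn_mult[of p k f "of_int c" q] by (simp add: Cn_of_int)
lemma Gm_of_nat: "Gm p k f (of_nat c * q) = of_nat c * Gm p k f q"
  using Gm_of_int[of p k f "int c" q] by simp

lemma Gm_al: "Gm p k f (al p c q) = al p c (Gm p k f q)"
proof (induction q arbitrary: f rule: pol_induct)
  case (const d) then show ?case by (simp add: Gm_Cn)
next
  case (add q r) then show ?case by (simp add: Gm_add al_add)
next
  case (mult n q)
  show ?case
    by (simp add: al_Xv Gm_add Gm_Xv mult al_diff al_of_int al_0 Gm_of_nat if_distrib[of "al p c"] if_distrib[of "Gm p k f"] cong: if_cong del: of_int_mult of_nat_mult)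
qed

text \<open>With y = 1/z, the operator y d/dy applied to exp(- k sum_n alpha(n) y^n / n) brings down
  - k sum_n alpha(n) y^n. This records that the ring homomorphism behind \<open>Gm\<close> is the
  exponential of annihilation operators.\<close>

lemma Gm_rec: "of_nat f * Gm p k f q = - of_int k * (\<Sum>c\<in>{1..f}. al p c (Gm p k (f - c) q))"
proof (induction q arbitrary: f rule: pol_induct)
  case (const d)
  then show ?case by (auto simp: Gm_Cn if_distrib[of "al p _"] cong: if_cong)
next
  case (add q r)
  then show ?case by (simp add: Gm_add al_add sum.distrib distrib_left)
next
  case (mult j q)
  let ?M = "of_int (2 * int p * k) :: pol"
  have s1: "(\<Sum>c\<in>{1..f}. al p c (Gm p k (f - c) (Xv j * q))) =
     Xv j * (\<Sum>c\<in>{1..f}. al p c (Gm p k (f - c) q))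
     + (if 1 \<le> j \<and> j \<le> f then of_nat (2 * p * j) * Gm p k (f - j) q
          - ?M * (\<Sum>c\<in>{1..f - j}. al p c (Gm p k (f - j - c) q)) else 0)"
  proof -
    have "(\<Sum>c\<in>{1..f}. al p c (Gm p k (f - c) (Xv j * q))) =
      (\<Sum>c\<in>{1..f}. Xv j * al p c (Gm p k (f - c) q) + (if j = c then of_nat (2 * p * j) * Gm p k (f - j) q else 0)
         - (if 1 \<le> j \<and> j \<le> f - c then ?M * al p c (Gm p k (f - c - j) q) else 0))"
      by (intro sum.cong) (auto simp: Gm_Xv al_diff al_Xv al_of_int simp del: of_int_mult of_nat_mult)
    also have "\<dots> = Xv j * (\<Sum>c\<in>{1..f}. al p c (Gm p k (f - c) q))
       + (\<Sum>c\<in>{1..f}. (if j = c then of_nat (2 * p * j) * Gm p k (f - j) q else 0))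
       - (\<Sum>c\<in>{1..f}. (if 1 \<le> j \<and> j \<le> f - c then ?M * al p c (Gm p k (f - c - j) q) else 0))"
      by (simp add: sum.distrib sum_subtractf sum_distrib_left)
    also have "(\<Sum>c\<in>{1..f}. (if 1 \<le> j \<and> j \<le> f - c then ?M * al p c (Gm p k (f - c - j) q) else 0))
      = (if 1 \<le> j \<and> j \<le> f then ?M * (\<Sum>c\<in>{1..f - j}. al p c (Gm p k (f - j - c) q)) else 0)"
    proof (cases "1 \<le> j \<and> j \<le> f")
      case True
      have "(\<Sum>c\<in>{1..f}. (if 1 \<le> j \<and> j \<le> f - c then ?M * al p c (Gm p k (f - c - j) q) else 0))
        = (\<Sum>c\<in>{1..f - j}. ?M * al p c (Gm p k (f - j - c) q))"
        using True by (intro sum.mono_neutral_cong_right) (auto simp: diff_commute add.commute)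
      then show ?thesis using True by (simp add: sum_distrib_left)
    qed (auto intro!: sum.neutral)
    finally show ?thesis by (auto simp: sum.delta)
  qed
  show ?case
  proof (cases "1 \<le> j \<and> j \<le> f")
    case False
    have "of_nat f * Gm p k f (Xv j * q) = Xv j * (of_nat f * Gm p k f q)"
      using False by (auto simp: Gm_Xv mult.left_commute)
    also have "\<dots> = Xv j * (- of_int k * (\<Sum>c\<in>{1..f}. al p c (Gm p k (f - c) q)))" by (simp only: mult)
    finally show ?thesis unfolding s1 using False by (auto simp: mult.left_commute)
  next
    case True
    have ij: "of_nat (f - j) = (of_nat f - of_nat j :: pol)" using True by (simp add: of_nat_diff)
    have "of_nat (f - j) * Gm p k (f - j) q = - (of_int k * (\<Sum>c\<in>{1..f - j}. al p c (Gm p k (f - j - c) q)))"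
      using mult[of "f - j"] by (simp only: mult_minus_left)
    then have "of_int k * (\<Sum>c\<in>{1..f - j}. al p c (Gm p k (f - j - c) q)) = - (of_nat (f - j) * Gm p k (f - j) q)"
      by (simp only: minus_minus)
    then have i2: "of_int k * (\<Sum>c\<in>{1..f - j}. al p c (Gm p k (f - j - c) q)) = - (of_nat f - of_nat j) * Gm p k (f - j) q"
      by (simp only: ij mult_minus_left)
    have "of_nat f * Gm p k f (Xv j * q) = Xv j * (of_nat f * Gm p k f q) - ?M * (of_nat f * Gm p k (f - j) q)"
      unfolding Gm_Xv using True by (simp add: algebra_simps)
    also have "\<dots> = Xv j * (- of_int k * (\<Sum>c\<in>{1..f}. al p c (Gm p k (f - c) q))) 
         - of_int k * (of_nat (2 * p * j) * Gm p k (f - j) q)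
         + ?M * (of_int k * (\<Sum>c\<in>{1..f - j}. al p c (Gm p k (f - j - c) q)))"
      unfolding i2 using mult[of f] by (simp add: algebra_simps)
    also have "\<dots> = - of_int k * (\<Sum>c\<in>{1..f}. al p c (Gm p k (f - c) (Xv j * q)))"
      unfolding s1 using True by (simp add: algebra_simps)
    finally show ?thesis .
  qed
qed

section \<open>The coefficients of E^- and their exchange with E^+\<close>

lemma finite_bnd: "finite (bnd D)"
proof -
  have "finite (lkp ` bnd D)"
    by (rule finite_subset[OF _ finite_set_of_finite_funs[of "{1..D}" "{..D}" 0]])
       (auto simp: bnd_def in_keys_iff subset_iff)
  moreover have "inj_on lkp (bnd D)" by (rule inj_onI) (metis poly_mapping_eqI)
  ultimately show ?thesis using finite_imageD by blast
qed

lemma deg_ge: assumes "n \<in> pkeys nu" shows "n * lkp nu n \<le> deg nu"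
  unfolding deg_def using assms by (intro member_le_sum) auto

lemma deg_ge': assumes "n \<in> pkeys nu" shows "n \<le> deg nu"
proof -
  have "lkp nu n \<noteq> 0" using assms by (simp add: in_keys_iff)
  then have "n \<le> n * lkp nu n" by (cases "lkp nu n") auto
  then show ?thesis using deg_ge[OF assms] le_trans by blast
qed

definition mons :: "nat \<Rightarrow> mon set" where "mons g = {nu. 0 \<notin> pkeys nu \<and> deg nu = g}"

lemma mons_bnd: "g \<le> D \<Longrightarrow> mons g \<subseteq> bnd D"
proof
  fix nu assume a: "nu \<in> mons g" "g \<le> D"
  have "lkp nu n \<le> D" for n
  proof (cases "n \<in> pkeys nu")
    case True
    then have "n \<noteq> 0" using a by (metis (mono_tags, lifting) mem_Collect_eq mons_def)
    then have "lkp nu n \<le> n * lkp nu n" by (cases n) auto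
    moreover have "deg nu = g" using a by (simp add: mons_def)
    ultimately show ?thesis using deg_ge[OF True] a(2) by linarith
  qed (simp add: in_keys_iff)
  moreover have "pkeys nu \<subseteq> {1..D}"
  proof
    fix n assume n: "n \<in> pkeys nu"
    then have "n \<noteq> 0" using a by (metis (mono_tags, lifting) mem_Collect_eq mons_def)
    then show "n \<in> {1..D}" using deg_ge'[OF n] a by (auto simp: mons_def)
  qed
  ultimately show "nu \<in> bnd D" by (simp add: bnd_def)
qed

lemma finite_mons [simp]: "finite (mons g)"
  using finite_subset[OF mons_bnd[OF order_refl] finite_bnd] .

text \<open>The coefficient of the monomial \<open>nu\<close> in exp(k sum_n x_n / n), in exactly
  the form in which it occurs in \<open>Ybasis\<close>.\<close>

definition coe :: "complex \<Rightarrow> mon \<Rightarrow> complex" where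
  "coe k nu = (\<Prod>n\<in>pkeys nu. (k / of_nat n) ^ lkp nu n / fact (lkp nu n))"

lemma coe_superset: "finite B \<Longrightarrow> pkeys nu \<subseteq> B \<Longrightarrow> coe k nu = (\<Prod>n\<in>B. (k / of_nat n) ^ lkp nu n / fact (lkp nu n))"
  unfolding coe_def by (intro prod.mono_neutral_left) (auto simp: in_keys_iff)

lemma coe_0 [simp]: "coe k 0 = 1" by (simp add: coe_def)

lemma coe_add_single: "coe k (nu + sgl n 1) * of_nat (Suc (lkp nu n)) = k / of_nat n * coe k nu"
proof -
  let ?B = "insert n (pkeys nu)"
  let ?h = "\<lambda>mu x. (k / of_nat x) ^ lkp mu x / fact (lkp mu x)"
  have "coe k (nu + sgl n 1) = (\<Prod>x\<in>?B. ?h (nu + sgl n 1) x)"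
    using keys_add[of nu "sgl n 1"] by (intro coe_superset) auto
  also have "\<dots> = ?h (nu + sgl n 1) n * (\<Prod>x\<in>?B - {n}. ?h (nu + sgl n 1) x)"
    by (intro prod.remove) auto
  also have "(\<Prod>x\<in>?B - {n}. ?h (nu + sgl n 1) x) = (\<Prod>x\<in>?B - {n}. ?h nu x)"
    by (intro prod.cong) (auto simp: lookup_add lookup_single when_def)
  finally have 1: "coe k (nu + sgl n 1) = ?h (nu + sgl n 1) n * (\<Prod>x\<in>?B - {n}. ?h nu x)" .
  have "coe k nu = (\<Prod>x\<in>?B. ?h nu x)" by (intro coe_superset) auto
  also have "\<dots> = ?h nu n * (\<Prod>x\<in>?B - {n}. ?h nu x)" by (intro prod.remove) auto
  finally have 2: "coe k nu = ?h nu n * (\<Prod>x\<in>?B - {n}. ?h nu x)" .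
  have 3: "?h (nu + sgl n 1) n * of_nat (Suc (lkp nu n)) = k / of_nat n * ?h nu n"
  proof -
    have l: "lkp (nu + sgl n 1) n = Suc (lkp nu n)" by (simp add: lookup_add)
    show ?thesis unfolding l by (simp del: of_nat_Suc)
  qed
  have 4: "A * R * N = (A * N) * R" for A R N :: complex by simp
  show ?thesis unfolding 1 2 by (subst 4, subst 3) (rule mult.assoc)
qed

text \<open>The coefficient of z^g in E^- = exp(k sum_n x_n z^n / n), for k = 1 an elementary Schur
  polynomial in rescaled variables. The index is an integer, with value 0 below zero, so that shifts
  of the index need no side condition.\<close>

definition Sc :: "int \<Rightarrow> int \<Rightarrow> pol" where
  "Sc k g = (if g < 0 then 0 else \<Sum>nu\<in>mons (nat g). Cn (coe (of_int k) nu) * Mo nu)"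

lemma Sc_neg [simp]: "g < 0 \<Longrightarrow> Sc k g = 0" by (simp add: Sc_def)

lemma lookup_Sc: "lkp (Sc k g) nu = (if 0 \<notin> pkeys nu \<and> int (deg nu) = g then coe (of_int k) nu else 0)"
proof (cases "g < 0")
  case False
  have "lkp (Sc k g) nu = (\<Sum>mu\<in>mons (nat g). coe (of_int k) mu * (if mu = nu then 1 else 0))"
    using False by (simp add: Sc_def lookup_sum Mo_def lookup_single when_def)
  also have "\<dots> = (\<Sum>mu\<in>mons (nat g). if mu = nu then coe (of_int k) nu else 0)"
    by (intro sum.cong) auto
  also have "\<dots> = (if nu \<in> mons (nat g) then coe (of_int k) nu else 0)" by simp
  finally have "lkp (Sc k g) nu = (if nu \<in> mons (nat g) then coe (of_int k) nu else 0)" .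
  then show ?thesis using False by (auto simp: sum.delta mons_def)
qed auto

lemma Sc_zero_idx [simp]: "Sc k 0 = 1"
proof -
  have "deg nu = 0 \<Longrightarrow> 0 \<notin> pkeys nu \<Longrightarrow> nu = 0" for nu
    using deg_ge'[of _ nu] by (metis all_not_in_conv keys_eq_empty le_zero_eq)
  then show ?thesis
    by (intro poly_mapping_eqI) (auto simp: lookup_Sc lookup_one when_def)
qed

text \<open>Euler's identity for the exponential, compared monomial by monomial: by
  \<open>coe_add_single\<close> the n-th summand contributes n times the exponent of x_n to the
  coefficient of \<open>nu\<close>, and these numbers add up to the degree.\<close>

lemma Sc_rec: "of_int g * Sc k g = of_int k * (\<Sum>n\<in>{1..nat g}. Xv n * Sc k (g - int n))"
proof (rule poly_mapping_eqI)
  fix nu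
  have L: "lkp (of_int g * Sc k g) nu = of_int g * lkp (Sc k g) nu"
    using lookup_Cn_mult[of "of_int g"] by (simp add: Cn_of_int)
  have R: "lkp (of_int k * (\<Sum>n\<in>{1..nat g}. Xv n * Sc k (g - int n))) nu
     = of_int k * (\<Sum>n\<in>{1..nat g}. if lkp nu n = 0 then 0 else lkp (Sc k (g - int n)) (nu - sgl n 1))"
    using lookup_Cn_mult[of "of_int k"] by (simp add: Cn_of_int lookup_sum lookup_Xv_mult)
  have D: "deg nu = deg (nu - sgl n 1) + n" if "lkp nu n \<noteq> 0" for n
    using sub_single_add[OF that] deg_add[of "nu - sgl n 1" "sgl n 1"] by simp
  have K: "0 \<in> pkeys (nu - sgl n 1) \<longleftrightarrow> 0 \<in> pkeys nu" if "n \<noteq> 0" for n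
    using that by (auto simp: in_keys_iff lookup_sub_single)
  have T: "of_int k * (if lkp nu n = 0 then 0 else lkp (Sc k (g - int n)) (nu - sgl n 1))
     = (if 0 \<notin> pkeys nu \<and> int (deg nu) = g then of_nat (n * lkp nu n) * coe (of_int k) nu else 0)" if "n \<noteq> 0" for n
  proof (cases "lkp nu n = 0")
    case False
    have c: "coe (of_int k) nu * of_nat (lkp nu n) = of_int k / of_nat n * coe (of_int k) (nu - sgl n 1)"
      using coe_add_single[of "of_int k" "nu - sgl n 1" n] sub_single_add[OF False] False
      by (simp add: lookup_sub_single)
    then have "of_int k * coe (of_int k) (nu - sgl n 1) = of_nat n * of_nat (lkp nu n) * coe (of_int k) nu"
      using that by (simp add: field_simps)
    then show ?thesis using False D[OF False] K[OF that] by (auto simp: lookup_Sc)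
  qed auto
  have "lkp (of_int k * (\<Sum>n\<in>{1..nat g}. Xv n * Sc k (g - int n))) nu
     = (\<Sum>n\<in>{1..nat g}. if 0 \<notin> pkeys nu \<and> int (deg nu) = g then of_nat (n * lkp nu n) * coe (of_int k) nu else 0)"
    by (subst R, subst sum_distrib_left, intro sum.cong refl T) auto
  also have "\<dots> = of_int g * lkp (Sc k g) nu"
  proof (cases "0 \<notin> pkeys nu \<and> int (deg nu) = g")
    case True
    have "pkeys nu \<subseteq> {1..nat g}"
    proof
      fix n assume n: "n \<in> pkeys nu"
      then have "n \<noteq> 0" using True by metis
      then show "n \<in> {1..nat g}" using deg_ge'[OF n] True by auto
    qed
    then have "(\<Sum>n\<in>{1..nat g}. n * lkp nu n) = deg nu"
      unfolding deg_def by (intro sum.mono_neutral_right) (auto simp: in_keys_iff)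
    then have "(\<Sum>n\<in>{1..nat g}. of_nat (n * lkp nu n)) = (of_int g :: complex)"
      using True by (metis of_int_of_nat_eq of_nat_sum)
    then show ?thesis using True by (simp add: lookup_Sc sum_distrib_right[symmetric] del: of_nat_mult)
  qed (auto simp: lookup_Sc)
  finally show "lkp (of_int g * Sc k g) nu = lkp (of_int k * (\<Sum>n\<in>{1..nat g}. Xv n * Sc k (g - int n))) nu"
    using L by simp
qed

lemma pol_cancel: "g \<noteq> 0 \<Longrightarrow> of_int g * (q::pol) = of_int g * r \<Longrightarrow> q = r"
  by simp

lemma Sc_rec': assumes "nat g \<le> K"
  shows "of_int k * (\<Sum>n\<in>{1..K}. Xv n * Sc k (g - int n)) = of_int g * Sc k g"
proof -
  have "(\<Sum>n\<in>{1..K}. Xv n * Sc k (g - int n)) = (\<Sum>n\<in>{1..nat g}. Xv n * Sc k (g - int n))"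
    using assms by (intro sum.mono_neutral_right) auto
  then show ?thesis using Sc_rec by simp
qed

lemma Sc_induct: assumes "\<And>g. (\<And>g'. g' < g \<Longrightarrow> P g') \<Longrightarrow> P g" "\<And>g. g < 0 \<Longrightarrow> P g" shows "P (g::int)"
proof (induction "nat (g + 1)" arbitrary: g rule: less_induct)
  case less
  show ?case
  proof (cases "g < 0")
    case False
    show ?thesis
    proof (rule assms(1))
      fix g' assume "g' < g"
      then show "P g'" using False by (intro less) auto
    qed
  qed (rule assms(2))
qed

text \<open>On the generating series alpha(c) acts as multiplication by 2pk z^c. The induction
  multiplies by g, so that \<open>Sc_rec\<close> applies on both sides, and cancels g at the
  end.\<close>

lemma al_Sc: assumes "c \<ge> 1" shows "al p c (Sc k g) = of_int (2 * int p * k) * Sc k (g - int c)"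
proof (induction g rule: Sc_induct)
  case (1 g)
  show ?case
  proof (cases "g \<le> 0")
    case True then show ?thesis using assms by (cases "g = 0") auto
  next
    case False
    have "of_int g * al p c (Sc k g) = al p c (of_int g * Sc k g)" by (simp add: al_of_int)
    also have "\<dots> = of_int k * (\<Sum>n\<in>{1..nat g}. al p c (Xv n * Sc k (g - int n)))"
      by (simp add: Sc_rec al_of_int al_sum)
    also have "(\<Sum>n\<in>{1..nat g}. al p c (Xv n * Sc k (g - int n)))
       = (\<Sum>n\<in>{1..nat g}. of_int (2 * int p * k) * (Xv n * Sc k (g - int c - int n))
            + (if n = c then of_nat (2 * p * c) * Sc k (g - int c) else 0))"
    proof (intro sum.cong refl)
      fix n assume n: "n \<in> {1..nat g}"
      have e: "g - int n - int c = g - int c - int n" by simp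
      from n have "al p c (Sc k (g - int n)) = of_int (2 * int p * k) * Sc k (g - int c - int n)"
        using 1[of "g - int n"] unfolding e by simp
      then show "al p c (Xv n * Sc k (g - int n)) = of_int (2 * int p * k) * (Xv n * Sc k (g - int c - int n))
            + (if n = c then of_nat (2 * p * c) * Sc k (g - int c) else 0)"
        unfolding al_Xv by (simp add: mult.left_commute)
    qed
    also have "\<dots> = of_int (2 * int p * k) * (\<Sum>n\<in>{1..nat g}. Xv n * Sc k (g - int c - int n))
        + of_nat (2 * p * c) * Sc k (g - int c)"
      using assms False by (auto simp: sum.distrib sum.delta sum_distrib_left simp del: of_nat_mult of_int_mult)
    finally have "of_int g * al p c (Sc k g) = of_int (2 * int p * k) * (of_int k * (\<Sum>n\<in>{1..nat g}. Xv n * Sc k (g - int c - int n)))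
        + of_int k * of_nat (2 * p * c) * Sc k (g - int c)" by (simp add: algebra_simps)
    also have "of_int k * (\<Sum>n\<in>{1..nat g}. Xv n * Sc k (g - int c - int n)) = of_int (g - int c) * Sc k (g - int c)"
      by (rule Sc_rec') auto
    also have "of_int (2 * int p * k) * (of_int (g - int c) * Sc k (g - int c)) + of_int k * of_nat (2 * p * c) * Sc k (g - int c)
      = of_int g * (of_int (2 * int p * k) * Sc k (g - int c))" by (simp add: algebra_simps)
    finally have E: "of_int g * al p c (Sc k g) = of_int g * (of_int (2 * int p * k) * Sc k (g - int c))" .
    show ?thesis by (rule pol_cancel[OF _ E]) (use False in auto)
  qed
next
  case (2 g) then show ?case by simp
qed

text \<open>The coefficient of t^i in (1 - t)^M.\<close>

definition sb :: "complex \<Rightarrow> nat \<Rightarrow> complex" where "sb M i = (-1) ^ i * (M gchoose i)"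

lemma sb_0 [simp]: "sb M 0 = 1" by (simp add: sb_def)

lemma sb_rec: "of_nat i * sb M i = - M * (\<Sum>n\<in>{1..i}. sb M (i - n))"
proof (cases i)
  case (Suc j)
  have "(\<Sum>n\<in>{1..i}. sb M (i - n)) = (\<Sum>n\<le>j. sb M n)"
    by (rule sum.reindex_bij_witness[of _ "\<lambda>n. i - n" "\<lambda>n. i - n"]) (auto simp: Suc One_nat_def)
  also have "\<dots> = (-1) ^ j * (M - 1 gchoose j)"
    using gbinomial_sum_lower_neg[of M j] by (simp add: sb_def mult.commute)
  finally have s: "(\<Sum>n\<in>{1..i}. sb M (i - n)) = (-1) ^ j * (M - 1 gchoose j)" .
  have "of_nat i * sb M i = - ((-1) ^ j * (of_nat (Suc j) * (M gchoose Suc j)))"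
    by (simp add: Suc sb_def algebra_simps)
  also have "\<dots> = - M * ((-1) ^ j * (M - 1 gchoose j))"
    unfolding gbinomial_absorption by (simp add: algebra_simps)
  finally show ?thesis unfolding s .
qed simp

lemma sb_conv: "(\<Sum>i\<le>n. sb M i * sb N (n - i)) = sb (M + N) n"
proof -
  have "(\<Sum>i\<le>n. sb M i * sb N (n - i)) = (\<Sum>i\<le>n. (-1) ^ n * ((M gchoose i) * (N gchoose (n - i))))"
  proof (intro sum.cong refl)
    fix i assume "i \<in> {..n}"
    then have "(-1::complex) ^ n = (-1) ^ i * (-1) ^ (n - i)" by (simp add: power_add[symmetric])
    then show "sb M i * sb N (n - i) = (-1) ^ n * ((M gchoose i) * (N gchoose (n - i)))"
      by (simp add: sb_def)
  qed
  then show ?thesis by (simp add: sb_def sum_distrib_left[symmetric] gbinomial_Vandermonde atMost_atLeast0)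
qed

text \<open>The exchange relation: moving E^+ of e^(k alpha) at x past E^- of e^(l alpha) at z costs
  the factor (1 - z/x)^(2pkl). All products of vertex operators below get their powers of x - z from
  here.\<close>

lemma Gm_Sc: "Gm p k i (Sc l g) = Cn (sb (of_int (2 * int p * k * l)) i) * Sc l (g - int i)"
proof (induction g arbitrary: i rule: Sc_induct)
  case (1 g)
  define M :: complex where "M = of_int (2 * int p * k * l)"
  show ?case unfolding M_def[symmetric]
  proof (cases "g \<le> 0")
    case True then show "Gm p k i (Sc l g) = Cn (sb M i) * Sc l (g - int i)"
      by (cases "g = 0"; cases "i = 0") (auto simp: Gm_1)
  next
    case False
    have IH: "Gm p k i (Sc l (g - int n)) = Cn (sb M i) * Sc l (g - int n - int i)" if "n \<ge> 1" for i n
      using 1[of "g - int n" i] that by (simp add: M_def)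
    have "of_int g * Gm p k i (Sc l g) = of_int l * (\<Sum>n\<in>{1..nat g}. Gm p k i (Xv n * Sc l (g - int n)))"
      by (metis Gm_of_int Gm_sum Sc_rec)
    also have "(\<Sum>n\<in>{1..nat g}. Gm p k i (Xv n * Sc l (g - int n)))
      = (\<Sum>n\<in>{1..nat g}. Cn (sb M i) * (Xv n * Sc l (g - int i - int n))
           - (if n \<le> i then of_int (2 * int p * k) * (Cn (sb M (i - n)) * Sc l (g - int i)) else 0))"
    proof (intro sum.cong refl)
      fix n assume n: "n \<in> {1..nat g}"
      have e: "g - int n - int i = g - int i - int n" by simp
      have "g - int n - int (i - n) = g - int i" if "n \<le> i" using that by simp
      then show "Gm p k i (Xv n * Sc l (g - int n)) = Cn (sb M i) * (Xv n * Sc l (g - int i - int n))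
           - (if n \<le> i then of_int (2 * int p * k) * (Cn (sb M (i - n)) * Sc l (g - int i)) else 0)"
        using n IH[of n] unfolding e[symmetric] by (simp add: Gm_Xv mult.left_commute)
    qed
    also have "\<dots> = Cn (sb M i) * (\<Sum>n\<in>{1..nat g}. Xv n * Sc l (g - int i - int n))
        - of_int (2 * int p * k) * ((\<Sum>n\<in>{1..nat g}. if n \<le> i then Cn (sb M (i - n)) else 0) * Sc l (g - int i))"
      by (simp add: sum_subtractf sum_distrib_left sum_distrib_right if_distrib[of "\<lambda>x. x * _"] if_distrib[of "\<lambda>x. _ * x"] cong: if_cong)
    also have "(\<Sum>n\<in>{1..nat g}. if n \<le> i then Cn (sb M (i - n)) else 0) * Sc l (g - int i)
       = Cn (\<Sum>n\<in>{1..i}. sb M (i - n)) * Sc l (g - int i)"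
    proof (cases "int i \<le> g")
      case True
      have "(\<Sum>n\<in>{1..nat g}. if n \<le> i then Cn (sb M (i - n)) else 0) = (\<Sum>n\<in>{1..i}. Cn (sb M (i - n)))"
        using True by (intro sum.mono_neutral_cong_right) auto
      then show ?thesis by (simp add: Cn_sum)
    qed simp
    finally have "of_int g * Gm p k i (Sc l g) = Cn (sb M i) * (of_int l * (\<Sum>n\<in>{1..nat g}. Xv n * Sc l (g - int i - int n)))
        - of_int (2 * int p * k * l) * (Cn (\<Sum>n\<in>{1..i}. sb M (i - n)) * Sc l (g - int i))"
      by (simp add: algebra_simps)
    also have "of_int l * (\<Sum>n\<in>{1..nat g}. Xv n * Sc l (g - int i - int n)) = of_int (g - int i) * Sc l (g - int i)"
      by (rule Sc_rec') auto
    also have "of_int (2 * int p * k * l) * (Cn (\<Sum>n\<in>{1..i}. sb M (i - n)) * Sc l (g - int i))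
       = - (of_nat i * (Cn (sb M i) * Sc l (g - int i)))"
    proof -
      have "Cn (M * (\<Sum>n\<in>{1..i}. sb M (i - n))) = - Cn (of_nat i * sb M i)"
        unfolding sb_rec by (simp add: Cn_uminus[symmetric])
      moreover have "Cn M = of_int (2 * int p * k * l)" unfolding M_def by (rule Cn_of_int)
      ultimately have "of_int (2 * int p * k * l) * Cn (\<Sum>n\<in>{1..i}. sb M (i - n)) = - (of_nat i * Cn (sb M i))"
        by (simp only: Cn_mult Cn_of_nat)
      then show ?thesis by (simp only: mult.assoc[symmetric] mult_minus_left)
    qed
    finally have E: "of_int g * Gm p k i (Sc l g) = of_int g * (Cn (sb M i) * Sc l (g - int i))"
      by (simp add: algebra_simps)
    show "Gm p k i (Sc l g) = Cn (sb M i) * Sc l (g - int i)" by (rule pol_cancel[OF _ E]) (use False in auto)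
  qed
next
  case (2 g) then show ?case by simp
qed

text \<open>The operators E^+ are exponentials of multiples of one operator, hence additive in
  k.\<close>

lemma Gm_comp: "Gm p (k + l) f q = (\<Sum>i\<le>f. Gm p k i (Gm p l (f - i) q))"
proof (induction q arbitrary: f rule: pol_induct)
  case (const d)
  have "(\<Sum>i\<le>f. Gm p k i (Gm p l (f - i) (Cn d))) = (\<Sum>i\<le>f. if i = f then Gm p k f (Cn d) else 0)"
    by (intro sum.cong) (auto simp: Gm_Cn)
  then show ?case by (simp add: Gm_Cn)
next
  case (add q r) then show ?case by (simp add: Gm_add sum.distrib)
next
  case (mult j q)
  let ?A = "1 \<le> j \<and> j \<le> f"
  have "(\<Sum>i\<le>f. Gm p k i (Gm p l (f - i) (Xv j * q)))
     = (\<Sum>i\<le>f. Xv j * Gm p k i (Gm p l (f - i) q) 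
          - (if 1 \<le> j \<and> j \<le> i then of_int (2 * int p * k) * Gm p k (i - j) (Gm p l (f - i) q) else 0)
          - (if 1 \<le> j \<and> j \<le> f - i then of_int (2 * int p * l) * Gm p k i (Gm p l (f - i - j) q) else 0))"
    by (intro sum.cong) (auto simp: Gm_Xv Gm_diff Gm_of_int simp del: of_int_mult)
  also have "\<dots> = Xv j * Gm p (k + l) f q 
       - (\<Sum>i\<le>f. if 1 \<le> j \<and> j \<le> i then of_int (2 * int p * k) * Gm p k (i - j) (Gm p l (f - i) q) else 0)
       - (\<Sum>i\<le>f. if 1 \<le> j \<and> j \<le> f - i then of_int (2 * int p * l) * Gm p k i (Gm p l (f - i - j) q) else 0)"
    by (simp add: sum_subtractf sum_distrib_left mult)
  also have "(\<Sum>i\<le>f. if 1 \<le> j \<and> j \<le> i then of_int (2 * int p * k) * Gm p k (i - j) (Gm p l (f - i) q) else 0)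
     = (if ?A then of_int (2 * int p * k) * Gm p (k + l) (f - j) q else 0)"
  proof (cases ?A)
    case True
    have "(\<Sum>i\<le>f. if 1 \<le> j \<and> j \<le> i then of_int (2 * int p * k) * Gm p k (i - j) (Gm p l (f - i) q) else 0)
       = (\<Sum>i\<in>{j..f}. of_int (2 * int p * k) * Gm p k (i - j) (Gm p l (f - i) q))"
      using True by (intro sum.mono_neutral_cong_right) auto
    also have "\<dots> = (\<Sum>i\<le>f - j. of_int (2 * int p * k) * Gm p k i (Gm p l (f - j - i) q))"
      using True by (intro sum.reindex_bij_witness[of _ "\<lambda>i. i + j" "\<lambda>i. i - j"]) auto
    finally show ?thesis using True by (simp add: mult sum_distrib_left)
  qed (auto intro!: sum.neutral)
  also have "(\<Sum>i\<le>f. if 1 \<le> j \<and> j \<le> f - i then of_int (2 * int p * l) * Gm p k i (Gm p l (f - i - j) q) else 0)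
     = (if ?A then of_int (2 * int p * l) * Gm p (k + l) (f - j) q else 0)"
  proof (cases ?A)
    case True
    have "(\<Sum>i\<le>f. if 1 \<le> j \<and> j \<le> f - i then of_int (2 * int p * l) * Gm p k i (Gm p l (f - i - j) q) else 0)
       = (\<Sum>i\<le>f - j. of_int (2 * int p * l) * Gm p k i (Gm p l (f - j - i) q))"
      using True by (intro sum.mono_neutral_cong_right) (auto simp: diff_commute add.commute)
    then show ?thesis using True by (simp add: mult sum_distrib_left)
  qed (auto intro!: sum.neutral)
  finally have F: "(\<Sum>i\<le>f. Gm p k i (Gm p l (f - i) (Xv j * q))) = Xv j * Gm p (k + l) f q
     - (if ?A then of_int (2 * int p * k) * Gm p (k + l) (f - j) q else 0)
     - (if ?A then of_int (2 * int p * l) * Gm p (k + l) (f - j) q else 0)" .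
  show ?case unfolding F by (subst Gm_Xv) (simp add: algebra_simps)
qed

lemma Gm_commute: "Gm p k f (Gm p l g q) = Gm p l g (Gm p k f q)"
proof (induction q arbitrary: f g rule: pol_induct)
  case (const d) then show ?case by (auto simp: Gm_Cn)
next
  case (add q r) then show ?case by (simp add: Gm_add)
next
  case (mult j q) then show ?case by (simp add: Gm_Xv Gm_diff Gm_of_int if_distrib[of "Gm p _ _"] cong: if_cong del: of_int_mult)
qed

section \<open>Vertex operators as Laurent series\<close>

unbundle fps_syntax
notation fls_nth (infixl "$$" 75)

text \<open>This is z^n; the sign is there because \<open>fls_shift\<close> divides by a power of
  z.\<close>

definition zp :: "int \<Rightarrow> pol fls" where "zp n = fls_shift (- n) 1"
definition kc :: "complex \<Rightarrow> pol fls" where "kc c = fls_const (Cn c)"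

lemma zp_mult_nth [simp]: "(zp n * F) $$ N = F $$ (N - n)"
  unfolding zp_def using fls_X_intpow_times_conv_shift(1)[of n F] by simp
lemma zp_nth: "zp n $$ N = (if N = n then 1 else 0)" by (simp add: zp_def)
lemma zp_add: "zp m * zp n = zp (m + n)" unfolding zp_def by (rule fls_X_intpow_times_fls_X_intpow)
lemma zp_add_left: "zp m * (zp n * F) = zp (m + n) * F" by (simp add: mult.assoc[symmetric] zp_add)
lemma zp_0 [simp]: "zp 0 = 1" by (simp add: zp_def)
lemma kc_mult_nth [simp]: "(kc c * F) $$ N = Cn c * F $$ N" by (simp add: kc_def)
lemma kc_hom: "rhom kc" using rhom_fCn by (simp add: kc_def[abs_def])
lemma kc_add: "kc (a + b) = kc a + kc b" using kc_hom by (simp add: rhom_def)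
lemma kc_mult: "kc (a * b) = kc a * kc b" using kc_hom by (simp add: rhom_def)
lemma kc_0 [simp]: "kc 0 = 0" by (simp add: kc_def)
lemma kc_1 [simp]: "kc 1 = 1" by (simp add: kc_def)
lemma kc_uminus: "kc (- a) = - kc a" by (simp add: kc_def Cn_uminus)
lemma kc_sum: "kc (sum f A) = (\<Sum>x\<in>A. kc (f x))"
  by (induction A rule: infinite_finite_induct) (auto simp: kc_add)

lemma fls_const_mult_nth [simp]: "(fls_const q * F) $$ N = (q::pol) * F $$ N" by simp

text \<open>The Cauchy product with arbitrary lower bounds in place of the exact subdegrees, which
  are not known for most series below.\<close>

lemma fls_times_nth_lb:
  fixes F G :: "'a::comm_ring_1 fls"
  assumes "\<And>n. n < l \<Longrightarrow> F $$ n = 0" "\<And>n. n < m \<Longrightarrow> G $$ n = 0"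
  shows "(F * G) $$ N = (\<Sum>j\<in>{l..N - m}. F $$ j * G $$ (N - j))"
proof -
  have "(F * G) $$ N = (\<Sum>j\<in>{fls_subdegree F..N - fls_subdegree G}. F $$ j * G $$ (N - j))"
    by (rule fls_times_nth(2))
  also have "\<dots> = (\<Sum>j\<in>{l..N - m}. F $$ j * G $$ (N - j))"
  proof (rule sum.mono_neutral_cong)
    show "F $$ i * G $$ (N - i) = 0" if "i \<in> {l..N - m} - {fls_subdegree F..N - fls_subdegree G}" for i
    proof (cases "i < fls_subdegree F")
      case True then show ?thesis by (simp add: fls_eq0_below_subdegree)
    next
      case False then have "N - i < fls_subdegree G" using that by auto
      then show ?thesis by (simp add: fls_eq0_below_subdegree)
    qed
    show "F $$ i * G $$ (N - i) = 0" if "i \<in> {fls_subdegree F..N - fls_subdegree G} - {l..N - m}" for i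
    proof (cases "i < l")
      case True then show ?thesis using assms by simp
    next
      case False then have "N - i < m" using that by auto
      then show ?thesis using assms by simp
    qed
  qed auto
  finally show ?thesis .
qed

definition fmap :: "(pol \<Rightarrow> pol) \<Rightarrow> pol fls \<Rightarrow> pol fls" where
  "fmap T F = Abs_fls (\<lambda>N. T (F $$ N))"

lemma fmap_nth [simp]: assumes "T 0 = 0" shows "fmap T F $$ N = T (F $$ N)"
  unfolding fmap_def using assms
  by (intro nth_Abs_fls_lower_bound[of "fls_subdegree F"]) (auto simp: fls_eq0_below_subdegree)

definition Em :: "int \<Rightarrow> pol fls" where "Em k = fps_to_fls (Abs_fps (\<lambda>g. Sc k (int g)))"

lemma Em_nth [simp]: "Em k $$ N = Sc k N" by (simp add: Em_def)

text \<open>Some bound after which the coefficients of E^+ on \<open>q\<close> vanish, enough to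
  write \<open>Ep\<close> as a finite sum. The explicit bound \<open>vb q\<close> is available only
  after the degree argument in \<open>Gm_zero\<close>.\<close>

definition gb :: "nat \<Rightarrow> int \<Rightarrow> pol \<Rightarrow> nat" where
  "gb p k q = (SOME F. \<forall>f>F. Gm p k f q = 0)"

lemma Gm_gb: "f > gb p k q \<Longrightarrow> Gm p k f q = 0"
  unfolding gb_def using someI_ex[OF Gm_bound[of p k q]] by blast

definition Ep :: "nat \<Rightarrow> int \<Rightarrow> pol \<Rightarrow> pol fls" where
  "Ep p k q = (\<Sum>f\<le>gb p k q. fls_const (Gm p k f q) * zp (- int f))"

lemma Ep_nth: "Ep p k q $$ N = (if N \<le> 0 then Gm p k (nat (- N)) q else 0)"
proof -
  have "Ep p k q $$ N = (\<Sum>f\<le>gb p k q. Gm p k f q * (if f = nat (- N) \<and> N \<le> 0 then 1 else 0))"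
    unfolding Ep_def fls_nth_sum fls_const_mult_nth by (intro sum.cong) (auto simp: zp_nth)
  also have "\<dots> = (\<Sum>f\<le>gb p k q. if f = nat (- N) then (if N \<le> 0 then Gm p k (nat (- N)) q else 0) else 0)"
    by (intro sum.cong) auto
  also have "\<dots> = (if N \<le> 0 then Gm p k (nat (- N)) q else 0)"
    by (auto simp: Gm_gb)
  finally show ?thesis .
qed

lemma Ep_sum: "F \<ge> gb p k q \<Longrightarrow> Ep p k q = (\<Sum>f\<le>F. fls_const (Gm p k f q) * zp (- int f))"
  unfolding Ep_def by (intro sum.mono_neutral_left) (auto simp: Gm_gb)

lemma Ep_add: "Ep p k (q + r) = Ep p k q + Ep p k r"
  by (auto simp: fls_eq_iff Ep_nth Gm_add)
lemma Ep_0 [simp]: "Ep p k 0 = 0" by (auto simp: fls_eq_iff Ep_nth)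
lemma Ep_Cn_mult: "Ep p k (Cn c * q) = kc c * Ep p k q"
  by (auto simp: fls_eq_iff Ep_nth Gm_Cn_mult)

section \<open>Degree bounds, and vertex operators by recursion\<close>

definition vb :: "pol \<Rightarrow> nat" where "vb q = Max (insert 0 (deg ` pkeys q))"

lemma vb_le_iff: "vb q \<le> D \<longleftrightarrow> (\<forall>nu\<in>pkeys q. deg nu \<le> D)"
  by (auto simp: vb_def)

lemma vb_add: "vb q \<le> D \<Longrightarrow> vb r \<le> D \<Longrightarrow> vb (q + r) \<le> D"
  unfolding vb_le_iff using keys_add[of q r] by blast
lemma vb_mult: "vb q \<le> D \<Longrightarrow> vb r \<le> E \<Longrightarrow> vb (q * r) \<le> D + E"
  unfolding vb_le_iff using keys_mult[of q r] by (force simp: deg_add intro: add_mono)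
lemma vb_Cn [simp]: "vb (Cn c) = 0" by (auto simp: vb_def Cn_def)
lemma vb_1 [simp]: "vb 1 = 0" using vb_Cn[of 1] by (simp del: vb_Cn)
lemma vb_of_int_mult: "vb (of_int c * q) \<le> vb q"
  using vb_mult[of "Cn (of_int c)" 0 q "vb q"] vb_Cn[of "of_int c"] by (simp add: Cn_of_int del: vb_Cn)
lemma vb_0 [simp]: "vb 0 = 0" by (simp add: vb_def)
lemma vb_uminus: "vb (- q) = vb q" by (simp add: vb_def)
lemma vb_diff: "vb q \<le> D \<Longrightarrow> vb r \<le> D \<Longrightarrow> vb (q - r) \<le> D"
  using vb_add[of q D "- r"] by (simp add: vb_uminus)

lemma al_zero: assumes "c > vb q" shows "al p c q = 0"
proof -
  have "of_nat (2 * p * c * lkp nu c) = (0::complex)" if "nu \<in> pkeys q" for nu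
  proof (cases "c \<in> pkeys nu")
    case True
    then have "c \<le> deg nu" by (rule deg_ge')
    moreover have "deg nu \<le> vb q" using that vb_le_iff[of q "vb q"] by auto
    ultimately show ?thesis using assms by simp
  qed (simp add: in_keys_iff)
  then show ?thesis unfolding al_def lext_def by (intro sum.neutral ballI) (simp del: of_nat_mult)
qed

lemma al0_zero: "c > vb q \<Longrightarrow> al0 p a c q = 0" by (auto simp: al0_def al_zero)

lemma vb_sgl: "vb (sgl nu d) \<le> deg nu" by (auto simp: vb_le_iff split: if_splits)

lemma vb_sum: "(\<And>x. x \<in> A \<Longrightarrow> vb (f x) \<le> D) \<Longrightarrow> vb (sum f A) \<le> D"
proof (induction A rule: infinite_finite_induct)
  case (insert x F) then show ?case by (auto intro: vb_add)
qed (simp_all add: vb_def)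

lemma vb_al: "vb (al p c q) \<le> vb q"
proof -
  have "vb (Cn (lkp q nu) * (Cn (of_nat (2 * p * c * lkp nu c)) * Mo (nu - sgl c 1))) \<le> vb q" if "nu \<in> pkeys q" for nu
  proof (cases "lkp nu c = 0")
    case False
    have "deg nu = deg (nu - sgl c 1) + c"
      using sub_single_add[OF False] deg_add[of "nu - sgl c 1" "sgl c 1"] by simp
    moreover have "deg nu \<le> vb q" using that vb_le_iff[of q "vb q"] by auto
    ultimately have "deg (nu - sgl c 1) \<le> vb q" by simp
    moreover have "vb (Cn (lkp q nu) * (Cn (of_nat (2 * p * c * lkp nu c)) * Mo (nu - sgl c 1))) \<le> deg (nu - sgl c 1)"
      by (simp add: Mo_def Cn_mult_single vb_sgl del: of_nat_mult)
    ultimately show ?thesis by linarith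
  qed (simp add: vb_def)
  then show ?thesis unfolding al_def lext_def by (intro vb_sum) auto
qed

lemma vb_al0: "vb (al0 p a c q) \<le> vb q"
  by (auto simp: al0_def vb_al vb_of_int_mult)

lemma vb_Gm: "vb (Gm p k f q) \<le> vb q"
proof -
  have m: "vb (Gm p k f (Mo nu)) \<le> deg nu" for nu f
  proof (induction nu arbitrary: f rule: mon_induct_in[OF subset_UNIV])
    case 1 then show ?case by (simp add: Gm_1)
  next
    case (2 n mu)
    have e: "Mo (mu + sgl n 1) = Xv n * Mo mu" by (simp add: Mo_add Xv_def mult.commute)
    have "vb (Xv n * Gm p k f (Mo mu)) \<le> n + deg mu"
      using vb_sgl[of "sgl n 1" 1] 2(3) by (intro vb_mult) (auto simp: Xv_def Mo_def)
    moreover have "vb (of_int (2 * int p * k) * Gm p k (f - n) (Mo mu)) \<le> n + deg mu"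
      using 2(3)[of "f - n"] vb_of_int_mult[of "2 * int p * k" "Gm p k (f - n) (Mo mu)"] by linarith
    ultimately show ?case unfolding e Gm_Xv deg_add
      by (cases "1 \<le> n \<and> n \<le> f") (auto simp del: of_int_mult simp: add.commute intro: vb_diff)
  qed
  have "Gm p k f q = (\<Sum>nu\<in>pkeys q. Cn (lkp q nu) * Gm p k f (Mo nu))"
    by (subst pol_expand[of q]) (simp add: Gm_sum sgl_eq Gm_Cn_mult)
  also have "vb \<dots> \<le> vb q"
  proof (rule vb_sum)
    fix nu assume "nu \<in> pkeys q"
    then have "deg nu \<le> vb q" using vb_le_iff[of q "vb q"] by auto
    then show "vb (Cn (lkp q nu) * Gm p k f (Mo nu)) \<le> vb q"
      using vb_mult[of "Cn (lkp q nu)" 0 "Gm p k f (Mo nu)" "deg nu"] m[of f nu] by simp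
  qed
  finally show ?thesis .
qed

lemma vb_Sc: "vb (Sc k g) \<le> nat g"
  unfolding vb_le_iff by (auto simp: in_keys_iff lookup_Sc split: if_splits)

text \<open>The creation half of the field of alpha(-n). In terms of the mode c = -(i + n) the
  coefficient is binom(-c - 1, n - 1); the modes with -n < c < 0 are absent because this binomial
  coefficient vanishes for them.\<close>

definition Af :: "nat \<Rightarrow> pol fls" where
  "Af n = fps_to_fls (Abs_fps (\<lambda>i. of_nat ((i + n - 1) choose (n - 1)) * Xv (i + n)))"

lemma Af_nth: "Af n $$ N = (if N < 0 then 0 else of_nat ((nat N + n - 1) choose (n - 1)) * Xv (nat N + n))"
  by (simp add: Af_def)

definition kp :: "nat \<Rightarrow> nat \<Rightarrow> complex" where "kp n c = (- of_nat c - 1) gchoose (n - 1)"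

text \<open>Y(alpha(-n_1) ... alpha(-n_r) e^(k alpha), z) on charge a, with the shift of charge
  stripped off. Normal ordering becomes a recursion over the factors: a creation mode multiplies the
  result, an annihilation mode acts on \<open>q\<close> before everything else. The sum over c stops
  at \<open>vb q\<close> because higher modes kill \<open>q\<close>.\<close>

fun Yl :: "nat \<Rightarrow> int \<Rightarrow> int \<Rightarrow> nat list \<Rightarrow> pol \<Rightarrow> pol fls" where
  "Yl p k a [] q = zp (k * a) * (Em k * Ep p k q)"
| "Yl p k a (n # ns) q = Af n * Yl p k a ns q
     + (\<Sum>c\<le>vb q. kc (kp n c) * (zp (- int (c + n)) * Yl p k a ns (al0 p a c q)))"

declare Yl.simps(2) [simp del]

lemma Yl_0 [simp]: "Yl p k a ns 0 = 0"
  by (induction ns) (auto simp: Yl.simps(2))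

lemma Yl_Cons: "vb q \<le> K \<Longrightarrow> Yl p k a (n # ns) q = Af n * Yl p k a ns q
     + (\<Sum>c\<le>K. kc (kp n c) * (zp (- int (c + n)) * Yl p k a ns (al0 p a c q)))"
  unfolding Yl.simps(2) by (intro arg_cong2[where f = "(+)"] refl sum.mono_neutral_left) (auto simp: al0_zero)

lemma Yl_add: "Yl p k a ns (q + r) = Yl p k a ns q + Yl p k a ns r"
proof (induction ns arbitrary: q r)
  case Nil then show ?case by (simp add: Ep_add distrib_left)
next
  case (Cons n ns)
  define K where "K = max (vb q) (vb r)"
  have K: "vb q \<le> K" "vb r \<le> K" "vb (q + r) \<le> K" by (auto simp: K_def intro!: vb_add)
  show ?case
    by (simp add: Yl_Cons[OF K(1)] Yl_Cons[OF K(2)] Yl_Cons[OF K(3)] al0_add Cons distrib_left sum.distrib)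
qed

lemma Yl_Cn_mult: "Yl p k a ns (Cn d * q) = kc d * Yl p k a ns q"
proof (induction ns arbitrary: q)
  case Nil then show ?case by (simp add: Ep_Cn_mult mult.left_commute)
next
  case (Cons n ns)
  have K: "vb (Cn d * q) \<le> vb q" using vb_mult[of "Cn d" 0 q "vb q"] by simp
  show ?case unfolding Yl_Cons[OF K] Yl_Cons[OF order_refl, of p k a n ns q]
    by (simp add: al0_Cn_mult Cons distrib_left sum_distrib_left mult.left_commute)
qed

text \<open>Creation operators commute among themselves, annihilation operators commute among
  themselves, and in a normally ordered product the two kinds never have to be exchanged.\<close>

lemma Yl_swap: "Yl p k a (n # m # ns) q = Yl p k a (m # n # ns) q"
proof -
  let ?K = "vb q"
  let ?Y = "Yl p k a ns"
  let ?k = "\<lambda>n c. kc (kp n c) * zp (- int (c + n))"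
  have v: "vb (al0 p a c q) \<le> ?K" for c by (rule vb_al0)
  have E: "Yl p k a (n # m # ns) q = Af n * Af m * ?Y q + (\<Sum>c\<le>?K. Af n * ?k m c * ?Y (al0 p a c q))
       + (\<Sum>c\<le>?K. Af m * ?k n c * ?Y (al0 p a c q)) + (\<Sum>c\<le>?K. \<Sum>d\<le>?K. ?k n c * ?k m d * ?Y (al0 p a d (al0 p a c q)))" for n m
    unfolding Yl_Cons[OF order_refl, of p k a n "m # ns" q]
    by (simp add: Yl_Cons[OF order_refl, of p k a m ns q] Yl_Cons[OF v, of p k a m ns] distrib_left sum.distrib sum_distrib_left mult_ac)
  have "(\<Sum>c\<le>?K. \<Sum>d\<le>?K. ?k n c * ?k m d * ?Y (al0 p a d (al0 p a c q)))
      = (\<Sum>d\<le>?K. \<Sum>c\<le>?K. ?k n c * ?k m d * ?Y (al0 p a d (al0 p a c q)))" by (rule sum.swap)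
  also have "\<dots> = (\<Sum>c\<le>?K. \<Sum>d\<le>?K. ?k m c * ?k n d * ?Y (al0 p a d (al0 p a c q)))"
    by (intro sum.cong refl) (subst al0_commute, simp only: mult_ac)
  finally have s: "(\<Sum>c\<le>?K. \<Sum>d\<le>?K. ?k n c * ?k m d * ?Y (al0 p a d (al0 p a c q)))
     = (\<Sum>c\<le>?K. \<Sum>d\<le>?K. ?k m c * ?k n d * ?Y (al0 p a d (al0 p a c q)))" .
  show ?thesis unfolding E[of n m] E[of m n] s by (simp only: mult.commute[of "Af n" "Af m"] add_ac)
qed

lemma Yl_Cons_cong: "(\<And>q. Yl p k a ns q = Yl p k a ms q) \<Longrightarrow> Yl p k a (n # ns) q = Yl p k a (n # ms) q"
  by (simp add: Yl.simps(2))

lemma Yl_move: "Yl p k a (xs @ n # ys) q = Yl p k a (n # xs @ ys) q"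
proof (induction xs arbitrary: q)
  case (Cons x xs)
  have "Yl p k a (x # (xs @ n # ys)) q = Yl p k a (x # n # xs @ ys) q"
    by (rule Yl_Cons_cong) (rule Cons)
  then show ?case by (simp add: Yl_swap[of p k a n x])
qed simp

lemma Yl_mset: "mset ns = mset ms \<Longrightarrow> Yl p k a ns q = Yl p k a ms q"
proof (induction ns arbitrary: ms q)
  case (Cons n ns)
  then have "n \<in> set ms" by (metis list.set_intros(1) set_mset_mset)
  then obtain xs ys where ms: "ms = xs @ n # ys" by (meson split_list)
  then have "mset ns = mset (xs @ ys)" using Cons.prems by simp
  then have "Yl p k a (n # ns) q = Yl p k a (n # xs @ ys) q" by (intro Yl_Cons_cong Cons.IH)
  then show ?case by (simp add: ms Yl_move)
qed simp

lemma count_factors: "count (mset (factors mu)) n = lkp mu n"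
proof -
  have "count (mset (factors mu)) n = (\<Sum>x\<in>pkeys mu. count (mset (replicate (lkp mu x) x)) n)"
    unfolding factors_def mset_concat
    by (simp add: count_sum comp_def sum_list_distinct_conv_sum_set)
  also have "\<dots> = (\<Sum>x\<in>pkeys mu. if x = n then lkp mu n else 0)" by (intro sum.cong) auto
  also have "\<dots> = lkp mu n" by (auto simp: in_keys_iff)
  finally show ?thesis .
qed

lemma mset_factors_add: "mset (factors (mu + sgl n 1)) = mset (n # factors mu)"
  by (rule multiset_eqI) (auto simp: count_factors lookup_add lookup_single when_def)

lemma factors_0 [simp]: "factors 0 = []" by (simp add: factors_def)

definition Yp :: "nat \<Rightarrow> int \<Rightarrow> int \<Rightarrow> pol \<Rightarrow> pol \<Rightarrow> pol fls" where
  "Yp p k a u q = lext kc (\<lambda>mu. Yl p k a (factors mu) q) u"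

lemma Yp_add_left: "Yp p k a (u + u') q = Yp p k a u q + Yp p k a u' q"
  by (simp add: Yp_def lext_add kc_hom)
lemma Yp_0_left [simp]: "Yp p k a 0 q = 0" by (simp add: Yp_def)
lemma Yp_Cn_mult_left: "Yp p k a (Cn d * u) q = kc d * Yp p k a u q"
  by (simp add: Yp_def lext_Cn_mult kc_hom)
lemma Yp_uminus_left: "Yp p k a (- u) q = - Yp p k a u q"
  using Yp_Cn_mult_left[of p k a "-1" u q] by (simp add: Cn_uminus kc_uminus)
lemma Yp_diff_left: "Yp p k a (u - u') q = Yp p k a u q - Yp p k a u' q"
  using Yp_add_left[of p k a u "- u'" q] by (simp add: Yp_uminus_left)
lemma Yp_sum_left: "Yp p k a (\<Sum>x\<in>A. u x) q = (\<Sum>x\<in>A. Yp p k a (u x) q)"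
  by (simp add: Yp_def lext_sum kc_hom)
lemma Yp_add: "Yp p k a u (q + r) = Yp p k a u q + Yp p k a u r"
  by (simp add: Yp_def lext_def Yl_add distrib_left sum.distrib)
lemma Yp_0 [simp]: "Yp p k a u 0 = 0" by (simp add: Yp_def lext_def)
lemma Yp_Cn_mult: "Yp p k a u (Cn d * q) = kc d * Yp p k a u q"
  by (simp add: Yp_def lext_def Yl_Cn_mult sum_distrib_left mult.left_commute)
lemma Yp_sum: "Yp p k a u (\<Sum>x\<in>A. q x) = (\<Sum>x\<in>A. Yp p k a u (q x))"
  by (induction A rule: infinite_finite_induct) (auto simp: Yp_add)
lemma Yp_Cn: "Yp p k a (Cn d) q = kc d * (zp (k * a) * (Em k * Ep p k q))"
  unfolding Yp_def Cn_def by (subst lext_single[OF kc_hom]) simp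
lemma Yp_1: "Yp p k a 1 q = zp (k * a) * (Em k * Ep p k q)" using Yp_Cn[of p k a 1 q] by simp

text \<open>\<open>factors\<close> puts the new variable at its sorted place in the list; invariance
  under permutations (\<open>Yl_mset\<close>) allows it to be treated as the head.\<close>

lemma Yp_Xv: assumes "vb q \<le> K"
  shows "Yp p k a (Xv n * u) q = Af n * Yp p k a u q
     + (\<Sum>c\<le>K. kc (kp n c) * (zp (- int (c + n)) * Yp p k a u (al0 p a c q)))"
proof (induction u rule: pol_add_induct)
  case (single mu d)
  have e: "Xv n * sgl mu d = sgl (mu + sgl n 1) d" by (simp add: Xv_def Mo_def mult_single add.commute)
  have f: "Yl p k a (factors (mu + sgl n 1)) q = Yl p k a (n # factors mu) q"
    by (rule Yl_mset) (rule mset_factors_add)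
  show ?case unfolding e Yp_def lext_single[OF kc_hom] f Yl_Cons[OF assms]
    by (simp add: distrib_left sum_distrib_left mult.left_commute)
next
  case (add u u')
  then show ?case by (simp add: distrib_left Yp_add_left sum.distrib)
qed

text \<open>For \<open>I = {0}\<close> this says homogeneous of degree \<open>d\<close>, for
  \<open>I = {..0}\<close> of degree at most \<open>d\<close>; the set parameter lets one calculus
  serve both.\<close>

definition wd :: "int set \<Rightarrow> int \<Rightarrow> pol \<Rightarrow> bool" where
  "wd I d q \<longleftrightarrow> (\<forall>nu\<in>pkeys q. int (deg nu) - d \<in> I)"

lemma wd_0 [simp]: "wd I d 0" by (simp add: wd_def)
lemma wd_add: "wd I d q \<Longrightarrow> wd I d r \<Longrightarrow> wd I d (q + r)"
  unfolding wd_def using keys_add[of q r] by blast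
lemma wd_sum: "(\<And>x. x \<in> A \<Longrightarrow> wd I d (f x)) \<Longrightarrow> wd I d (sum f A)"
  by (induction A rule: infinite_finite_induct) (auto simp: wd_add)
lemma wd_mult: assumes "wd {0} g s" "wd I d q" shows "wd I (d + g) (s * q)"
  unfolding wd_def
proof
  fix nu assume "nu \<in> pkeys (s * q)"
  then obtain x y where xy: "x \<in> pkeys s" "y \<in> pkeys q" "nu = x + y" using keys_mult[of s q] by blast
  then have "int (deg x) = g" "int (deg y) - d \<in> I" using assms by (auto simp: wd_def)
  then show "int (deg nu) - (d + g) \<in> I" using xy by (simp add: deg_add algebra_simps)
qed
lemma wd_Cn: "0 \<in> I \<Longrightarrow> wd I 0 (Cn c)" by (auto simp: wd_def Cn_def)
lemma wd_Cn_mult: "wd I d q \<Longrightarrow> wd I d (Cn c * q)"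
  using wd_mult[OF wd_Cn, of I d q c] by simp
lemma wd_uminus: "wd I d q \<Longrightarrow> wd I d (- q)" by (simp add: wd_def)
lemma wd_diff: "wd I d q \<Longrightarrow> wd I d r \<Longrightarrow> wd I d (q - r)"
  using wd_add[of I d q "- r"] by (simp add: wd_uminus)
lemma wd_Mo: "wd {0} (int (deg nu)) (Mo nu)" by (simp add: wd_def Mo_def)
lemma wd_Xv: "wd {0} (int n) (Xv n)" using wd_Mo[of "sgl n 1"] by (simp add: Xv_def)
lemma wd_Sc: "wd {0} g (Sc k g)"
  by (auto simp: wd_def in_keys_iff lookup_Sc split: if_splits)
text \<open>The degree arguments for vanishing end here.\<close>

lemma wd_neg: assumes "wd I d q" "I \<subseteq> {..0}" "d < 0" shows "q = 0"
proof -
  have "pkeys q = {}"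
  proof (rule ccontr)
    assume "pkeys q \<noteq> {}"
    then obtain nu where "nu \<in> pkeys q" by blast
    then have "int (deg nu) - d \<in> {..0}" using assms unfolding wd_def by blast
    then show False using assms(3) by simp
  qed
  then show ?thesis by simp
qed
lemma wd_vb: "wd {..0} (int (vb q)) q"
  using vb_le_iff[of q "vb q"] by (auto simp: wd_def)

lemma wd_Gm: assumes "wd I d q" shows "wd I (d - int f) (Gm p k f q)"
proof -
  have m: "wd {0} (int (deg nu) - int f) (Gm p k f (Mo nu))" for nu f
  proof (induction nu arbitrary: f rule: mon_induct_in[OF subset_UNIV])
    case 1 then show ?case using wd_Cn[of "{0}" 1] by (auto simp: Gm_1)
  next
    case (2 n mu)
    have e: "Mo (mu + sgl n 1) = Xv n * Mo mu" by (simp add: Mo_add Xv_def mult.commute)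
    have "wd {0} (int (deg mu) - int f + int n) (Xv n * Gm p k f (Mo mu))"
      by (rule wd_mult[OF wd_Xv 2(3)])
    moreover have "wd {0} (int (deg mu) - int f + int n) (of_int (2 * int p * k) * Gm p k (f - n) (Mo mu))" if "n \<le> f"
      using wd_Cn_mult[OF 2(3)[of "f - n"], of "of_int (2 * int p * k)"] that
      by (simp only: Cn_of_int) (simp add: algebra_simps of_nat_diff)
    ultimately show ?case unfolding e Gm_Xv deg_add
      by (auto simp del: of_int_mult simp: algebra_simps intro: wd_diff)
  qed
  have "Gm p k f q = (\<Sum>nu\<in>pkeys q. Cn (lkp q nu) * Gm p k f (Mo nu))"
    by (subst pol_expand[of q]) (simp add: Gm_sum sgl_eq Gm_Cn_mult)
  also have "wd I (d - int f) \<dots>"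
  proof (intro wd_sum wd_Cn_mult)
    fix nu assume nu: "nu \<in> pkeys q"
    show "wd I (d - int f) (Gm p k f (Mo nu))"
      unfolding wd_def
    proof
      fix mu assume "mu \<in> pkeys (Gm p k f (Mo nu))"
      then have "int (deg mu) = int (deg nu) - int f" using m[of nu f] by (auto simp: wd_def)
      moreover have "int (deg nu) - d \<in> I" using nu assms by (auto simp: wd_def)
      ultimately show "int (deg mu) - (d - int f) \<in> I" by simp
    qed
  qed
  finally show ?thesis .
qed

lemma Gm_zero: "f > vb q \<Longrightarrow> Gm p k f q = 0"
  using wd_neg[OF wd_Gm[OF wd_vb], of q f p k] by simp

lemma wd_al: assumes "wd I d q" shows "wd I (d - int c) (al p c q)"
  unfolding al_def lext_def
proof (rule wd_sum)
  fix nu assume nu: "nu \<in> pkeys q"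
  show "wd I (d - int c) (Cn (lkp q nu) * (Cn (of_nat (2 * p * c * lkp nu c)) * Mo (nu - sgl c 1)))"
  proof (cases "lkp nu c = 0")
    case False
    have "deg nu = deg (nu - sgl c 1) + c"
      using sub_single_add[OF False] deg_add[of "nu - sgl c 1" "sgl c 1"] by simp
    then have e: "int (deg (nu - sgl c 1)) - (d - int c) = int (deg nu) - d" by simp
    have "int (deg (nu - sgl c 1)) - (d - int c) \<in> I" unfolding e using nu assms by (auto simp: wd_def)
    then have "wd I (d - int c) (Mo (nu - sgl c 1))" by (simp add: wd_def Mo_def)
    then show ?thesis by (intro wd_Cn_mult)
  qed simp
qed

lemma al_Gm_zero: "c + f > vb q \<Longrightarrow> al p c (Gm p k f q) = 0"
  using wd_neg[OF wd_al[OF wd_Gm[OF wd_vb]], of q f c p p k] by simp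

lemma Gm_al0: "Gm p k f (al0 p a c q) = al0 p a c (Gm p k f q)"
  by (auto simp: al0_def Gm_al Gm_of_int)

section \<open>The screening current moved past a vertex operator\<close>

definition tw :: "nat \<Rightarrow> complex" where "tw p = of_nat (2 * p)"

lemma Gm1_Xv: "n \<ge> 1 \<Longrightarrow> Gm p 1 f (Xv n * q) = Xv n * Gm p 1 f q
   - (if n \<le> f then Cn (tw p) * Gm p 1 (f - n) q else 0)"
  using Gm_Xv[of p 1 f n q] by (auto simp: tw_def Cn_mult Cn_of_nat Cn_numeral)

text \<open>E^+ of e^alpha at the point x, applied to the coefficients of a Laurent series in z. The
  variable of the formal power series is 1/x.\<close>

definition GG :: "nat \<Rightarrow> pol fls \<Rightarrow> pol fls fps" where
  "GG p F = Abs_fps (\<lambda>h. fmap (Gm p 1 h) F)"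

lemma GG_nth: "(GG p F $ h) $$ N = Gm p 1 h (F $$ N)" by (simp add: GG_def)

lemma GG_add: "GG p (F + G) = GG p F + GG p G"
  by (simp add: fps_eq_iff fls_eq_iff GG_nth Gm_add)
lemma GG_0 [simp]: "GG p 0 = 0"
  by (simp add: fps_eq_iff fls_eq_iff GG_nth)
lemma GG_sum: "GG p (\<Sum>x\<in>A. F x) = (\<Sum>x\<in>A. GG p (F x))"
  by (induction A rule: infinite_finite_induct) (auto simp: GG_add)

lemma GG_mult: "GG p (F * G) = GG p F * GG p G"
proof -
  define l m where "l = fls_subdegree F" and "m = fls_subdegree G"
  have F: "F $$ n = 0" if "n < l" for n using that by (simp add: l_def fls_eq0_below_subdegree)
  have G: "G $$ n = 0" if "n < m" for n using that by (simp add: m_def fls_eq0_below_subdegree)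
  have "(GG p (F * G) $ h) $$ N = ((GG p F * GG p G) $ h) $$ N" for h N
  proof -
    have "(GG p (F * G) $ h) $$ N = (\<Sum>j\<in>{l..N - m}. \<Sum>i\<le>h. Gm p 1 i (F $$ j) * Gm p 1 (h - i) (G $$ (N - j)))"
      by (simp add: GG_nth fls_times_nth_lb[OF F G] Gm_sum Gm_mult)
    also have "\<dots> = (\<Sum>i\<le>h. \<Sum>j\<in>{l..N - m}. Gm p 1 i (F $$ j) * Gm p 1 (h - i) (G $$ (N - j)))"
      by (rule sum.swap)
    also have "\<dots> = (\<Sum>i\<le>h. (GG p F $ i * GG p G $ (h - i)) $$ N)"
      by (intro sum.cong refl, subst fls_times_nth_lb[of l _ m]) (auto simp: GG_nth F G)
    also have "\<dots> = ((GG p F * GG p G) $ h) $$ N"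
      by (simp add: fps_mult_nth fls_nth_sum atMost_atLeast0)
    finally show ?thesis .
  qed
  then show ?thesis by (simp add: fps_eq_iff fls_eq_iff)
qed

lemma GG_kc: "GG p (kc c) = fps_const (kc c)"
  by (auto simp: fps_eq_iff fls_eq_iff GG_nth kc_def Gm_Cn)
lemma GG_zp: "GG p (zp n) = fps_const (zp n)"
  by (auto simp: fps_eq_iff fls_eq_iff GG_nth zp_nth Gm_1)

text \<open>The series (1 - z/x)^m, again in powers of 1/x.\<close>

definition PW :: "complex \<Rightarrow> pol fls fps" where
  "PW m = Abs_fps (\<lambda>i. kc (sb m i) * zp (int i))"

lemma PW_mult: "PW m * PW n = PW (m + n)"
proof (rule fps_ext)
  fix h
  have "(PW m * PW n) $ h = (\<Sum>i\<in>{0..h}. kc (sb m i * sb n (h - i)) * zp (int h))"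
    unfolding fps_mult_nth by (intro sum.cong refl) (auto simp: PW_def kc_mult zp_add mult_ac zp_add_left of_nat_diff)
  also have "\<dots> = kc (\<Sum>i\<le>h. sb m i * sb n (h - i)) * zp (int h)"
    by (simp add: kc_sum sum_distrib_right atMost_atLeast0)
  finally show "(PW m * PW n) $ h = PW (m + n) $ h" by (simp add: PW_def sb_conv)
qed

lemma GG_Em: "GG p (Em k) = fps_const (Em k) * PW (of_int (2 * int p * k))"
proof (rule fps_ext)
  fix h
  have "(fps_const (Em k) * PW (of_int (2 * int p * k))) $ h = kc (sb (of_int (2 * int p * k)) h) * (zp (int h) * Em k)"
    by (simp add: PW_def mult_ac)
  then show "GG p (Em k) $ h = (fps_const (Em k) * PW (of_int (2 * int p * k))) $ h"
    by (simp add: fls_eq_iff GG_nth Gm_Sc del: of_int_mult)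
qed

lemma GG_Ep: "GG p (Ep p k w) $ h = Ep p k (Gm p 1 h w)"
  by (auto simp: fls_eq_iff GG_nth Ep_nth Gm_commute)

lemma Gm_Xv_only: "n \<ge> 1 \<Longrightarrow> Gm p 1 h (Xv n) = (if h = 0 then Xv n else if h = n then - Cn (tw p) else 0)"
  using Gm1_Xv[of n p h 1] by (auto simp: Gm_1)

lemma sb_neg_nat: "n \<ge> 1 \<Longrightarrow> sb (- of_nat n) i = of_nat ((i + n - 1) choose (n - 1))"
proof -
  assume n: "n \<ge> 1"
  have "sb (- of_nat n) i = ((of_nat n + of_nat i - 1) gchoose i)"
    by (simp add: sb_def gbinomial_minus)
  also have "of_nat n + of_nat i - 1 = (of_nat (i + n - 1) :: complex)"
    using n by (simp add: of_nat_diff)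
  also have "(of_nat (i + n - 1) gchoose i) = (of_nat ((i + n - 1) choose i) :: complex)"
    by (simp add: binomial_gbinomial)
  also have "(i + n - 1) choose i = (i + n - 1) choose (n - 1)"
    using n binomial_symmetric[of i "i + n - 1"] by simp
  finally show ?thesis .
qed

text \<open>E^+ shifts alpha(-j) by -2p x^(-j). Summed against the coefficients of
  \<open>Af n\<close>, the shifts form the binomial series of x^(-n) (1 - z/x)^(-n).\<close>

lemma GG_Af: assumes n: "n \<ge> 1"
  shows "GG p (Af n) = fps_const (Af n) - fps_const (kc (tw p)) * (fps_X ^ n * PW (- of_nat n))"
proof (rule fps_ext)
  fix h
  show "GG p (Af n) $ h = (fps_const (Af n) - fps_const (kc (tw p)) * (fps_X ^ n * PW (- of_nat n))) $ h"
    unfolding fls_eq_iff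
  proof
    fix N
    have g: "Gm p 1 h (of_nat c * q) = of_nat c * Gm p 1 h q" for c q by (rule Gm_of_nat)
    have L: "(GG p (Af n) $ h) $$ N = (if N < 0 then 0 else of_nat ((nat N + n - 1) choose (n - 1)) *
       (if h = 0 then Xv (nat N + n) else if h = nat N + n then - Cn (tw p) else 0))"
      using n by (simp add: GG_nth Af_nth g Gm_Xv_only)
    have R: "((fps_const (Af n) - fps_const (kc (tw p)) * (fps_X ^ n * PW (- of_nat n))) $ h) $$ N
      = (if h = 0 then Af n $$ N else 0) - (if h < n then 0 else
           Cn (tw p) * (Cn (sb (- of_nat n) (h - n)) * (if N = int (h - n) then 1 else 0)))"
      by (simp add: fps_X_power_mult_nth PW_def zp_nth)
    show "(GG p (Af n) $ h) $$ N = ((fps_const (Af n) - fps_const (kc (tw p)) * (fps_X ^ n * PW (- of_nat n))) $ h) $$ N"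
      unfolding L R sb_neg_nat[OF n] using n
      by (auto simp: Af_nth Cn_of_nat mult.commute)
  qed
qed

definition WY :: "nat \<Rightarrow> int \<Rightarrow> int \<Rightarrow> pol \<Rightarrow> pol \<Rightarrow> pol fls fps" where
  "WY p k a u w = Abs_fps (\<lambda>h. Yp p k a u (Gm p 1 h w))"

text \<open>Contribution of E^+(x) to the product Y(e^alpha, x) Y(u e^(k alpha), z) for |x| > |z|.
  Passing E^+(x) to the right costs (1 - z/x)^(2pk) for the exponentials, and its contraction with
  \<open>u\<close> turns \<open>u\<close> into \<open>Gm p 1 f u\<close> with a factor (x - z)^(-f).
  The threshold is uniform in \<open>w\<close> because the induction step uses the hypothesis also
  for \<open>al0 p a c w\<close>.\<close>

theorem shift_Yp:
  assumes "vin {1..} u"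
  shows "\<exists>F0. \<forall>F\<ge>F0. \<forall>w. GG p (Yp p k a u w)
     = (\<Sum>f\<le>F. fps_X ^ f * (PW (of_int (2 * int p * k) - of_nat f) * WY p k a (Gm p 1 f u) w))"
  using assms
proof (induction u rule: pol_induct_in)
  case (const d)
  have "GG p (Yp p k a (Cn d) w) = PW (of_int (2 * int p * k)) * WY p k a (Cn d) w" for w
  proof -
    have "GG p (Yp p k a (Cn d) w) = PW (of_int (2 * int p * k)) *
       (fps_const (kc d * (zp (k * a) * Em k)) * GG p (Ep p k w))"
      by (simp add: Yp_Cn GG_mult GG_kc GG_zp GG_Em fps_const_mult[symmetric] mult_ac del: fps_const_mult of_int_mult)
    also have "fps_const (kc d * (zp (k * a) * Em k)) * GG p (Ep p k w) = WY p k a (Cn d) w"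
      by (rule fps_ext) (simp add: WY_def GG_Ep Yp_Cn mult.assoc)
    finally show ?thesis .
  qed
  moreover have "WY p k a 0 w = 0" for w by (simp add: WY_def fps_eq_iff)
  moreover have "(\<Sum>f\<le>F. fps_X ^ f * (PW (of_int (2 * int p * k) - of_nat f) * WY p k a (Gm p 1 f (Cn d)) w))
     = (\<Sum>f\<le>F. if f = 0 then PW (of_int (2 * int p * k)) * WY p k a (Cn d) w else 0)" for F w
    using calculation(2) by (intro sum.cong) (auto simp: Gm_Cn)
  ultimately show ?case by auto
next
  case (add u v)
  then obtain F0 F1 where *: "\<forall>F\<ge>F0. \<forall>w. GG p (Yp p k a u w)
     = (\<Sum>f\<le>F. fps_X ^ f * (PW (of_int (2 * int p * k) - of_nat f) * WY p k a (Gm p 1 f u) w))"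
    "\<forall>F\<ge>F1. \<forall>w. GG p (Yp p k a v w)
     = (\<Sum>f\<le>F. fps_X ^ f * (PW (of_int (2 * int p * k) - of_nat f) * WY p k a (Gm p 1 f v) w))" by blast
  have W: "WY p k a (Gm p 1 f (u + v)) w = WY p k a (Gm p 1 f u) w + WY p k a (Gm p 1 f v) w" for f w
    by (simp add: WY_def fps_eq_iff Gm_add Yp_add_left)
  have "\<forall>F\<ge>max F0 F1. \<forall>w. GG p (Yp p k a (u + v) w)
     = (\<Sum>f\<le>F. fps_X ^ f * (PW (of_int (2 * int p * k) - of_nat f) * WY p k a (Gm p 1 f (u + v)) w))"
  proof (intro allI impI)
    fix F w assume "F \<ge> max F0 F1"
    then have "F \<ge> F0" "F \<ge> F1" by auto
    then show "GG p (Yp p k a (u + v) w)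
     = (\<Sum>f\<le>F. fps_X ^ f * (PW (of_int (2 * int p * k) - of_nat f) * WY p k a (Gm p 1 f (u + v)) w))"
      using * by (simp only: W Yp_add_left GG_add sum.distrib distrib_left)
  qed
  then show ?case by blast
next
  case (mult n u)
  then have n: "n \<ge> 1" by simp
  let ?b = "of_int (2 * int p * k) :: complex"
  let ?R = "\<lambda>F u w. (\<Sum>f\<le>F. fps_X ^ f * (PW (?b - of_nat f) * WY p k a (Gm p 1 f u) w))"
  from mult obtain F0 where IH: "\<And>F w. F \<ge> F0 \<Longrightarrow> GG p (Yp p k a u w) = ?R F u w" by blast
  have "GG p (Yp p k a (Xv n * u) w) = ?R F (Xv n * u) w" if F: "F \<ge> F0 + n" for F w
  proof -
    let ?C = "\<lambda>c. fps_const (kc (kp n c) * zp (- int (c + n)))"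
    have "GG p (Yp p k a (Xv n * u) w) = GG p (Af n) * GG p (Yp p k a u w)
       + (\<Sum>c\<le>vb w. ?C c * GG p (Yp p k a u (al0 p a c w)))"
      unfolding Yp_Xv[OF order_refl]
      by (simp add: GG_add GG_mult GG_sum GG_kc GG_zp fps_const_mult[symmetric] mult.assoc del: fps_const_mult)
    also have "\<dots> = fps_const (Af n) * GG p (Yp p k a u w)
       - fps_const (kc (tw p)) * (fps_X ^ n * (PW (- of_nat n) * GG p (Yp p k a u w)))
       + (\<Sum>c\<le>vb w. ?C c * GG p (Yp p k a u (al0 p a c w)))"
      unfolding GG_Af[OF n] by (simp add: left_diff_distrib mult.assoc)
    \<comment> \<open>The contraction term is expanded only up to \<open>F - n\<close>: its factor
      of order n shifts the index f by n, so that all sums end at \<open>F\<close>. This is why the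
      hypothesis is kept for all large \<open>F\<close>.\<close>
    also have "\<dots> = fps_const (Af n) * ?R F u w
       - fps_const (kc (tw p)) * (fps_X ^ n * (PW (- of_nat n) * ?R (F - n) u w))
       + (\<Sum>c\<le>vb w. ?C c * ?R F u (al0 p a c w))"
      using F IH[of F] IH[of "F - n"] by simp
    also have "\<dots> = ?R F (Xv n * u) w"
    proof -
      have W: "WY p k a (Gm p 1 f (Xv n * u)) w = fps_const (Af n) * WY p k a (Gm p 1 f u) w
         + (\<Sum>c\<le>vb w. ?C c * WY p k a (Gm p 1 f u) (al0 p a c w))
         - (if n \<le> f then fps_const (kc (tw p)) * WY p k a (Gm p 1 (f - n) u) w else 0)" for f
        by (rule fps_ext)
           (simp add: WY_def Gm1_Xv[OF n] Yp_diff_left Yp_Xv[OF vb_Gm] Yp_Cn_mult_left Gm_al0 fps_sum_nth mult.assoc)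
      have "?R F (Xv n * u) w = fps_const (Af n) * ?R F u w + (\<Sum>c\<le>vb w. ?C c * ?R F u (al0 p a c w))
         - (\<Sum>f\<le>F. if n \<le> f then fps_X ^ f * (PW (?b - of_nat f) * (fps_const (kc (tw p)) * WY p k a (Gm p 1 (f - n) u) w)) else 0)"
      proof -
        have "(\<Sum>f\<le>F. fps_X ^ f * (PW (?b - of_nat f) * (\<Sum>c\<le>vb w. ?C c * WY p k a (Gm p 1 f u) (al0 p a c w))))
          = (\<Sum>c\<le>vb w. ?C c * ?R F u (al0 p a c w))"
          unfolding sum_distrib_left by (subst sum.swap) (simp only: mult_ac)
        then show ?thesis unfolding W
          by (simp only: distrib_left right_diff_distrib sum.distrib sum_subtractf)
             (simp add: sum_distrib_left mult.left_commute[of "fps_const (Af n)"] if_distrib[of "\<lambda>x. _ * x"] cong: if_cong)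
      qed
      also have "(\<Sum>f\<le>F. if n \<le> f then fps_X ^ f * (PW (?b - of_nat f) * (fps_const (kc (tw p)) * WY p k a (Gm p 1 (f - n) u) w)) else 0)
        = (\<Sum>f\<in>{n..F}. fps_X ^ f * (PW (?b - of_nat f) * (fps_const (kc (tw p)) * WY p k a (Gm p 1 (f - n) u) w)))"
        by (intro sum.mono_neutral_cong_right) auto
      also have "\<dots> = (\<Sum>f\<le>F - n. fps_X ^ (f + n) * (PW (?b - of_nat (f + n)) * (fps_const (kc (tw p)) * WY p k a (Gm p 1 f u) w)))"
        using F by (intro sum.reindex_bij_witness[of _ "\<lambda>i. i + n" "\<lambda>i. i - n"]) auto
      also have "\<dots> = fps_const (kc (tw p)) * (fps_X ^ n * (PW (- of_nat n) * ?R (F - n) u w))"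
      proof -
        have "PW (?b - of_nat (f + n)) = PW (- of_nat n) * PW (?b - of_nat f)" for f
          by (simp add: PW_mult algebra_simps)
        then show ?thesis by (simp add: sum_distrib_left power_add mult_ac)
      qed
      finally show ?thesis by simp
    qed
    finally show ?thesis .
  qed
  then show ?case by blast
qed

text \<open>The power (x - z)^L expanded for |x| < |z|, with x as the variable of the formal power
  series.\<close>

definition QW :: "int \<Rightarrow> pol fls fps" where
  "QW L = Abs_fps (\<lambda>i. kc ((-1) powi L * sb (of_int L) i) * zp (L - int i))"

lemma QW_mult: "QW L * QW M = QW (L + M)"
proof (rule fps_ext)
  fix h
  have "(QW L * QW M) $ h = (\<Sum>i\<in>{0..h}. kc (((-1) powi (L + M)) * (sb (of_int L) i * sb (of_int M) (h - i))) * zp (L + M - int h))"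
    unfolding fps_mult_nth
  proof (intro sum.cong refl)
    fix i assume i: "i \<in> {0..h}"
    have "QW L $ i * QW M $ (h - i) = kc (((-1) powi L * (-1) powi M) * (sb (of_int L) i * sb (of_int M) (h - i))) * (zp (L - int i) * zp (M - int (h - i)))"
      by (simp add: QW_def kc_mult mult_ac)
    also have "zp (L - int i) * zp (M - int (h - i)) = zp (L + M - int h)"
    proof -
      have "L - int i + (M - int (h - i)) = L + M - int h" using i by (simp add: of_nat_diff)
      then show ?thesis by (simp only: zp_add)
    qed
    also have "(-1) powi L * (-1) powi M = ((-1) powi (L + M) :: complex)" by (simp add: power_int_add)
    finally show "QW L $ i * QW M $ (h - i) = kc (((-1) powi (L + M)) * (sb (of_int L) i * sb (of_int M) (h - i))) * zp (L + M - int h)" .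
  qed
  also have "\<dots> = kc ((-1) powi (L + M) * (\<Sum>i\<le>h. sb (of_int L) i * sb (of_int M) (h - i))) * zp (L + M - int h)"
    by (simp add: kc_sum kc_mult sum_distrib_left sum_distrib_right atMost_atLeast0)
  finally show "(QW L * QW M) $ h = QW (L + M) $ h" by (simp add: QW_def sb_conv)
qed

definition fE :: "pol fls fps" where "fE = Abs_fps (\<lambda>g. fls_const (Sc 1 (int g)))"

text \<open>The generating series in x of Y(u, z) applied to E^-(x) w. The charge is a + 2p because
  e^alpha has already acted.\<close>

definition LS :: "nat \<Rightarrow> int \<Rightarrow> int \<Rightarrow> pol \<Rightarrow> pol \<Rightarrow> pol fls fps" where
  "LS p k a u w = Abs_fps (\<lambda>g. Yp p k (a + 2 * int p) u (Sc 1 (int g) * w))"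

lemma Ep_Sc_mult: "Abs_fps (\<lambda>g. Ep p k (Sc 1 (int g) * w))
   = fE * (Abs_fps (\<lambda>i. kc (sb (of_int (2 * int p * k)) i) * zp (- int i)) * fps_const (Ep p k w))"
proof (rule fps_ext)
  fix g
  define M :: complex where "M = of_int (2 * int p * k)"
  have "Ep p k (Sc 1 (int g) * w) = (\<Sum>i\<le>g. fls_const (Sc 1 (int (g - i))) * (kc (sb M i) * (zp (- int i) * Ep p k w)))"
    unfolding fls_eq_iff
  proof
    fix N
    have R: "(\<Sum>i\<le>g. fls_const (Sc 1 (int (g - i))) * (kc (sb M i) * (zp (- int i) * Ep p k w))) $$ N
      = (\<Sum>i\<le>g. Sc 1 (int (g - i)) * (Cn (sb M i) * Ep p k w $$ (N + int i)))"
      unfolding fls_nth_sum fls_const_mult_nth by simp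
    show "Ep p k (Sc 1 (int g) * w) $$ N = (\<Sum>i\<le>g. fls_const (Sc 1 (int (g - i))) * (kc (sb M i) * (zp (- int i) * Ep p k w))) $$ N"
    proof (cases "N \<le> 0")
      case False
      then show ?thesis unfolding R by (simp add: Ep_nth)
    next
      case True
      define f where "f = nat (- N)"
      have N: "N = - int f" using True by (simp add: f_def)
      have "Ep p k (Sc 1 (int g) * w) $$ N = (\<Sum>i\<le>f. Cn (sb M i) * Sc 1 (int g - int i) * Gm p k (f - i) w)"
        using Gm_Sc[of p k _ 1 "int g"] by (simp add: N Ep_nth Gm_mult M_def)
      also have "\<dots> = (\<Sum>i\<le>max f g. if i \<le> f \<and> i \<le> g then Cn (sb M i) * Sc 1 (int g - int i) * Gm p k (f - i) w else 0)"
        by (intro sum.mono_neutral_cong_left) auto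
      also have "\<dots> = (\<Sum>i\<le>g. Sc 1 (int (g - i)) * (Cn (sb M i) * Ep p k w $$ (N + int i)))"
        by (intro sum.mono_neutral_cong_right) (auto simp: Ep_nth N of_nat_diff mult_ac nat_diff_distrib)
      finally show ?thesis unfolding R .
    qed
  qed
  also have "\<dots> = (\<Sum>i\<in>{0..g}. ((Abs_fps (\<lambda>i. kc (sb M i) * zp (- int i)) * fps_const (Ep p k w)) $ i) * fE $ (g - i))"
    unfolding atMost_atLeast0
  proof (intro sum.cong refl)
    fix i
    show "fls_const (Sc 1 (int (g - i))) * (kc (sb M i) * (zp (- int i) * Ep p k w))
      = ((Abs_fps (\<lambda>i. kc (sb M i) * zp (- int i)) * fps_const (Ep p k w)) $ i) * fE $ (g - i)"
      unfolding fE_def fps_mult_right_const_nth fps_nth_Abs_fps by (simp only: mult_ac)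
  qed
  also have "\<dots> = (fE * (Abs_fps (\<lambda>i. kc (sb M i) * zp (- int i)) * fps_const (Ep p k w))) $ g"
    by (subst mult.commute[of fE]) (rule fps_mult_nth[symmetric])
  finally show "Abs_fps (\<lambda>g. Ep p k (Sc 1 (int g) * w)) $ g =
     (fE * (Abs_fps (\<lambda>i. kc (sb (of_int (2 * int p * k)) i) * zp (- int i)) * fps_const (Ep p k w))) $ g"
    unfolding M_def[symmetric] fps_nth_Abs_fps .
qed

lemma vb_Sc_mult: "vb (Sc k (int g) * w) \<le> g + vb w"
  using vb_mult[of "Sc k (int g)" g w "vb w"] vb_Sc[of k "int g"] by simp

lemma al0_Sc: "al0 p (a + 2 * int p) c (Sc 1 g * w) = Sc 1 g * al0 p a c w + Cn (tw p) * (Sc 1 (g - int c) * w)"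
  by (auto simp: al0_def al_mult al_Sc tw_def Cn_of_nat Cn_mult Cn_numeral algebra_simps)

text \<open>The counterpart of \<open>shift_Yp\<close> for the product in the other order, with |x|
  < |z|: here E^-(x) passes to the left, and the contractions produce the same powers (x - z)^(2pk -
  f) in the opposite expansion.\<close>

theorem Yp_Sc_right:
  assumes "vin {1..} u"
  shows "\<exists>F0. \<forall>F\<ge>F0. \<forall>w. LS p k a u w
     = fE * (\<Sum>f\<le>F. QW (2 * int p * k - int f) * fps_const (Yp p k a (Gm p 1 f u) w))"
  using assms
proof (induction u rule: pol_induct_in)
  case (const d)
  have "LS p k a (Cn d) w = fE * (QW (2 * int p * k) * fps_const (Yp p k a (Cn d) w))" for w
  proof -
    have "LS p k a (Cn d) w = fps_const (kc d * (zp (k * (a + 2 * int p)) * Em k)) * Abs_fps (\<lambda>g. Ep p k (Sc 1 (int g) * w))"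
      by (rule fps_ext) (simp add: LS_def Yp_Cn mult.assoc)
    also have "\<dots> = fE * ((fps_const (zp (2 * int p * k)) * Abs_fps (\<lambda>i. kc (sb (of_int (2 * int p * k)) i) * zp (- int i))) * fps_const (Yp p k a (Cn d) w))"
    proof -
      have eq: "kc d * (zp (k * (a + 2 * int p)) * Em k) = kc d * (zp (2 * int p * k) * (zp (k * a) * Em k))"
      proof -
        have "k * (a + 2 * int p) = 2 * int p * k + k * a" by (simp add: algebra_simps)
        then show ?thesis by (simp only: zp_add_left)
      qed
      show ?thesis unfolding eq Ep_Sc_mult Yp_Cn
        by (simp only: fps_const_mult[symmetric] mult_ac)
    qed
    also have "fps_const (zp (2 * int p * k)) * Abs_fps (\<lambda>i. kc (sb (of_int (2 * int p * k)) i) * zp (- int i)) = QW (2 * int p * k)"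
      by (rule fps_ext) (simp add: QW_def mult.left_commute[of "zp _"] zp_add power_int_mult)
    finally show ?thesis .
  qed
  moreover have "(\<Sum>f\<le>F. QW (2 * int p * k - int f) * fps_const (Yp p k a (Gm p 1 f (Cn d)) w))
     = (\<Sum>f\<le>F. if f = 0 then QW (2 * int p * k) * fps_const (Yp p k a (Cn d) w) else 0)" for F w
    by (intro sum.cong) (auto simp: Gm_Cn)
  ultimately show ?case by auto
next
  case (add u v)
  then obtain F0 F1 where *: "\<forall>F\<ge>F0. \<forall>w. LS p k a u w
     = fE * (\<Sum>f\<le>F. QW (2 * int p * k - int f) * fps_const (Yp p k a (Gm p 1 f u) w))"
    "\<forall>F\<ge>F1. \<forall>w. LS p k a v w
     = fE * (\<Sum>f\<le>F. QW (2 * int p * k - int f) * fps_const (Yp p k a (Gm p 1 f v) w))" by blast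
  have W: "LS p k a (u + v) w = LS p k a u w + LS p k a v w" for w
    by (simp add: LS_def fps_eq_iff Yp_add_left)
  have "\<forall>F\<ge>max F0 F1. \<forall>w. LS p k a (u + v) w
     = fE * (\<Sum>f\<le>F. QW (2 * int p * k - int f) * fps_const (Yp p k a (Gm p 1 f (u + v)) w))"
  proof (intro allI impI)
    fix F w assume "F \<ge> max F0 F1"
    then have "F \<ge> F0" "F \<ge> F1" by auto
    then show "LS p k a (u + v) w
     = fE * (\<Sum>f\<le>F. QW (2 * int p * k - int f) * fps_const (Yp p k a (Gm p 1 f (u + v)) w))"
      using * by (simp only: W Yp_add_left Gm_add fps_const_add[symmetric] sum.distrib distrib_left)
  qed
  then show ?case by blast
next
  case (mult n u)
  then have n: "n \<ge> 1" by simp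
  let ?b = "2 * int p * k"
  let ?R = "\<lambda>F u w. (\<Sum>f\<le>F. QW (?b - int f) * fps_const (Yp p k a (Gm p 1 f u) w))"
  from mult obtain F0 where IH: "\<And>F w. F \<ge> F0 \<Longrightarrow> LS p k a u w = fE * ?R F u w" by blast
  \<comment> \<open>With these coefficients the contractions of the modes alpha(c), c \<ge> 0, with
    E^-(x) sum to - (x - z)^(-n), up to the factor 2p.\<close>
  have kq: "kp n c = - ((-1) powi (- int n) * sb (of_int (- int n)) c)" for c
  proof -
    have "kp n c = (-1) ^ (n - 1) * ((of_nat c + 1 + of_nat (n - 1) - 1) gchoose (n - 1))"
      unfolding kp_def using gbinomial_minus[of "of_nat c + 1 :: complex" "n - 1"] by simp
    also have "(of_nat c + 1 + of_nat (n - 1) - 1) = (of_nat (c + n - 1) :: complex)"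
      using n by (simp add: of_nat_diff)
    also have "(of_nat (c + n - 1) gchoose (n - 1)) = (sb (- of_nat n) c)"
      by (simp add: sb_neg_nat[OF n] binomial_gbinomial)
    also have "(-1) ^ (n - 1) = - ((-1) powi (- int n) :: complex)"
      using n by (cases n) (auto simp: power_int_minus One_nat_def power_int_of_nat field_simps simp del: of_nat_Suc)
    finally show ?thesis by simp
  qed
  have "LS p k a (Xv n * u) w = fE * ?R F (Xv n * u) w" if F: "F \<ge> F0 + n" for F w
  proof -
    let ?C = "\<lambda>c. kc (kp n c) * zp (- int (c + n))"
    have "LS p k a (Xv n * u) w = fps_const (Af n) * LS p k a u w
       + (\<Sum>c\<le>vb w. fps_const (?C c) * LS p k a u (al0 p a c w))
       - fps_const (kc (tw p)) * (QW (- int n) * LS p k a u w)"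
    proof (rule fps_ext)
      fix g
      let ?K = "g + vb w"
      have v: "vb (Sc 1 (int g) * w) \<le> ?K" by (rule vb_Sc_mult)
      have "LS p k a (Xv n * u) w $ g = Af n * LS p k a u w $ g
         + (\<Sum>c\<le>?K. ?C c * (Yp p k (a + 2 * int p) u (Sc 1 (int g) * al0 p a c w)))
         + kc (tw p) * (\<Sum>c\<le>?K. ?C c * Yp p k (a + 2 * int p) u (Sc 1 (int g - int c) * w))"
        unfolding LS_def fps_nth_Abs_fps Yp_Xv[OF v] al0_Sc Yp_add Yp_Cn_mult
        by (simp only: distrib_left sum.distrib sum_distrib_left mult.left_commute[of _ "kc (tw p)"] mult.assoc add.assoc)
      also have "(\<Sum>c\<le>?K. ?C c * (Yp p k (a + 2 * int p) u (Sc 1 (int g) * al0 p a c w)))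
         = (\<Sum>c\<le>vb w. ?C c * (Yp p k (a + 2 * int p) u (Sc 1 (int g) * al0 p a c w)))"
        by (intro sum.mono_neutral_right) (auto simp: al0_zero)
      also have "(\<Sum>c\<le>?K. ?C c * Yp p k (a + 2 * int p) u (Sc 1 (int g - int c) * w))
         = (\<Sum>c\<le>g. ?C c * Yp p k (a + 2 * int p) u (Sc 1 (int g - int c) * w))"
        by (intro sum.mono_neutral_right) auto
      also have "\<dots> = - (\<Sum>c\<le>g. QW (- int n) $ c * LS p k a u w $ (g - c))"
        unfolding sum_negf[symmetric] kq
      proof (intro sum.cong refl)
        fix c assume c: "c \<in> {..g}"
        have e: "- int (c + n) = - int n - int c" "int g - int c = int (g - c)" using c by auto
        show "kc (- ((-1) powi (- int n) * sb (of_int (- int n)) c)) * zp (- int (c + n)) * Yp p k (a + 2 * int p) u (Sc 1 (int g - int c) * w)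
           = - (QW (- int n) $ c * LS p k a u w $ (g - c))"
          unfolding e QW_def LS_def fps_nth_Abs_fps kc_uminus by (simp only: mult_minus_left)
      qed
      also have "\<dots> = - ((QW (- int n) * LS p k a u w) $ g)"
        by (simp add: fps_mult_nth atMost_atLeast0)
      finally show "LS p k a (Xv n * u) w $ g = (fps_const (Af n) * LS p k a u w
         + (\<Sum>c\<le>vb w. fps_const (?C c) * LS p k a u (al0 p a c w))
         - fps_const (kc (tw p)) * (QW (- int n) * LS p k a u w)) $ g"
        by (simp add: fps_sum_nth LS_def)
    qed
    also have "\<dots> = fE * (fps_const (Af n) * ?R F u w
       + (\<Sum>c\<le>vb w. fps_const (?C c) * ?R F u (al0 p a c w))
       - fps_const (kc (tw p)) * (QW (- int n) * ?R (F - n) u w))"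
    proof -
      have "LS p k a u w = fE * ?R F u w" "LS p k a u w = fE * ?R (F - n) u w"
         "\<And>c. LS p k a u (al0 p a c w) = fE * ?R F u (al0 p a c w)"
        using F IH[of F] IH[of "F - n"] by auto
      then have "fps_const (Af n) * LS p k a u w
       + (\<Sum>c\<le>vb w. fps_const (?C c) * LS p k a u (al0 p a c w))
       - fps_const (kc (tw p)) * (QW (- int n) * LS p k a u w) = 
        fps_const (Af n) * (fE * ?R F u w)
       + (\<Sum>c\<le>vb w. fps_const (?C c) * (fE * ?R F u (al0 p a c w)))
       - fps_const (kc (tw p)) * (QW (- int n) * (fE * ?R (F - n) u w))" by presburger
      then show ?thesis
        by (simp only: distrib_left right_diff_distrib sum_distrib_left mult.left_commute[of _ fE])
    qed
    also have "fps_const (Af n) * ?R F u w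
       + (\<Sum>c\<le>vb w. fps_const (?C c) * ?R F u (al0 p a c w))
       - fps_const (kc (tw p)) * (QW (- int n) * ?R (F - n) u w) = ?R F (Xv n * u) w"
    proof -
      have W: "fps_const (Yp p k a (Gm p 1 f (Xv n * u)) w) = fps_const (Af n) * fps_const (Yp p k a (Gm p 1 f u) w)
         + (\<Sum>c\<le>vb w. fps_const (?C c) * fps_const (Yp p k a (Gm p 1 f u) (al0 p a c w)))
         - (if n \<le> f then fps_const (kc (tw p)) * fps_const (Yp p k a (Gm p 1 (f - n) u) w) else 0)" for f
        by (rule fps_ext)
           (simp add: Gm1_Xv[OF n] Yp_diff_left Yp_Xv[OF order_refl] Yp_Cn_mult_left fps_sum_nth mult.assoc)
      have "?R F (Xv n * u) w = fps_const (Af n) * ?R F u w + (\<Sum>c\<le>vb w. fps_const (?C c) * ?R F u (al0 p a c w))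
         - (\<Sum>f\<le>F. if n \<le> f then QW (?b - int f) * (fps_const (kc (tw p)) * fps_const (Yp p k a (Gm p 1 (f - n) u) w)) else 0)"
      proof -
        have "(\<Sum>f\<le>F. QW (?b - int f) * (\<Sum>c\<le>vb w. fps_const (?C c) * fps_const (Yp p k a (Gm p 1 f u) (al0 p a c w))))
          = (\<Sum>c\<le>vb w. fps_const (?C c) * ?R F u (al0 p a c w))"
          unfolding sum_distrib_left by (subst sum.swap) (simp only: mult_ac)
        then show ?thesis unfolding W
          by (simp only: distrib_left right_diff_distrib sum.distrib sum_subtractf)
             (simp add: sum_distrib_left mult.left_commute[of "fps_const (Af n)"] if_distrib[of "\<lambda>x. _ * x"] del: fps_const_mult cong: if_cong)
      qed
      also have "(\<Sum>f\<le>F. if n \<le> f then QW (?b - int f) * (fps_const (kc (tw p)) * fps_const (Yp p k a (Gm p 1 (f - n) u) w)) else 0)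
        = (\<Sum>f\<in>{n..F}. QW (?b - int f) * (fps_const (kc (tw p)) * fps_const (Yp p k a (Gm p 1 (f - n) u) w)))"
        by (intro sum.mono_neutral_cong_right) auto
      also have "\<dots> = (\<Sum>f\<le>F - n. QW (?b - int (f + n)) * (fps_const (kc (tw p)) * fps_const (Yp p k a (Gm p 1 f u) w)))"
        using F by (intro sum.reindex_bij_witness[of _ "\<lambda>i. i + n" "\<lambda>i. i - n"]) auto
      also have "\<dots> = fps_const (kc (tw p)) * (QW (- int n) * ?R (F - n) u w)"
      proof -
        have "QW (?b - int (f + n)) = QW (- int n) * QW (?b - int f)" for f
          by (simp add: QW_mult algebra_simps)
        then show ?thesis by (simp add: sum_distrib_left mult_ac del: fps_const_mult)
      qed
      finally show ?thesis by simp
    qed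
    finally show ?thesis .
  qed
  then show ?case by blast
qed

section \<open>Vertex operators of the iterates of the screening current\<close>

text \<open>The divided derivative (d/dz)^g / g!. Dividing at every step keeps the Leibniz rule free
  of binomial coefficients.\<close>

primrec hsd :: "nat \<Rightarrow> pol fls \<Rightarrow> pol fls" where
  "hsd 0 F = F"
| "hsd (Suc g) F = kc (1 / of_nat (Suc g)) * fls_deriv (hsd g F)"

lemma hsd_nth: "hsd g F $$ N = Cn (of_int (N + int g) gchoose g) * F $$ (N + int g)"
proof (induction g arbitrary: N)
  case (Suc g)
  define A :: complex where "A = of_int (N + 1 + int g)"
  have b: "1 / of_nat (Suc g) * (of_int (N + 1) * (A gchoose g)) = A gchoose (Suc g)"
  proof -
    have "A * (A gchoose g) = of_nat g * (A gchoose g) + of_nat (Suc g) * (A gchoose Suc g)"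
      by (rule gbinomial_mult_1)
    moreover have "of_int (N + 1) = A - of_nat g" by (simp add: A_def)
    ultimately have "of_int (N + 1) * (A gchoose g) = of_nat (Suc g) * (A gchoose Suc g)"
      by (simp only: left_diff_distrib) (simp del: of_nat_Suc)
    then show ?thesis by (simp del: of_nat_Suc)
  qed
  have i: "N + int (Suc g) = N + 1 + int g" by simp
  have "hsd (Suc g) F $$ N = Cn (1 / of_nat (Suc g)) * (Cn (of_int (N + 1)) * (Cn (A gchoose g) * F $$ (N + 1 + int g)))"
    by (simp only: hsd.simps kc_mult_nth fls_deriv_nth Suc A_def Cn_of_int)
  also have "\<dots> = Cn (A gchoose Suc g) * F $$ (N + 1 + int g)"
    unfolding b[symmetric] by (simp only: Cn_mult mult.assoc)
  finally show ?case unfolding A_def i .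
qed simp

lemma hsd_add: "hsd g (F + G) = hsd g F + hsd g G"
  by (simp add: fls_eq_iff hsd_nth distrib_left)
lemma hsd_deriv: "hsd g (fls_deriv F) = kc (of_nat (Suc g)) * hsd (Suc g) F"
proof -
  have "(of_int (N + int g) gchoose g) * of_int (N + int g + 1) = of_nat (Suc g) * ((of_int (N + int (Suc g)) gchoose Suc g) :: complex)" for N
    using gbinomial_absorption[of g "of_int (N + int (Suc g)) :: complex"] by (simp add: mult.commute algebra_simps)
  then have "Cn (of_int (N + int g) gchoose g) * of_int (N + int g + 1) = Cn (of_nat (Suc g)) * Cn (of_int (N + int (Suc g)) gchoose Suc g)" for N
    by (simp only: Cn_mult[symmetric] Cn_of_int[symmetric])
  moreover have "N + int (Suc g) = N + int g + 1" for N by simp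
  ultimately show ?thesis
    by (simp only: fls_eq_iff hsd_nth kc_mult_nth fls_deriv_nth mult.assoc[symmetric]) simp
qed

lemma hsd_Suc': "kc (of_nat (Suc g)) * hsd (Suc g) F = fls_deriv (hsd g F)"
  by (simp only: hsd.simps mult.assoc[symmetric] kc_mult[symmetric]) (simp del: of_nat_Suc)

lemma kc_cancel: "c \<noteq> 0 \<Longrightarrow> kc c * F = kc c * G \<Longrightarrow> F = G"
  by (simp add: fls_eq_iff)

lemma hsd_mult: "hsd g (A * F) = (\<Sum>n\<le>g. hsd n A * hsd (g - n) F)"
proof (induction g)
  case (Suc g)
  let ?t = "\<lambda>n. hsd n A * hsd (Suc g - n) F"
  have "kc (of_nat (Suc g)) * hsd (Suc g) (A * F) = fls_deriv (hsd g (A * F))" by (rule hsd_Suc')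
  also have "\<dots> = (\<Sum>n\<le>g. fls_deriv (hsd n A) * hsd (g - n) F) + (\<Sum>n\<le>g. hsd n A * fls_deriv (hsd (g - n) F))"
    by (simp add: Suc fls_deriv_sum sum.distrib add.commute)
  also have "(\<Sum>n\<le>g. fls_deriv (hsd n A) * hsd (g - n) F) = (\<Sum>n\<le>g. kc (of_nat (Suc n)) * ?t (Suc n))"
    by (simp only: hsd_Suc'[symmetric] mult.assoc diff_Suc_Suc)
  also have "\<dots> = (\<Sum>n\<le>Suc g. kc (of_nat n) * ?t n)"
    by (subst sum.atMost_Suc_shift) simp
  also have "(\<Sum>n\<le>g. hsd n A * fls_deriv (hsd (g - n) F)) = (\<Sum>n\<le>g. kc (of_nat (Suc g - n)) * ?t n)"
    by (intro sum.cong refl) (simp only: hsd_Suc'[symmetric] Suc_diff_le atMost_iff mult.left_commute)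
  also have "\<dots> = (\<Sum>n\<le>Suc g. kc (of_nat (Suc g - n)) * ?t n)" by simp
  also have "(\<Sum>n\<le>Suc g. kc (of_nat n) * ?t n) + (\<Sum>n\<le>Suc g. kc (of_nat (Suc g - n)) * ?t n)
     = (\<Sum>n\<le>Suc g. kc (of_nat (Suc g)) * ?t n)"
    unfolding sum.distrib[symmetric]
  proof (intro sum.cong refl)
    fix n assume "n \<in> {..Suc g}"
    then have "of_nat n + of_nat (Suc g - n) = (of_nat (Suc g) :: complex)" by (simp add: of_nat_diff)
    then show "kc (of_nat n) * ?t n + kc (of_nat (Suc g - n)) * ?t n = kc (of_nat (Suc g)) * ?t n"
      by (simp only: distrib_right[symmetric] kc_add[symmetric])
  qed
  also have "\<dots> = kc (of_nat (Suc g)) * (\<Sum>n\<le>Suc g. ?t n)" by (simp only: sum_distrib_left)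
  finally show ?case by (rule kc_cancel[rotated]) (simp del: of_nat_Suc)
qed simp

lemma Af_hsd: "n \<ge> 1 \<Longrightarrow> Af n = hsd (n - 1) (Af 1)"
proof (unfold fls_eq_iff, rule allI)
  fix N assume n: "n \<ge> 1"
  show "Af n $$ N = hsd (n - 1) (Af 1) $$ N"
  proof (cases "N < 0")
    case False
    define m where "m = nat N + n - 1"
    have e: "N + int (n - 1) = int m" "nat N + n = m + 1" using False n by (auto simp: m_def of_nat_diff)
    have c: "(of_int (int m) gchoose (n - 1)) = (of_nat (m choose (n - 1)) :: complex)"
      by (simp add: binomial_gbinomial)
    show ?thesis unfolding hsd_nth e c Af_nth m_def[symmetric] using False by (simp add: Cn_of_nat)
  next
    case True
    show ?thesis
    proof (cases "N + int (n - 1) < 0")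
      case False
      then have e: "N + int (n - 1) = int (nat (N + int (n - 1)))" by simp
      have "(of_int (N + int (n - 1)) gchoose (n - 1)) = (of_nat (nat (N + int (n - 1)) choose (n - 1)) :: complex)"
        by (subst e) (simp add: binomial_gbinomial)
      also have "nat (N + int (n - 1)) choose (n - 1) = 0" using True False by (intro binomial_eq_0) (simp add: nat_less_iff)
      finally show ?thesis using True by (simp add: hsd_nth Af_nth)
    qed (use True in \<open>simp add: hsd_nth Af_nth\<close>)
  qed
qed

lemma zp_hsd: "n \<ge> 1 \<Longrightarrow> kc (kp n c) * zp (- int (c + n)) = hsd (n - 1) (zp (- int (c + 1)))"
proof (unfold fls_eq_iff, rule allI)
  fix N assume n: "n \<ge> 1"
  show "(kc (kp n c) * zp (- int (c + n))) $$ N = hsd (n - 1) (zp (- int (c + 1))) $$ N"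
  proof (cases "N + int (n - 1) = - int (c + 1)")
    case True
    have e: "of_int (- int (c + 1)) = (- of_nat c - 1 :: complex)" by simp
    have "N = - int (c + n)" using True n by (simp add: of_nat_diff)
    then show ?thesis unfolding hsd_nth True e by (simp add: zp_nth kp_def)
  next
    case False
    then have "N \<noteq> - int (c + n)" using n by (auto simp: of_nat_diff)
    then show ?thesis using False by (simp add: hsd_nth zp_nth)
  qed
qed

lemma Af1_mult_nth: assumes "\<And>n. n < 0 \<Longrightarrow> G $$ n = 0"
  shows "(Af 1 * G) $$ N = (\<Sum>n\<in>{1..nat (N + 1)}. Xv n * G $$ (N + 1 - int n))"
proof -
  have "(Af 1 * G) $$ N = (\<Sum>j\<in>{0..N - 0}. Af 1 $$ j * G $$ (N - j))"
    by (rule fls_times_nth_lb) (auto simp: Af_nth assms)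
  also have "\<dots> = (\<Sum>n\<in>{1..nat (N + 1)}. Xv n * G $$ (N + 1 - int n))"
    by (rule sum.reindex_bij_witness[of _ "\<lambda>n. int n - 1" "\<lambda>j. nat (j + 1)"]) (auto simp: Af_nth nat_add_distrib One_nat_def)
  finally show ?thesis .
qed

lemma deriv_Em: "fls_deriv (Em k) = of_int k * (Af 1 * Em k)"
proof (unfold fls_eq_iff, rule allI)
  fix N
  have "fls_deriv (Em k) $$ N = of_int (N + 1) * Sc k (N + 1)" by simp
  also have "\<dots> = of_int k * (\<Sum>n\<in>{1..nat (N + 1)}. Xv n * Sc k (N + 1 - int n))" by (rule Sc_rec)
  also have "\<dots> = (of_int k * (Af 1 * Em k)) $$ N"
    using fls_const_mult_nth[of "of_int k" "Af 1 * Em k" N] by (simp add: Af1_mult_nth fls_of_int)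
  finally show "fls_deriv (Em k) $$ N = (of_int k * (Af 1 * Em k)) $$ N" .
qed

text \<open>A power series with constant term 1 is determined by its logarithmic derivative.\<close>

lemma Em_unique:
  assumes z: "\<And>n. n < 0 \<Longrightarrow> G $$ n = 0" and o: "G $$ 0 = 1" and d: "fls_deriv G = of_int k * (Af 1 * G)"
  shows "G = Em k"
proof (unfold fls_eq_iff, rule allI)
  fix N show "G $$ N = Em k $$ N"
  proof (induction N rule: Sc_induct)
    case (1 N)
    show ?case
    proof (cases "N \<le> 0")
      case True then show ?thesis using z o by (cases "N = 0") auto
    next
      case False
      have "of_int N * G $$ N = (of_int k * (Af 1 * G)) $$ (N - 1)"
        unfolding d[symmetric] by simp
      also have "\<dots> = of_int k * (\<Sum>n\<in>{1..nat N}. Xv n * G $$ (N - int n))"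
        using fls_const_mult_nth[of "of_int k" "Af 1 * G" "N - 1"] by (simp add: Af1_mult_nth[OF z] fls_of_int)
      also have "\<dots> = of_int k * (\<Sum>n\<in>{1..nat N}. Xv n * Sc k (N - int n))"
        using 1 by simp
      also have "\<dots> = of_int N * Sc k N" by (rule Sc_rec[symmetric])
      finally have E: "of_int N * G $$ N = of_int N * Sc k N" .
      show ?thesis unfolding Em_nth by (rule pol_cancel[OF _ E]) (use False in simp)
    qed
  qed (simp add: z)
qed

lemma Em_add: "Em (k + l) = Em k * Em l"
proof (rule Em_unique[symmetric])
  have nth: "(Em k * Em l) $$ n = (\<Sum>j\<in>{0..n - 0}. Em k $$ j * Em l $$ (n - j))" for n
    by (rule fls_times_nth_lb) auto
  show "(Em k * Em l) $$ n = 0" if "n < 0" for n using that by (simp add: nth)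
  show "(Em k * Em l) $$ 0 = 1" by (simp add: nth)
  show "fls_deriv (Em k * Em l) = of_int (k + l) * (Af 1 * (Em k * Em l))"
    by (simp add: deriv_Em algebra_simps)
qed

lemma Ep_comp: assumes "vb w \<le> F"
  shows "Ep p (k + 1) w = (\<Sum>f\<le>F. zp (- int f) * Ep p k (Gm p 1 f w))"
proof (unfold fls_eq_iff, rule allI)
  fix N
  have R: "(\<Sum>f\<le>F. zp (- int f) * Ep p k (Gm p 1 f w)) $$ N = (\<Sum>f\<le>F. Ep p k (Gm p 1 f w) $$ (N + int f))"
    by (simp add: fls_nth_sum)
  show "Ep p (k + 1) w $$ N = (\<Sum>f\<le>F. zp (- int f) * Ep p k (Gm p 1 f w)) $$ N"
  proof (cases "N \<le> 0")
    case False then show ?thesis unfolding R by (simp add: Ep_nth)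
  next
    case True
    define n where "n = nat (- N)"
    have N: "N = - int n" using True by (simp add: n_def)
    have "Ep p (k + 1) w $$ N = (\<Sum>i\<le>n. Gm p k i (Gm p 1 (n - i) w))"
      by (simp add: N Ep_nth Gm_comp)
    also have "\<dots> = (\<Sum>f\<le>n. Gm p k (n - f) (Gm p 1 f w))"
      by (rule sum.reindex_bij_witness[of _ "\<lambda>i. n - i" "\<lambda>i. n - i"]) auto
    also have "\<dots> = (\<Sum>f\<le>max n F. if f \<le> n \<and> f \<le> F then Gm p k (n - f) (Gm p 1 f w) else 0)"
      using assms by (intro sum.mono_neutral_cong_left) (auto simp: Gm_zero)
    also have "\<dots> = (\<Sum>f\<le>F. Ep p k (Gm p 1 f w) $$ (N + int f))"
      by (intro sum.mono_neutral_cong_right) (auto simp: Ep_nth N nat_diff_distrib)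
    finally show ?thesis unfolding R .
  qed
qed

text \<open>The normally ordered product of Y(e^alpha, z) and Y(u e^(k alpha), z) at the same point;
  it is the case g = 0 of \<open>Yp_Sc_left\<close>.\<close>

lemma Yp_succ: assumes "vb w \<le> F"
  shows "Yp p (k + 1) a u w = (\<Sum>f\<le>F. (zp (a - int f) * Em 1) * Yp p k a u (Gm p 1 f w))"
  using assms
proof (induction u arbitrary: w rule: pol_induct)
  case (const d)
  have "zp ((k + 1) * a) * (Em (k + 1) * zp (- int f)) = (zp (a - int f) * Em 1) * (zp (k * a) * Em k)" for f
  proof -
    have "(k + 1) * a + - int f = (a - int f) + k * a" by (simp add: algebra_simps)
    then have "zp ((k + 1) * a) * zp (- int f) = zp (a - int f) * zp (k * a)" by (simp only: zp_add)
    then show ?thesis by (simp add: Em_add mult_ac)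
  qed
  then have "zp ((k + 1) * a) * (Em (k + 1) * (zp (- int f) * Ep p k (Gm p 1 f w)))
      = (zp (a - int f) * Em 1) * (zp (k * a) * (Em k * Ep p k (Gm p 1 f w)))" for f
    by (simp only: mult.assoc[symmetric])
  then show ?case unfolding Yp_Cn Ep_comp[OF const] sum_distrib_left
    by (simp only: mult.left_commute[of "kc d"])
next
  case (add u v) then show ?case by (simp add: Yp_add_left distrib_left sum.distrib)
next
  case (mult n u)
  have v: "vb (al0 p a c w) \<le> F" for c using vb_al0[of p a c w] mult.prems by linarith
  have v2: "vb (Gm p 1 f w) \<le> F" for f using vb_Gm[of p 1 f w] mult.prems by linarith
  let ?T = "\<lambda>f. zp (a - int f) * Em 1"
  let ?C = "\<lambda>c. kc (kp n c) * zp (- int (c + n))"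
  have "Yp p (k + 1) a (Xv n * u) w = Af n * (\<Sum>f\<le>F. ?T f * Yp p k a u (Gm p 1 f w))
     + (\<Sum>c\<le>F. ?C c * (\<Sum>f\<le>F. ?T f * Yp p k a u (Gm p 1 f (al0 p a c w))))"
    unfolding Yp_Xv[OF mult.prems] mult.IH[OF mult.prems] mult.IH[OF v] by (simp only: mult.assoc)
  also have "(\<Sum>c\<le>F. ?C c * (\<Sum>f\<le>F. ?T f * Yp p k a u (Gm p 1 f (al0 p a c w))))
     = (\<Sum>f\<le>F. ?T f * (\<Sum>c\<le>F. ?C c * Yp p k a u (al0 p a c (Gm p 1 f w))))"
    unfolding sum_distrib_left Gm_al0 by (subst sum.swap) (simp only: mult_ac)
  also have "Af n * (\<Sum>f\<le>F. ?T f * Yp p k a u (Gm p 1 f w)) = (\<Sum>f\<le>F. ?T f * (Af n * Yp p k a u (Gm p 1 f w)))"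
    unfolding sum_distrib_left by (simp only: mult_ac)
  finally show ?case unfolding Yp_Xv[OF v2]
    by (simp only: distrib_left sum.distrib mult.assoc)
qed

text \<open>A Taylor expansion: Y(E^-(t) u e^((k+1) alpha), z) is the normally ordered product of
  e^alpha at z + t with Y(u e^(k alpha), z), so the coefficient of t^g carries a divided derivative
  of order g. After multiplication by g, \<open>Sc_rec\<close> on the left matches the Leibniz rule
  on the right.\<close>

theorem Yp_Sc_left: assumes "vb w \<le> F"
  shows "Yp p (k + 1) a (Sc 1 (int g) * u) w = (\<Sum>f\<le>F. hsd g (zp (a - int f) * Em 1) * Yp p k a u (Gm p 1 f w))"
  using assms
proof (induction g arbitrary: w rule: less_induct)
  case (less g)
  show ?case
  proof (cases g)
    case 0 then show ?thesis using Yp_succ[OF less.prems] by simp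
  next
    case (Suc g')
    let ?T = "\<lambda>f. zp (a - int f) * Em 1"
    let ?V = "\<lambda>f. Yp p k a u (Gm p 1 f w)"
    let ?Y = "Yp p (k + 1) a"
    have v: "vb (al0 p a c w) \<le> F" for c using vb_al0[of p a c w] less.prems by linarith
    have IH: "?Y (Sc 1 (int g - int n) * u) w' = (\<Sum>f\<le>F. hsd (g - n) (?T f) * Yp p k a u (Gm p 1 f w'))"
      if "n \<in> {1..g}" "vb w' \<le> F" for n w'
      using less.IH[of "g - n" w'] that by (simp add: of_nat_diff)
    have e: "kc (of_nat g) * ?Y (Sc 1 (int g) * u) w = (\<Sum>n\<in>{1..g}. ?Y (Xv n * (Sc 1 (int g - int n) * u)) w)"
    proof -
      have "kc (of_nat g) * ?Y (Sc 1 (int g) * u) w = ?Y (Cn (of_nat g) * (Sc 1 (int g) * u)) w"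
        by (simp only: Yp_Cn_mult_left)
      also have "Cn (of_nat g) * (Sc 1 (int g) * u) = (\<Sum>n\<in>{1..g}. Xv n * (Sc 1 (int g - int n) * u))"
        using Sc_rec[of "int g" 1] by (simp add: Cn_of_nat mult.assoc[symmetric] sum_distrib_right)
      finally show ?thesis by (simp only: Yp_sum_left)
    qed
    also have "\<dots> = (\<Sum>n\<in>{1..g}. Af n * (\<Sum>f\<le>F. hsd (g - n) (?T f) * ?V f)
       + (\<Sum>c\<le>F. kc (kp n c) * zp (- int (c + n)) * (\<Sum>f\<le>F. hsd (g - n) (?T f) * Yp p k a u (Gm p 1 f (al0 p a c w)))))"
      unfolding Yp_Xv[OF less.prems] using IH less.prems v by (intro sum.cong refl) (simp only: mult.assoc)
    also have "\<dots> = (\<Sum>n\<in>{1..g}. hsd (n - 1) (Af 1) * (\<Sum>f\<le>F. hsd (g - n) (?T f) * ?V f)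
       + (\<Sum>c\<le>F. hsd (n - 1) (zp (- int (c + 1))) * (\<Sum>f\<le>F. hsd (g - n) (?T f) * Yp p k a u (Gm p 1 f (al0 p a c w)))))"
    proof (intro sum.cong refl)
      fix n assume "n \<in> {1..g}"
      then have n: "n \<ge> 1" by simp
      show "Af n * (\<Sum>f\<le>F. hsd (g - n) (?T f) * ?V f)
       + (\<Sum>c\<le>F. kc (kp n c) * zp (- int (c + n)) * (\<Sum>f\<le>F. hsd (g - n) (?T f) * Yp p k a u (Gm p 1 f (al0 p a c w))))
       = hsd (n - 1) (Af 1) * (\<Sum>f\<le>F. hsd (g - n) (?T f) * ?V f)
       + (\<Sum>c\<le>F. hsd (n - 1) (zp (- int (c + 1))) * (\<Sum>f\<le>F. hsd (g - n) (?T f) * Yp p k a u (Gm p 1 f (al0 p a c w))))"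
        by (simp only: Af_hsd[OF n] zp_hsd[OF n])
    qed
    also have "\<dots> = (\<Sum>n\<le>g'. hsd n (Af 1) * (\<Sum>f\<le>F. hsd (g' - n) (?T f) * ?V f)
       + (\<Sum>c\<le>F. hsd n (zp (- int (c + 1))) * (\<Sum>f\<le>F. hsd (g' - n) (?T f) * Yp p k a u (Gm p 1 f (al0 p a c w)))))"
      using Suc by (intro sum.reindex_bij_witness[of _ Suc "\<lambda>n. n - 1"]) (auto simp: One_nat_def)
    also have "\<dots> = (\<Sum>n\<le>g'. \<Sum>f\<le>F. hsd n (Af 1) * hsd (g' - n) (?T f) * ?V f)
       + (\<Sum>n\<le>g'. \<Sum>c\<le>F. \<Sum>f\<le>F. hsd n (zp (- int (c + 1))) * hsd (g' - n) (?T f) * Yp p k a u (Gm p 1 f (al0 p a c w)))"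
      by (simp only: sum.distrib sum_distrib_left mult.assoc)
    also have "(\<Sum>n\<le>g'. \<Sum>f\<le>F. hsd n (Af 1) * hsd (g' - n) (?T f) * ?V f) = (\<Sum>f\<le>F. hsd g' (Af 1 * ?T f) * ?V f)"
      by (subst sum.swap) (simp only: hsd_mult sum_distrib_right)
    also have "(\<Sum>n\<le>g'. \<Sum>c\<le>F. \<Sum>f\<le>F. hsd n (zp (- int (c + 1))) * hsd (g' - n) (?T f) * Yp p k a u (Gm p 1 f (al0 p a c w)))
       = (\<Sum>c\<le>F. \<Sum>f\<le>F. hsd g' (zp (- int (c + 1)) * ?T f) * Yp p k a u (Gm p 1 f (al0 p a c w)))"
    proof -
      let ?t = "\<lambda>n c f. hsd n (zp (- int (c + 1))) * hsd (g' - n) (?T f) * Yp p k a u (Gm p 1 f (al0 p a c w))"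
      have "(\<Sum>n\<le>g'. \<Sum>c\<le>F. \<Sum>f\<le>F. ?t n c f) = (\<Sum>c\<le>F. \<Sum>n\<le>g'. \<Sum>f\<le>F. ?t n c f)" by (rule sum.swap)
      also have "\<dots> = (\<Sum>c\<le>F. \<Sum>f\<le>F. \<Sum>n\<le>g'. ?t n c f)" by (intro sum.cong refl sum.swap)
      finally show ?thesis by (simp only: hsd_mult sum_distrib_right)
    qed
    \<comment> \<open>For a fixed total exponent f the vectors alpha(c) applied to
      \<open>Gm p 1 (f - c) w\<close> add up, by \<open>Gm_rec\<close> and the zero mode, to (a - f)
      times \<open>Gm p 1 f w\<close>. This is the factor produced by differentiating z^(a -
      f).\<close>
    also have "\<dots> = (\<Sum>f\<le>F. hsd g' (zp (a - int f - 1) * Em 1) * (kc (of_int a - of_nat f) * ?V f))"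
    proof -
      let ?H = "\<lambda>f. hsd g' (zp (a - int f - 1) * Em 1)"
      have z: "zp (- int (c + 1)) * ?T f = zp (a - int (f + c) - 1) * Em 1" for c f
      proof -
        have "- int (c + 1) + (a - int f) = a - int (f + c) - 1" by simp
        then show ?thesis by (simp only: zp_add_left)
      qed
      have "(\<Sum>c\<le>F. \<Sum>f\<le>F. hsd g' (zp (- int (c + 1)) * ?T f) * Yp p k a u (Gm p 1 f (al0 p a c w)))
        = (\<Sum>c\<le>F. \<Sum>f\<le>F. ?H (f + c) * Yp p k a u (al0 p a c (Gm p 1 f w)))"
        by (simp only: z Gm_al0)
      also have "\<dots> = (\<Sum>c\<le>F. \<Sum>f'\<le>F. if c \<le> f' then ?H f' * Yp p k a u (al0 p a c (Gm p 1 (f' - c) w)) else 0)"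
      proof (rule sum.cong[OF refl])
        fix c assume c: "c \<in> {..F}"
        have "(\<Sum>f'\<le>F. if c \<le> f' then ?H f' * Yp p k a u (al0 p a c (Gm p 1 (f' - c) w)) else 0)
          = (\<Sum>f'\<in>{c..F}. ?H f' * Yp p k a u (al0 p a c (Gm p 1 (f' - c) w)))"
          by (intro sum.mono_neutral_cong_right) auto
        also have "\<dots> = (\<Sum>f\<le>F - c. ?H (f + c) * Yp p k a u (al0 p a c (Gm p 1 f w)))"
          using c by (intro sum.reindex_bij_witness[of _ "\<lambda>f. f + c" "\<lambda>f. f - c"]) auto
        also have "\<dots> = (\<Sum>f\<le>F. ?H (f + c) * Yp p k a u (al0 p a c (Gm p 1 f w)))"
        proof (intro sum.mono_neutral_left ballI)
          fix f assume "f \<in> {..F} - {..F - c}"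
          then have "c + f > vb w" "c \<noteq> 0" using less.prems by auto
          then show "?H (f + c) * Yp p k a u (al0 p a c (Gm p 1 f w)) = 0"
            by (simp add: al0_def al_Gm_zero)
        qed auto
        finally show "(\<Sum>f\<le>F. ?H (f + c) * Yp p k a u (al0 p a c (Gm p 1 f w)))
          = (\<Sum>f'\<le>F. if c \<le> f' then ?H f' * Yp p k a u (al0 p a c (Gm p 1 (f' - c) w)) else 0)" by simp
      qed
      also have "\<dots> = (\<Sum>f'\<le>F. \<Sum>c\<le>F. if c \<le> f' then ?H f' * Yp p k a u (al0 p a c (Gm p 1 (f' - c) w)) else 0)"
        by (rule sum.swap)
      also have "\<dots> = (\<Sum>f\<le>F. ?H f * (kc (of_int a - of_nat f) * ?V f))"
      proof (intro sum.cong refl)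
        fix f assume f: "f \<in> {..F}"
        have "(\<Sum>c\<le>F. if c \<le> f then ?H f * Yp p k a u (al0 p a c (Gm p 1 (f - c) w)) else 0)
          = (\<Sum>c\<le>f. ?H f * Yp p k a u (al0 p a c (Gm p 1 (f - c) w)))"
          using f by (intro sum.mono_neutral_cong_right) auto
        also have "\<dots> = ?H f * Yp p k a u (\<Sum>c\<le>f. al0 p a c (Gm p 1 (f - c) w))"
          by (simp only: Yp_sum sum_distrib_left)
        also have "(\<Sum>c\<le>f. al0 p a c (Gm p 1 (f - c) w)) = Cn (of_int a - of_nat f) * Gm p 1 f w"
        proof -
          have "(\<Sum>c\<le>f. al0 p a c (Gm p 1 (f - c) w)) = of_int a * Gm p 1 f w + (\<Sum>c\<in>{1..f}. al p c (Gm p 1 (f - c) w))"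
            unfolding atMost_atLeast0 by (subst sum.atLeast_Suc_atMost) (auto simp: al0_def One_nat_def intro!: sum.cong)
          also have "(\<Sum>c\<in>{1..f}. al p c (Gm p 1 (f - c) w)) = - (of_nat f * Gm p 1 f w)"
            unfolding Gm_rec by simp
          finally show ?thesis by (simp add: Cn_diff Cn_of_int Cn_of_nat left_diff_distrib)
        qed
        finally show "(\<Sum>c\<le>F. if c \<le> f then ?H f * Yp p k a u (al0 p a c (Gm p 1 (f - c) w)) else 0)
          = ?H f * (kc (of_int a - of_nat f) * ?V f)" by (simp only: Yp_Cn_mult)
      qed
      finally show ?thesis .
    qed
    also have "(\<Sum>f\<le>F. hsd g' (Af 1 * ?T f) * ?V f) + (\<Sum>f\<le>F. hsd g' (zp (a - int f - 1) * Em 1) * (kc (of_int a - of_nat f) * ?V f))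
       = (\<Sum>f\<le>F. kc (of_nat g) * (hsd g (?T f) * ?V f))"
      unfolding sum.distrib[symmetric]
    proof (intro sum.cong refl)
      fix f
      have d: "fls_deriv (?T f) = Af 1 * ?T f + kc (of_int a - of_nat f) * (zp (a - int f - 1) * Em 1)"
      proof -
        have "fls_deriv (zp (a - int f)) = kc (of_int a - of_nat f) * zp (a - int f - 1)"
          by (auto simp: fls_eq_iff zp_nth Cn_diff Cn_of_int Cn_of_nat)
        then show ?thesis by (simp add: deriv_Em mult_ac)
      qed
      have k: "hsd g' (kc c * G) = kc c * hsd g' G" for c G
        by (simp add: fls_eq_iff hsd_nth)
      have "kc (of_nat g) * hsd g (?T f) = hsd g' (fls_deriv (?T f))" unfolding Suc hsd_deriv ..
      also have "\<dots> = hsd g' (Af 1 * ?T f) + kc (of_int a - of_nat f) * hsd g' (zp (a - int f - 1) * Em 1)"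
        unfolding d hsd_add k ..
      finally show "hsd g' (Af 1 * ?T f) * ?V f + hsd g' (zp (a - int f - 1) * Em 1) * (kc (of_int a - of_nat f) * ?V f)
        = kc (of_nat g) * (hsd g (?T f) * ?V f)"
        by (simp only: mult.assoc[symmetric] distrib_right) (simp only: mult_ac)
    qed
    also have "\<dots> = kc (of_nat g) * (\<Sum>f\<le>F. hsd g (?T f) * ?V f)" by (simp only: sum_distrib_left)
    finally show ?thesis by (rule kc_cancel[rotated]) (simp add: Suc del: of_nat_Suc)
  qed
qed

section \<open>Stripped modes of e^alpha, and a residue identity\<close>

lemma Ep_sum_vb: assumes "vb q \<le> F" shows "Ep p k q = (\<Sum>f\<le>F. fls_const (Gm p k f q) * zp (- int f))"
proof -
  have "(\<Sum>f\<le>F. fls_const (Gm p k f q) * zp (- int f)) = (\<Sum>f\<le>max F (gb p k q). fls_const (Gm p k f q) * zp (- int f))"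
    using assms by (intro sum.mono_neutral_left) (auto simp: Gm_zero)
  then show ?thesis using Ep_sum[of p k q "max F (gb p k q)"] by simp
qed

text \<open>The coefficient of \<open>z\<^sup>t\<close> in \<open>Y(e\<^sup>\<alpha>, z)\<close>, stripped of the factor \<open>e\<^sup>\<alpha> z\<^bsup>\<alpha>(0)\<^esup>\<close>.\<close>
definition eps :: "nat \<Rightarrow> int \<Rightarrow> pol \<Rightarrow> pol" where "eps p t q = (Em 1 * Ep p 1 q) $$ t"

lemma eps_sum: assumes "vb q \<le> F" shows "eps p t q = (\<Sum>f\<le>F. Sc 1 (t + int f) * Gm p 1 f q)"
proof -
  have "Em 1 * Ep p 1 q = (\<Sum>f\<le>F. fls_const (Gm p 1 f q) * (zp (- int f) * Em 1))"
    unfolding Ep_sum_vb[OF assms] sum_distrib_left by (simp only: mult_ac)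
  then have "eps p t q = (\<Sum>f\<le>F. (fls_const (Gm p 1 f q) * (zp (- int f) * Em 1)) $$ t)"
    by (simp add: eps_def fls_nth_sum)
  then show ?thesis unfolding fls_const_mult_nth zp_mult_nth by (simp add: mult.commute[of "Gm _ _ _ _"])
qed

lemma eps_add: "eps p t (q + r) = eps p t q + eps p t r"
  by (simp add: eps_def Ep_add distrib_left)
lemma eps_0 [simp]: "eps p t 0 = 0" by (simp add: eps_def)
lemma eps_Cn_mult: "eps p t (Cn c * q) = Cn c * eps p t q"
  by (simp add: eps_def Ep_Cn_mult mult.left_commute[of "Em 1"])
lemma eps_vin: assumes "vin A q" "{1..} \<subseteq> A" shows "vin A (eps p t q)"
proof -
  have S: "vin A (Sc 1 g)" for g
    unfolding vin_def
  proof
    fix nu assume "nu \<in> pkeys (Sc 1 g)"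
    then have "0 \<notin> pkeys nu" by (auto simp: in_keys_iff lookup_Sc split: if_splits)
    then have "pkeys nu \<subseteq> {1..}" by (metis One_nat_def Suc_le_eq atLeast_iff gr0I subsetI)
    then show "pkeys nu \<subseteq> A" using assms by blast
  qed
  have G: "vin A (Gm p 1 f q)" for f
    using assms(1)
  proof (induction q arbitrary: f rule: pol_induct_in)
    case (const c) then show ?case by (simp add: Gm_Cn)
  next
    case (add q r) then show ?case by (simp add: Gm_add vin_add)
  next
    case (mult n q)
    have "vin A (of_int (2 * int p * 1) * Gm p 1 (f - n) q)"
      using vin_mult[OF vin_Cn[of A "of_int (2 * int p * 1)"] mult(3)] by (simp only: Cn_of_int)
    then show ?case unfolding Gm_Xv using mult by (auto intro!: vin_diff vin_mult vin_Xv)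
  qed
  show ?thesis unfolding eps_sum[OF order_refl] by (intro vin_sum vin_mult S G)
qed

text \<open>Both sums are the residue in x of x^(-s) E^-(x) (x - z)^L V(z), expanded for |x| > |z|
  and for |x| < |z|. For L \<ge> 0 the expansions agree; for L < 0 their difference is the residue
  at x = z, a divided derivative of order -1 - L.\<close>

lemma residue_coeff:
  shows "\<exists>I0. \<forall>I\<ge>I0. (\<Sum>i\<le>I. Cn (sb (of_int L) i) * (Sc 1 (int i + s - 1 - L) * V $$ (N - int i)))
     - (\<Sum>i\<le>I. Cn ((-1) powi L * sb (of_int L) i) * (Sc 1 (s - 1 - int i) * V $$ (N - L + int i)))
   = (if L < 0 then (hsd (nat (- 1 - L)) (zp (- s) * Em 1) * V) $$ N else 0)"
proof (cases "L < 0")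
  case False
  define l where "l = nat L"
  have L: "L = int l" using False by (simp add: l_def)
  have z: "sb (of_int L) i = 0" if "i > l" for i
    using that unfolding sb_def L by (simp add: binomial_gbinomial[symmetric])
  have "(\<Sum>i\<le>I. Cn (sb (of_int L) i) * (Sc 1 (int i + s - 1 - L) * V $$ (N - int i)))
     = (\<Sum>i\<le>I. Cn ((-1) powi L * sb (of_int L) i) * (Sc 1 (s - 1 - int i) * V $$ (N - L + int i)))" if I: "I \<ge> l" for I
  proof -
    have "(\<Sum>i\<le>I. Cn ((-1) powi L * sb (of_int L) i) * (Sc 1 (s - 1 - int i) * V $$ (N - L + int i)))
      = (\<Sum>i\<le>l. Cn ((-1) powi L * sb (of_int L) i) * (Sc 1 (s - 1 - int i) * V $$ (N - L + int i)))"
      using I by (intro sum.mono_neutral_right) (auto simp: z)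
    also have "\<dots> = (\<Sum>i\<le>l. Cn (sb (of_int L) i) * (Sc 1 (int i + s - 1 - L) * V $$ (N - int i)))"
    proof (rule sum.reindex_bij_witness[of _ "\<lambda>i. l - i" "\<lambda>i. l - i"])
      fix i assume i: "i \<in> {..l}"
      have "(l choose (l - i)) = (l choose i)" using i by (simp add: binomial_symmetric[symmetric])
      moreover have "(-1::complex) ^ l * (-1) ^ i = (-1) ^ (l - i)"
      proof -
        have e: "(-1::complex) ^ l = (-1) ^ (l - i) * (-1) ^ i" using i by (simp add: power_add[symmetric])
        have "(-1) ^ i * (-1) ^ i = (1::complex)" by (simp add: power_mult_distrib[symmetric])
        then show ?thesis by (simp only: e mult.assoc mult_1_right)
      qed
      ultimately have "sb (of_int L) (l - i) = (-1) powi L * sb (of_int L) i"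
        unfolding sb_def L by (simp add: binomial_gbinomial[symmetric] mult.assoc[symmetric])
      moreover have "int (l - i) + s - 1 - L = s - 1 - int i" "N - int (l - i) = N - L + int i"
        using i by (auto simp: L of_nat_diff)
      ultimately show "Cn (sb (of_int L) (l - i)) * (Sc 1 (int (l - i) + s - 1 - L) * V $$ (N - int (l - i))) =
         Cn ((-1) powi L * sb (of_int L) i) * (Sc 1 (s - 1 - int i) * V $$ (N - L + int i))" by (simp only:)
    qed auto
    also have "\<dots> = (\<Sum>i\<le>I. Cn (sb (of_int L) i) * (Sc 1 (int i + s - 1 - L) * V $$ (N - int i)))"
      using I by (intro sum.mono_neutral_left) (auto simp: z)
    finally show ?thesis by simp
  qed
  then show ?thesis using False by (intro exI[of _ l]) auto
next
  case True
  define g where "g = nat (- 1 - L)"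
  have L: "L = - 1 - int g" using True by (simp add: g_def)
  define T where "T = hsd g (zp (- s) * Em 1)"
  have T: "T $$ r = Cn (of_int (r + int g) gchoose g) * Sc 1 (r + int g + s)" for r
    by (simp add: T_def hsd_nth)
  define I0 where "I0 = nat \<bar>s\<bar> + nat \<bar>N - fls_subdegree V\<bar>"
  have "(\<Sum>i\<le>I. Cn (sb (of_int L) i) * (Sc 1 (int i + s - 1 - L) * V $$ (N - int i)))
     - (\<Sum>i\<le>I. Cn ((-1) powi L * sb (of_int L) i) * (Sc 1 (s - 1 - int i) * V $$ (N - L + int i))) = (T * V) $$ N"
    if I: "I \<ge> I0" for I
  proof -
    let ?t = "\<lambda>r. T $$ r * V $$ (N - r)"
    have "(T * V) $$ N = (\<Sum>r\<in>{- 1 - int g - int I..N - (N - int I)}. ?t r)"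
    proof (rule fls_times_nth_lb)
      fix n assume "n < - 1 - int g - int I"
      then show "T $$ n = 0" unfolding T using I by (simp add: I0_def)
    next
      fix n assume "n < N - int I"
      then show "V $$ n = 0" using I by (intro fls_eq0_below_subdegree) (simp add: I0_def)
    qed
    \<comment> \<open>On the middle range the binomial coefficient in T is zero; the two outer
      ranges are the two expansions.\<close>
    also have "{- 1 - int g - int I..N - (N - int I)} = {- 1 - int g - int I..- 1 - int g} \<union> ({- int g..-1} \<union> {0..int I})" by auto
    also have "sum ?t \<dots> = sum ?t {- 1 - int g - int I..- 1 - int g} + (sum ?t {- int g..-1} + sum ?t {0..int I})"
      by (subst sum.union_disjoint; (subst sum.union_disjoint)?) auto
    also have "sum ?t {- int g..-1} = 0"
    proof (intro sum.neutral ballI)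
      fix r assume r: "r \<in> {- int g..-1}"
      then have e: "r + int g = int (nat (r + int g))" by simp
      have "(of_int (r + int g) gchoose g) = (of_nat (nat (r + int g) choose g) :: complex)"
        by (subst e) (simp add: binomial_gbinomial)
      also have "nat (r + int g) choose g = 0" using r by (intro binomial_eq_0) auto
      finally show "?t r = 0" by (simp add: T)
    qed
    also have "sum ?t {0..int I} = (\<Sum>i\<le>I. Cn (sb (of_int L) i) * (Sc 1 (int i + s - 1 - L) * V $$ (N - int i)))"
    proof (rule sum.reindex_bij_witness[of _ int nat])
      fix r assume r: "r \<in> {0..int I}"
      define i where "i = nat r"
      have ri: "r = int i" using r by (simp add: i_def)
      have Lc: "of_int L = (- of_nat (g + 1) :: complex)" by (simp add: L)
      have "sb (of_int L) i = of_nat ((i + g) choose g)"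
        unfolding Lc using sb_neg_nat[of "g + 1" i] by simp
      also have "\<dots> = (of_int (r + int g) gchoose g)" by (simp add: ri binomial_gbinomial)
      finally have "sb (of_int L) i = (of_int (r + int g) gchoose g)" .
      moreover have "int i + s - 1 - L = r + int g + s" "N - int i = N - r" by (simp_all add: L ri)
      ultimately show "Cn (sb (of_int L) (nat r)) * (Sc 1 (int (nat r) + s - 1 - L) * V $$ (N - int (nat r))) = ?t r"
        unfolding i_def[symmetric] T by (simp only: mult.assoc)
    qed auto
    also have "sum ?t {- 1 - int g - int I..- 1 - int g} = - (\<Sum>i\<le>I. Cn ((-1) powi L * sb (of_int L) i) * (Sc 1 (s - 1 - int i) * V $$ (N - L + int i)))"
      unfolding sum_negf[symmetric]
    proof (rule sum.reindex_bij_witness[of _ "\<lambda>i. - 1 - int g - int i" "\<lambda>r. nat (- 1 - int g - r)"])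
      fix r assume r: "r \<in> {- 1 - int g - int I..- 1 - int g}"
      define i where "i = nat (- 1 - int g - r)"
      have ri: "r = - 1 - int g - int i" using r by (simp add: i_def)
      have Lc: "of_int L = (- of_nat (g + 1) :: complex)" by (simp add: L)
      have a: "sb (of_int L) i = of_nat ((i + g) choose g)"
        unfolding Lc using sb_neg_nat[of "g + 1" i] by simp
      have "of_int (r + int g) = (- (of_nat i + 1) :: complex)" by (simp add: ri)
      then have "(of_int (r + int g) gchoose g) = ((- (of_nat i + 1)) gchoose g :: complex)" by (simp only:)
      also have "\<dots> = (-1) ^ g * ((of_nat i + 1 + of_nat g - 1) gchoose g)" by (rule gbinomial_minus)
      also have "of_nat i + 1 + of_nat g - 1 = (of_nat (i + g) :: complex)" by simp
      also have "(of_nat (i + g) gchoose g) = (of_nat ((i + g) choose g) :: complex)" by (simp add: binomial_gbinomial)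
      finally have b: "(of_int (r + int g) gchoose g) = (-1) ^ g * (sb (of_int L) i :: complex)" unfolding a .
      have c: "(-1) powi L = - ((-1) ^ g :: complex)"
      proof -
        have "(-1) powi L = ((-1) powi (- int (Suc g)) :: complex)" by (simp add: L)
        also have "\<dots> = - ((-1) ^ g)" unfolding power_int_minus power_int_of_nat by (simp add: power_inverse[symmetric])
        finally show ?thesis .
      qed
      have "s - 1 - int i = r + int g + s" "N - L + int i = N - r" by (auto simp: L ri)
      then show "- (Cn ((-1) powi L * sb (of_int L) (nat (- 1 - int g - r))) * (Sc 1 (s - 1 - int (nat (- 1 - int g - r))) * V $$ (N - L + int (nat (- 1 - int g - r))))) = ?t r"
        unfolding i_def[symmetric] c T b by (simp only: mult_minus_left Cn_uminus minus_minus mult.assoc)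
    qed auto
    finally show ?thesis by simp
  qed
  then show ?thesis using True unfolding g_def[symmetric] T_def by auto
qed

section \<open>The screening operator as a derivation\<close>

text \<open>The commutator formula [Q, Y(v, z)] = Y(Qv, z) for v of charge 2pk acting on charge a.
  An exponent -1 minus the charge selects the residue of the screening current.
  \<open>shift_Yp\<close> expands the left side, \<open>Yp_Sc_left\<close> and
  \<open>Yp_Sc_right\<close> the two terms on the right, and \<open>residue_coeff\<close> matches
  them for each pair (f, h), where f counts the contraction with u and h the one with w.\<close>

theorem eps_derivation:
  assumes u: "vin {1..} u"
  shows "eps p (- 1 - (a + 2 * int p * k)) (Yp p k a u w $$ N)
     = Yp p (k + 1) a (eps p (- 1 - 2 * int p * k) u) w $$ N
       + Yp p k (a + 2 * int p) u (eps p (- 1 - a) w) $$ N"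
proof -
  define b where "b = 2 * int p * k"
  define W where "W = vb w"
  define V where "V = (\<lambda>f h. Yp p k a (Gm p 1 f u) (Gm p 1 h w))"
  define L where "L = (\<lambda>f. b - int f)"
  obtain F1 where F1: "\<And>F w. F \<ge> F1 \<Longrightarrow> GG p (Yp p k a u w)
     = (\<Sum>f\<le>F. fps_X ^ f * (PW (of_int (2 * int p * k) - of_nat f) * WY p k a (Gm p 1 f u) w))"
    using shift_Yp[OF u, of p k a] by blast
  obtain F2 where F2: "\<And>F w. F \<ge> F2 \<Longrightarrow> LS p k a u w
     = fE * (\<Sum>f\<le>F. QW (2 * int p * k - int f) * fps_const (Yp p k a (Gm p 1 f u) w))"
    using Yp_Sc_right[OF u, of p k a] by blast
  define F where "F = max (max F1 F2) (vb u)"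
  have F: "F \<ge> F1" "F \<ge> F2" "F \<ge> vb u" by (auto simp: F_def)
  define PP where "PP = (\<lambda>f h I. (\<Sum>i\<le>I. Cn (sb (of_int (L f)) i) * (Sc 1 (int i + (int h - a) - 1 - L f) * V f h $$ (N - int i)))
     - (\<Sum>i\<le>I. Cn ((-1) powi (L f) * sb (of_int (L f)) i) * (Sc 1 ((int h - a) - 1 - int i) * V f h $$ (N - L f + int i)))
   = (if L f < 0 then (hsd (nat (- 1 - L f)) (zp (- (int h - a)) * Em 1) * V f h) $$ N else 0))"
  have ex: "\<exists>I0. \<forall>I\<ge>I0. PP f h I" for f h unfolding PP_def by (rule residue_coeff)
  define I0 where "I0 = (\<lambda>f h. SOME I0. \<forall>I\<ge>I0. PP f h I)"
  have I0: "PP f h I" if "I \<ge> I0 f h" for f h I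
    using someI_ex[OF ex[of f h]] that unfolding I0_def by blast
  \<comment> \<open>A single truncation for all pairs (f, h): it exceeds each threshold of
    \<open>residue_coeff\<close>, reaches below the subdegree of each V, and through W + |a| bounds
    the indices h - a - 1 of \<open>Sc\<close> occurring in \<open>R2\<close>.\<close>
  define I where "I = (\<Sum>f\<le>F. \<Sum>h\<le>W. I0 f h + nat \<bar>N - fls_subdegree (V f h)\<bar>) + W + nat \<bar>a\<bar> + 1"
  have Ile: "I0 f h + nat \<bar>N - fls_subdegree (V f h)\<bar> \<le> I" if "f \<le> F" "h \<le> W" for f h
  proof -
    have "I0 f h + nat \<bar>N - fls_subdegree (V f h)\<bar> \<le> (\<Sum>h\<le>W. I0 f h + nat \<bar>N - fls_subdegree (V f h)\<bar>)"
      using that by (intro member_le_sum) auto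
    also have "\<dots> \<le> (\<Sum>f\<le>F. \<Sum>h\<le>W. I0 f h + nat \<bar>N - fls_subdegree (V f h)\<bar>)"
      using that by (intro member_le_sum[of f "{..F}" "\<lambda>f. \<Sum>h\<le>W. I0 f h + nat \<bar>N - fls_subdegree (V f h)\<bar>"]) auto
    finally show ?thesis by (simp add: I_def)
  qed
  have Vz: "V f h $$ (N - int i) = 0" if "f \<le> F" "i > I" for f h i
  proof (cases "h \<le> W")
    case True
    then show ?thesis using Ile[OF that(1) True] that(2) by (intro fls_eq0_below_subdegree) linarith
  next
    case False then show ?thesis by (simp add: V_def W_def Gm_zero)
  qed
  have Vz2: "V f h = 0" if "h > W" for f h using that by (simp add: V_def W_def Gm_zero)
  define q where "q = Yp p k a u w $$ N"
  define tt where "tt = (\<lambda>f h i. Cn (sb (of_int (L f)) i) * V f h $$ (N - int i))"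
  have G: "Gm p 1 h q = (\<Sum>f\<le>F. \<Sum>h'\<le>W. \<Sum>i\<le>I. if f + h' + i = h then tt f h' i else 0)" for h
  proof -
    have "Gm p 1 h q = (GG p (Yp p k a u w) $ h) $$ N" by (simp add: GG_nth q_def)
    also have "\<dots> = (\<Sum>f\<le>F. (if h < f then 0 else \<Sum>i\<in>{0..h - f}. tt f (h - f - i) i))"
    proof -
      have "of_int (2 * int p * k) - of_nat f = (of_int (L f) :: complex)" for f by (simp add: L_def b_def)
      then have "(GG p (Yp p k a u w) $ h) $$ N = (\<Sum>f\<le>F. (fps_X ^ f * (PW (of_int (L f)) * WY p k a (Gm p 1 f u) w)) $ h $$ N)"
        unfolding F1[OF F(1)] by (simp add: fps_sum_nth fls_nth_sum)
      also have "\<dots> = (\<Sum>f\<le>F. (if h < f then 0 else \<Sum>i\<in>{0..h - f}. tt f (h - f - i) i))"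
        unfolding fps_X_power_mult_nth
        by (intro sum.cong refl) (simp add: fps_mult_nth fls_nth_sum PW_def WY_def tt_def V_def mult.assoc)
      finally show ?thesis .
    qed
    also have "\<dots> = (\<Sum>f\<le>F. \<Sum>h'\<le>W. \<Sum>i\<le>I. if f + h' + i = h then tt f h' i else 0)"
    proof (rule sum.cong[OF refl])
      fix f assume f: "f \<in> {..F}"
      have "(\<Sum>h'\<le>W. \<Sum>i\<le>I. if f + h' + i = h then tt f h' i else 0) = (\<Sum>i\<le>I. \<Sum>h'\<le>W. if f + h' + i = h then tt f h' i else 0)"
        by (rule sum.swap)
      also have "\<dots> = (\<Sum>i\<le>I. if f + i \<le> h then tt f (h - f - i) i else 0)"
      proof (rule sum.cong[OF refl])
        fix i
        have "(\<Sum>h'\<le>W. if f + h' + i = h then tt f h' i else 0) = (\<Sum>h'\<le>W. if h' = h - f - i then (if f + i \<le> h then tt f (h - f - i) i else 0) else 0)"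
          by (intro sum.cong) auto
        also have "\<dots> = (if f + i \<le> h then tt f (h - f - i) i else 0)"
          using Vz2[of "h - f - i" f] by (auto simp: tt_def)
        finally show "(\<Sum>h'\<le>W. if f + h' + i = h then tt f h' i else 0) = (if f + i \<le> h then tt f (h - f - i) i else 0)" .
      qed
      also have "\<dots> = (\<Sum>i\<le>max I h. if f + i \<le> h then tt f (h - f - i) i else 0)"
        using Vz[of f] f by (intro sum.mono_neutral_left) (auto simp: tt_def)
      also have "\<dots> = (if h < f then 0 else \<Sum>i\<in>{0..h - f}. tt f (h - f - i) i)"
      proof (cases "h < f")
        case False
        have "(\<Sum>i\<le>max I h. if f + i \<le> h then tt f (h - f - i) i else 0) = (\<Sum>i\<in>{0..h - f}. tt f (h - f - i) i)"
          using False by (intro sum.mono_neutral_cong_right) auto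
        then show ?thesis using False by simp
      qed (auto intro!: sum.neutral)
      finally show "(if h < f then 0 else \<Sum>i\<in>{0..h - f}. tt f (h - f - i) i) = (\<Sum>h'\<le>W. \<Sum>i\<le>I. if f + h' + i = h then tt f h' i else 0)" ..
    qed
    finally show ?thesis .
  qed
  define H where "H = max (vb q) (F + W + I)"
  have "eps p (- 1 - (a + b)) q = (\<Sum>h\<le>H. Sc 1 (- 1 - (a + b) + int h) * Gm p 1 h q)"
    by (rule eps_sum) (simp add: H_def)
  also have "\<dots> = (\<Sum>f\<le>F. \<Sum>h'\<le>W. \<Sum>i\<le>I. \<Sum>h\<le>H. if f + h' + i = h then Sc 1 (- 1 - (a + b) + int h) * tt f h' i else 0)"
  proof -
    have "(\<Sum>h\<le>H. Sc 1 (- 1 - (a + b) + int h) * Gm p 1 h q)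
       = (\<Sum>h\<le>H. \<Sum>f\<le>F. \<Sum>h'\<le>W. \<Sum>i\<le>I. if f + h' + i = h then Sc 1 (- 1 - (a + b) + int h) * tt f h' i else 0)"
      by (simp add: G sum_distrib_left if_distrib[of "\<lambda>x. _ * x"] cong: if_cong)
    also have "\<dots> = (\<Sum>f\<le>F. \<Sum>h\<le>H. \<Sum>h'\<le>W. \<Sum>i\<le>I. if f + h' + i = h then Sc 1 (- 1 - (a + b) + int h) * tt f h' i else 0)"
      by (rule sum.swap)
    also have "\<dots> = (\<Sum>f\<le>F. \<Sum>h'\<le>W. \<Sum>h\<le>H. \<Sum>i\<le>I. if f + h' + i = h then Sc 1 (- 1 - (a + b) + int h) * tt f h' i else 0)"
      by (intro sum.cong refl sum.swap)
    also have "\<dots> = (\<Sum>f\<le>F. \<Sum>h'\<le>W. \<Sum>i\<le>I. \<Sum>h\<le>H. if f + h' + i = h then Sc 1 (- 1 - (a + b) + int h) * tt f h' i else 0)"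
      by (rule sum.cong[OF refl], rule sum.cong[OF refl], rule sum.swap)
    finally show ?thesis .
  qed
  also have "\<dots> = (\<Sum>f\<le>F. \<Sum>h'\<le>W. \<Sum>i\<le>I. Cn (sb (of_int (L f)) i) * (Sc 1 (int i + (int h' - a) - 1 - L f) * V f h' $$ (N - int i)))"
  proof (rule sum.cong[OF refl], rule sum.cong[OF refl], rule sum.cong[OF refl])
    fix f h' i assume *: "f \<in> {..F}" "h' \<in> {..W}" "i \<in> {..I}"
    then have "f + h' + i \<le> H" by (auto simp: H_def)
    then have "(\<Sum>h\<le>H. if f + h' + i = h then Sc 1 (- 1 - (a + b) + int h) * tt f h' i else 0) = Sc 1 (- 1 - (a + b) + int (f + h' + i)) * tt f h' i"
      by simp
    also have "- 1 - (a + b) + int (f + h' + i) = int i + (int h' - a) - 1 - L f" by (simp add: L_def)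
    finally show "(\<Sum>h\<le>H. if f + h' + i = h then Sc 1 (- 1 - (a + b) + int h) * tt f h' i else 0)
       = Cn (sb (of_int (L f)) i) * (Sc 1 (int i + (int h' - a) - 1 - L f) * V f h' $$ (N - int i))"
      by (simp only: tt_def mult.left_commute)
  qed
  finally have LHS: "eps p (- 1 - (a + b)) q = (\<Sum>f\<le>F. \<Sum>h\<le>W. \<Sum>i\<le>I. Cn (sb (of_int (L f)) i) * (Sc 1 (int i + (int h - a) - 1 - L f) * V f h $$ (N - int i)))" .
  have R2: "Yp p k (a + 2 * int p) u (eps p (- 1 - a) w) $$ N
     = (\<Sum>f\<le>F. \<Sum>h\<le>W. \<Sum>i\<le>I. Cn ((-1) powi (L f) * sb (of_int (L f)) i) * (Sc 1 ((int h - a) - 1 - int i) * V f h $$ (N - L f + int i)))"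
  proof -
    have "Yp p k (a + 2 * int p) u (eps p (- 1 - a) w) $$ N = (\<Sum>h\<le>W. Yp p k (a + 2 * int p) u (Sc 1 (- 1 - a + int h) * Gm p 1 h w) $$ N)"
      unfolding eps_sum[OF order_refl] W_def by (simp only: Yp_sum fls_nth_sum)
    also have "\<dots> = (\<Sum>h\<le>W. \<Sum>f\<le>F. \<Sum>i\<le>I. Cn ((-1) powi (L f) * sb (of_int (L f)) i) * (Sc 1 ((int h - a) - 1 - int i) * V f h $$ (N - L f + int i)))"
    proof (rule sum.cong[OF refl])
      fix h assume h: "h \<in> {..W}"
      show "Yp p k (a + 2 * int p) u (Sc 1 (- 1 - a + int h) * Gm p 1 h w) $$ N = (\<Sum>f\<le>F. \<Sum>i\<le>I. Cn ((-1) powi (L f) * sb (of_int (L f)) i) * (Sc 1 ((int h - a) - 1 - int i) * V f h $$ (N - L f + int i)))"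
      proof (cases "- 1 - a + int h < 0")
        case True then show ?thesis by simp
      next
        case False
        define g where "g = nat (- 1 - a + int h)"
        have g: "- 1 - a + int h = int g" using False by (simp add: g_def)
        have gI: "g \<le> I" using h by (simp add: g_def I_def)
        have "Yp p k (a + 2 * int p) u (Sc 1 (- 1 - a + int h) * Gm p 1 h w) = LS p k a u (Gm p 1 h w) $ g"
          unfolding g LS_def by simp
        also have "\<dots> = (\<Sum>f\<le>F. (fE * (QW (L f) * fps_const (V f h))) $ g)"
          unfolding F2[OF F(2)] by (simp add: sum_distrib_left fps_sum_nth L_def b_def V_def)
        also have "\<dots> = (\<Sum>f\<le>F. \<Sum>i\<in>{0..g}. fls_const (Sc 1 (int (g - i))) * (kc ((-1) powi (L f) * sb (of_int (L f)) i) * (zp (L f - int i) * V f h)))"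
        proof (intro sum.cong refl)
          fix f
          have "(fE * (QW (L f) * fps_const (V f h))) $ g = (\<Sum>i\<in>{0..g}. (QW (L f) * fps_const (V f h)) $ i * fE $ (g - i))"
            by (subst mult.commute) (rule fps_mult_nth)
          also have "\<dots> = (\<Sum>i\<in>{0..g}. fls_const (Sc 1 (int (g - i))) * (kc ((-1) powi (L f) * sb (of_int (L f)) i) * (zp (L f - int i) * V f h)))"
            unfolding QW_def fE_def fps_mult_right_const_nth fps_nth_Abs_fps by (simp only: mult_ac)
          finally show "(fE * (QW (L f) * fps_const (V f h))) $ g = (\<Sum>i\<in>{0..g}. fls_const (Sc 1 (int (g - i))) * (kc ((-1) powi (L f) * sb (of_int (L f)) i) * (zp (L f - int i) * V f h)))" .
        qed
        finally have "Yp p k (a + 2 * int p) u (Sc 1 (- 1 - a + int h) * Gm p 1 h w) $$ N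
          = (\<Sum>f\<le>F. \<Sum>i\<in>{0..g}. Sc 1 (int (g - i)) * (Cn ((-1) powi (L f) * sb (of_int (L f)) i) * V f h $$ (N - (L f - int i))))"
          by (simp only: fls_nth_sum fls_const_mult_nth kc_mult_nth zp_mult_nth)
        also have "\<dots> = (\<Sum>f\<le>F. \<Sum>i\<le>I. Cn ((-1) powi (L f) * sb (of_int (L f)) i) * (Sc 1 ((int h - a) - 1 - int i) * V f h $$ (N - L f + int i)))"
        proof (rule sum.cong[OF refl])
          fix f
          show "(\<Sum>i\<in>{0..g}. Sc 1 (int (g - i)) * (Cn ((-1) powi (L f) * sb (of_int (L f)) i) * V f h $$ (N - (L f - int i))))
            = (\<Sum>i\<le>I. Cn ((-1) powi (L f) * sb (of_int (L f)) i) * (Sc 1 ((int h - a) - 1 - int i) * V f h $$ (N - L f + int i)))"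
          proof (rule sum.mono_neutral_cong_left)
            fix i assume "i \<in> {0..g}"
            then have "int (g - i) = (int h - a) - 1 - int i" using g by (simp add: of_nat_diff)
            moreover have "N - (L f - int i) = N - L f + int i" by simp
            ultimately show "Sc 1 (int (g - i)) * (Cn ((-1) powi (L f) * sb (of_int (L f)) i) * V f h $$ (N - (L f - int i)))
              = Cn ((-1) powi (L f) * sb (of_int (L f)) i) * (Sc 1 ((int h - a) - 1 - int i) * V f h $$ (N - L f + int i))"
              by (simp only: mult.left_commute)
          qed (use gI g in auto)
        qed
        finally show ?thesis .
      qed
    qed
    also have "\<dots> = (\<Sum>f\<le>F. \<Sum>h\<le>W. \<Sum>i\<le>I. Cn ((-1) powi (L f) * sb (of_int (L f)) i) * (Sc 1 ((int h - a) - 1 - int i) * V f h $$ (N - L f + int i)))"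
      by (rule sum.swap)
    finally show ?thesis .
  qed
  have R1: "Yp p (k + 1) a (eps p (- 1 - b) u) w $$ N
     = (\<Sum>f\<le>F. \<Sum>h\<le>W. if L f < 0 then (hsd (nat (- 1 - L f)) (zp (- (int h - a)) * Em 1) * V f h) $$ N else 0)"
  proof -
    have "Yp p (k + 1) a (eps p (- 1 - b) u) w $$ N = (\<Sum>f\<le>F. Yp p (k + 1) a (Sc 1 (- 1 - b + int f) * Gm p 1 f u) w $$ N)"
      unfolding eps_sum[OF F(3)] by (simp only: Yp_sum_left fls_nth_sum)
    also have "\<dots> = (\<Sum>f\<le>F. \<Sum>h\<le>W. if L f < 0 then (hsd (nat (- 1 - L f)) (zp (- (int h - a)) * Em 1) * V f h) $$ N else 0)"
    proof (rule sum.cong[OF refl])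
      fix f
      show "Yp p (k + 1) a (Sc 1 (- 1 - b + int f) * Gm p 1 f u) w $$ N = (\<Sum>h\<le>W. if L f < 0 then (hsd (nat (- 1 - L f)) (zp (- (int h - a)) * Em 1) * V f h) $$ N else 0)"
      proof (cases "L f < 0")
        case False then show ?thesis by (simp add: L_def)
      next
        case True
        have g: "- 1 - b + int f = int (nat (- 1 - L f))" using True by (simp add: L_def)
        show ?thesis unfolding g Yp_Sc_left[OF order_refl, of p k a _ _ w] using True
          by (simp add: W_def V_def fls_nth_sum)
      qed
    qed
    finally show ?thesis .
  qed
  have "eps p (- 1 - (a + b)) q - Yp p k (a + 2 * int p) u (eps p (- 1 - a) w) $$ N = Yp p (k + 1) a (eps p (- 1 - b) u) w $$ N"
    unfolding LHS R2 R1 sum_subtractf[symmetric]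
  proof (rule sum.cong[OF refl])
    fix f assume f: "f \<in> {..F}"
    show "(\<Sum>h\<le>W. \<Sum>i\<le>I. Cn (sb (of_int (L f)) i) * (Sc 1 (int i + (int h - a) - 1 - L f) * V f h $$ (N - int i))
        - Cn ((-1) powi (L f) * sb (of_int (L f)) i) * (Sc 1 ((int h - a) - 1 - int i) * V f h $$ (N - L f + int i)))
      = (\<Sum>h\<le>W. if L f < 0 then (hsd (nat (- 1 - L f)) (zp (- (int h - a)) * Em 1) * V f h) $$ N else 0)"
    proof (rule sum.cong[OF refl])
      fix h assume h: "h \<in> {..W}"
      have "I \<ge> I0 f h" using Ile[of f h] f h by simp
      from I0[OF this, unfolded PP_def] show "(\<Sum>i\<le>I. Cn (sb (of_int (L f)) i) * (Sc 1 (int i + (int h - a) - 1 - L f) * V f h $$ (N - int i))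
        - Cn ((-1) powi (L f) * sb (of_int (L f)) i) * (Sc 1 ((int h - a) - 1 - int i) * V f h $$ (N - L f + int i)))
        = (if L f < 0 then (hsd (nat (- 1 - L f)) (zp (- (int h - a)) * Em 1) * V f h) $$ N else 0)"
        by (simp only: sum_subtractf)
    qed
  qed
  then show ?thesis unfolding q_def b_def by (simp add: algebra_simps)
qed

section \<open>Modes of the screening current\<close>

text \<open>The coefficients of the normally ordered product of two screening currents: both E^+ act
  first, both E^- last, which makes it symmetric.\<close>

definition nn :: "nat \<Rightarrow> int \<Rightarrow> int \<Rightarrow> pol \<Rightarrow> pol" where
  "nn p s t q = (\<Sum>f\<le>vb q. \<Sum>h\<le>vb q. Sc 1 (s + int f) * (Sc 1 (t + int h) * Gm p 1 f (Gm p 1 h q)))"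

lemma nn_commute: "nn p s t q = nn p t s q"
  unfolding nn_def by (subst sum.swap, intro sum.cong refl, subst Gm_commute) (simp only: mult.left_commute)

lemma vb_eps: "vb (eps p t q) \<le> nat t + vb q"
proof -
  have "vb (Sc 1 (t + int f) * Gm p 1 f q) \<le> nat t + vb q" if "f \<le> vb q" for f
  proof -
    have "wd {0} (t + int f) (Sc 1 (t + int f))" by (rule wd_Sc)
    moreover have "wd {..0} (int (vb q) - int f) (Gm p 1 f q)" by (rule wd_Gm[OF wd_vb])
    ultimately have "wd {..0} (int (vb q) - int f + (t + int f)) (Sc 1 (t + int f) * Gm p 1 f q)" by (rule wd_mult)
    then show ?thesis unfolding wd_def vb_le_iff by auto
  qed
  then show ?thesis unfolding eps_sum[OF order_refl] by (intro vb_sum) auto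
qed

lemma sb_2p_zero: "i > 2 * p \<Longrightarrow> sb (tw p) i = 0"
  unfolding sb_def tw_def by (simp only: binomial_gbinomial[symmetric] binomial_eq_0 of_nat_0 mult_zero_right)

text \<open>The exchange of the inner E^- with the outer E^+ gives (1 - z/x)^(2p), a polynomial
  because the exponent is a natural number; hence the finite sum.\<close>

lemma eps_eps: "eps p s (eps p t q) = (\<Sum>i\<le>2 * p. Cn (sb (tw p) i) * nn p (s + int i) (t - int i) q)"
proof -
  define F where "F = vb q"
  define F' where "F' = nat t + F + 2 * p"
  have v: "vb (eps p t q) \<le> F'" using vb_eps[of p t q] by (simp add: F'_def F_def)
  have G: "Gm p 1 f (eps p t q) = (\<Sum>h\<le>F. \<Sum>i\<le>f. Cn (sb (tw p) i) * (Sc 1 (t - int i + int h) * Gm p 1 (f - i) (Gm p 1 h q)))" for f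
  proof -
    have "Gm p 1 i (Sc 1 (t + int h)) = Cn (sb (tw p) i) * Sc 1 (t - int i + int h)" for i h
    proof -
      have "t + int h - int i = t - int i + int h" by simp
      moreover have "of_int (2 * int p * 1 * 1) = tw p" by (simp add: tw_def)
      ultimately show ?thesis using Gm_Sc[of p 1 i 1 "t + int h"] by (simp only:)
    qed
    then show ?thesis unfolding eps_sum[OF order_refl] F_def by (simp add: Gm_sum Gm_mult mult.assoc)
  qed
  have "eps p s (eps p t q) = (\<Sum>f\<le>F'. \<Sum>h\<le>F. \<Sum>i\<le>f. Sc 1 (s + int f) * (Cn (sb (tw p) i) * (Sc 1 (t - int i + int h) * Gm p 1 (f - i) (Gm p 1 h q))))"
    unfolding eps_sum[OF v] G by (simp only: sum_distrib_left)
  also have "\<dots> = (\<Sum>h\<le>F. \<Sum>f\<le>F'. \<Sum>i\<le>f. Sc 1 (s + int f) * (Cn (sb (tw p) i) * (Sc 1 (t - int i + int h) * Gm p 1 (f - i) (Gm p 1 h q))))"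
    by (rule sum.swap)
  also have "\<dots> = (\<Sum>h\<le>F. \<Sum>i\<le>2 * p. \<Sum>f\<le>F. Sc 1 (s + int (f + i)) * (Cn (sb (tw p) i) * (Sc 1 (t - int i + int h) * Gm p 1 f (Gm p 1 h q))))"
  proof (rule sum.cong[OF refl])
    fix h
    let ?g = "\<lambda>f i. Sc 1 (s + int f) * (Cn (sb (tw p) i) * (Sc 1 (t - int i + int h) * Gm p 1 (f - i) (Gm p 1 h q)))"
    have z: "?g f i = 0" if "f - i > F" for f i
      using that vb_Gm[of p 1 h q] by (simp add: Gm_zero F_def)
    have z2: "?g f i = 0" if "i > 2 * p" for f i using that by (simp add: sb_2p_zero)
    have "(\<Sum>f\<le>F'. \<Sum>i\<le>f. ?g f i) = (\<Sum>f\<le>F'. \<Sum>i\<le>2 * p. if i \<le> f then ?g f i else 0)"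
    proof (rule sum.cong[OF refl])
      fix f
      have "(\<Sum>i\<le>f. ?g f i) = (\<Sum>i\<le>max f (2 * p). if i \<le> f \<and> i \<le> 2 * p then ?g f i else 0)"
        using z2 by (intro sum.mono_neutral_cong_left) auto
      also have "\<dots> = (\<Sum>i\<le>2 * p. if i \<le> f then ?g f i else 0)"
        by (intro sum.mono_neutral_cong_right) auto
      finally show "(\<Sum>i\<le>f. ?g f i) = (\<Sum>i\<le>2 * p. if i \<le> f then ?g f i else 0)" .
    qed
    also have "\<dots> = (\<Sum>i\<le>2 * p. \<Sum>f\<le>F'. if i \<le> f then ?g f i else 0)" by (rule sum.swap)
    also have "\<dots> = (\<Sum>i\<le>2 * p. \<Sum>f\<le>F. ?g (f + i) i)"
    proof (rule sum.cong[OF refl])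
      fix i assume i: "i \<in> {..2 * p}"
      have "(\<Sum>f\<le>F'. if i \<le> f then ?g f i else 0) = (\<Sum>f\<in>{i..F + i}. ?g f i)"
      proof (rule sum.mono_neutral_cong_right)
        show "{i..F + i} \<subseteq> {..F'}" using i by (auto simp: F'_def)
        show "\<forall>f\<in>{..F'} - {i..F + i}. (if i \<le> f then ?g f i else 0) = 0"
        proof
          fix f assume "f \<in> {..F'} - {i..F + i}"
          then show "(if i \<le> f then ?g f i else 0) = 0" using z[of f i] by auto
        qed
      qed auto
      also have "\<dots> = (\<Sum>f\<le>F. ?g (f + i) i)"
        by (rule sum.reindex_bij_witness[of _ "\<lambda>f. f + i" "\<lambda>f. f - i"]) auto
      finally show "(\<Sum>f\<le>F'. if i \<le> f then ?g f i else 0) = (\<Sum>f\<le>F. ?g (f + i) i)" .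
    qed
    finally show "(\<Sum>f\<le>F'. \<Sum>i\<le>f. ?g f i) = (\<Sum>i\<le>2 * p. \<Sum>f\<le>F. Sc 1 (s + int (f + i)) * (Cn (sb (tw p) i) * (Sc 1 (t - int i + int h) * Gm p 1 f (Gm p 1 h q))))"
      by simp
  qed
  also have "\<dots> = (\<Sum>i\<le>2 * p. \<Sum>h\<le>F. \<Sum>f\<le>F. Sc 1 (s + int (f + i)) * (Cn (sb (tw p) i) * (Sc 1 (t - int i + int h) * Gm p 1 f (Gm p 1 h q))))"
    by (rule sum.swap)
  also have "\<dots> = (\<Sum>i\<le>2 * p. Cn (sb (tw p) i) * nn p (s + int i) (t - int i) q)"
  proof (rule sum.cong[OF refl])
    fix i
    have e: "s + int (f + i) = s + int i + int f" for f by simp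
    have "(\<Sum>h\<le>F. \<Sum>f\<le>F. Sc 1 (s + int (f + i)) * (Cn (sb (tw p) i) * (Sc 1 (t - int i + int h) * Gm p 1 f (Gm p 1 h q))))
      = (\<Sum>f\<le>F. \<Sum>h\<le>F. Sc 1 (s + int (f + i)) * (Cn (sb (tw p) i) * (Sc 1 (t - int i + int h) * Gm p 1 f (Gm p 1 h q))))"
      by (rule sum.swap)
    then show "(\<Sum>h\<le>F. \<Sum>f\<le>F. Sc 1 (s + int (f + i)) * (Cn (sb (tw p) i) * (Sc 1 (t - int i + int h) * Gm p 1 f (Gm p 1 h q))))
      = Cn (sb (tw p) i) * nn p (s + int i) (t - int i) q"
      unfolding nn_def F_def e sum_distrib_left by (simp only: mult.left_commute[of "Cn _"])
  qed
  finally show ?thesis .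
qed

lemma sb_2p_sym: assumes "i \<le> 2 * p" shows "sb (tw p) (2 * p - i) = sb (tw p) i"
proof -
  have "sb (tw p) j = (-1) ^ j * of_nat ((2 * p) choose j)" for j
    unfolding sb_def tw_def by (simp only: binomial_gbinomial)
  moreover have "(2 * p) choose (2 * p - i) = (2 * p) choose i"
    using assms by (metis binomial_symmetric)
  moreover have "(-1::complex) ^ (2 * p - i) = (-1) ^ i"
    using assms by (cases "even i") auto
  ultimately show ?thesis by simp
qed

text \<open>Locality: the exponent 2p is even, so (x - z)^(2p) is symmetric in x and z. The shift by
  2p in the outer index compensates the charge that the inner current has added.\<close>

lemma eps_commute: "eps p (s - 2 * int p) (eps p t q) = eps p (t - 2 * int p) (eps p s q)"
proof -
  have "eps p (s - 2 * int p) (eps p t q) = (\<Sum>i\<le>2 * p. Cn (sb (tw p) i) * nn p (s - 2 * int p + int i) (t - int i) q)"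
    by (rule eps_eps)
  also have "\<dots> = (\<Sum>i\<le>2 * p. Cn (sb (tw p) i) * nn p (t - 2 * int p + int i) (s - int i) q)"
  proof (rule sum.reindex_bij_witness[of _ "\<lambda>i. 2 * p - i" "\<lambda>i. 2 * p - i"])
    fix i assume i: "i \<in> {..2 * p}"
    then have e: "t - 2 * int p + int (2 * p - i) = t - int i" "s - int (2 * p - i) = s - 2 * int p + int i" by (auto simp: of_nat_diff)
    show "Cn (sb (tw p) (2 * p - i)) * nn p (t - 2 * int p + int (2 * p - i)) (s - int (2 * p - i)) q
       = Cn (sb (tw p) i) * nn p (s - 2 * int p + int i) (t - int i) q"
      unfolding e using i sb_2p_sym[of i p] nn_commute[of p "t - int i" "s - 2 * int p + int i" q] by simp
  qed auto
  also have "\<dots> = eps p (t - 2 * int p) (eps p s q)" by (rule eps_eps[symmetric])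
  finally show ?thesis .
qed

lemma nn_zero: "s < - int (vb q) \<or> t < - int (vb q) \<Longrightarrow> nn p s t q = 0"
  unfolding nn_def by (intro sum.neutral ballI) auto

lemma eps_neg: "t < - int (vb q) \<Longrightarrow> eps p t q = 0"
  unfolding eps_sum[OF order_refl] by (intro sum.neutral ballI) auto

text \<open>The coefficients of e^alpha(z) e^alpha(z) = 0: summing over all splittings of a total
  index sets x = z, and the prefactor becomes (1 - 1)^(2p). For large K the truncation cuts off only
  zero terms, so the sum of normally ordered terms is the same for every i.\<close>

lemma eps_eps_sum_zero: assumes "p \<ge> 1"
  shows "\<exists>K0. \<forall>K\<ge>K0. (\<Sum>l\<in>{- int K..int K}. eps p (A + l) (eps p (B - l) q)) = 0"
proof -
  define R where "R = \<bar>A\<bar> + \<bar>B\<bar> + int (vb q)"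
  have "(\<Sum>l\<in>{- int K..int K}. eps p (A + l) (eps p (B - l) q)) = 0" if K: "int K \<ge> R + 2 * int p" for K
  proof -
    have "(\<Sum>l\<in>{- int K..int K}. eps p (A + l) (eps p (B - l) q))
      = (\<Sum>l\<in>{- int K..int K}. \<Sum>i\<le>2 * p. Cn (sb (tw p) i) * nn p (A + l + int i) (B - l - int i) q)"
      by (simp only: eps_eps)
    also have "\<dots> = (\<Sum>i\<le>2 * p. Cn (sb (tw p) i) * (\<Sum>l\<in>{- int K..int K}. nn p (A + l + int i) (B - l - int i) q))"
      by (subst sum.swap) (simp only: sum_distrib_left)
    also have "\<dots> = (\<Sum>i\<le>2 * p. Cn (sb (tw p) i) * (\<Sum>l\<in>{- R..R}. nn p (A + l) (B - l) q))"
    proof (rule sum.cong[OF refl])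
      fix i assume i: "i \<in> {..2 * p}"
      have "(\<Sum>l\<in>{- int K..int K}. nn p (A + l + int i) (B - l - int i) q) = (\<Sum>l\<in>{- R - int i..R - int i}. nn p (A + l + int i) (B - l - int i) q)"
      proof (rule sum.mono_neutral_right)
        show "{- R - int i..R - int i} \<subseteq> {- int K..int K}" using i K by auto
        show "\<forall>l\<in>{- int K..int K} - {- R - int i..R - int i}. nn p (A + l + int i) (B - l - int i) q = 0"
        proof
          fix l assume "l \<in> {- int K..int K} - {- R - int i..R - int i}"
          then show "nn p (A + l + int i) (B - l - int i) q = 0" by (intro nn_zero) (auto simp: R_def)
        qed
      qed auto
      also have "\<dots> = (\<Sum>l\<in>{- R..R}. nn p (A + l) (B - l) q)"
        by (rule sum.reindex_bij_witness[of _ "\<lambda>l. l - int i" "\<lambda>l. l + int i"]) (auto simp: algebra_simps)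
      finally show "Cn (sb (tw p) i) * (\<Sum>l\<in>{- int K..int K}. nn p (A + l + int i) (B - l - int i) q) = Cn (sb (tw p) i) * (\<Sum>l\<in>{- R..R}. nn p (A + l) (B - l) q)" by simp
    qed
    also have "\<dots> = Cn (\<Sum>i\<le>2 * p. sb (tw p) i) * (\<Sum>l\<in>{- R..R}. nn p (A + l) (B - l) q)"
      by (simp add: Cn_sum sum_distrib_right)
    also have "(\<Sum>i\<le>2 * p. sb (tw p) i) = 0"
    proof -
      have "(\<Sum>i\<le>2 * p. sb (tw p) i) = (\<Sum>i\<le>2 * p. (-1) ^ i * of_nat ((2 * p) choose i))"
        unfolding sb_def tw_def by (simp only: binomial_gbinomial)
      also have "\<dots> = 0" using choose_alternating_sum[of "2 * p", where 'a = complex] assms by simp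
      finally show ?thesis .
    qed
    finally show ?thesis by simp
  qed
  then show ?thesis by (intro exI[of _ "nat (R + 2 * int p)"]) auto
qed

text \<open>The operator z d/dz applied to E^-(z) E^+(z): differentiating E^- brings down creation
  operators, differentiating E^+ brings down annihilation operators. On a given \<open>q\<close>
  both sums are finite, hence the threshold \<open>K0\<close>.\<close>

lemma eps_Euler: 
  shows "\<exists>K0. \<forall>K\<ge>K0. of_int t * eps p t q = (\<Sum>l\<in>{1..K}. Xv l * eps p (t - int l) q) + (\<Sum>l\<in>{1..K}. eps p (t + int l) (al p l q))"
proof -
  define F where "F = vb q"
  have "of_int t * eps p t q = (\<Sum>l\<in>{1..K}. Xv l * eps p (t - int l) q) + (\<Sum>l\<in>{1..K}. eps p (t + int l) (al p l q))"
    if K: "K \<ge> F + nat \<bar>t\<bar>" for K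
  proof -
    have 1: "(\<Sum>l\<in>{1..K}. Xv l * eps p (t - int l) q) = (\<Sum>f\<le>F. of_int (t + int f) * (Sc 1 (t + int f) * Gm p 1 f q))"
    proof -
      have "(\<Sum>l\<in>{1..K}. Xv l * eps p (t - int l) q) = (\<Sum>l\<in>{1..K}. \<Sum>f\<le>F. Xv l * (Sc 1 (t + int f - int l) * Gm p 1 f q))"
        unfolding eps_sum[OF order_refl] F_def sum_distrib_left by (simp add: algebra_simps)
      also have "\<dots> = (\<Sum>f\<le>F. (\<Sum>l\<in>{1..K}. Xv l * Sc 1 (t + int f - int l)) * Gm p 1 f q)"
        by (subst sum.swap) (simp only: sum_distrib_right mult.assoc)
      also have "\<dots> = (\<Sum>f\<le>F. of_int (t + int f) * (Sc 1 (t + int f) * Gm p 1 f q))"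
      proof (rule sum.cong[OF refl])
        fix f assume f: "f \<in> {..F}"
        have "(\<Sum>l\<in>{1..K}. Xv l * Sc 1 (t + int f - int l)) = of_int (t + int f) * Sc 1 (t + int f)"
          using Sc_rec'[of "t + int f" K 1] f K by simp
        then show "(\<Sum>l\<in>{1..K}. Xv l * Sc 1 (t + int f - int l)) * Gm p 1 f q = of_int (t + int f) * (Sc 1 (t + int f) * Gm p 1 f q)"
          by (simp only: mult.assoc)
      qed
      finally show ?thesis .
    qed
    have 2: "(\<Sum>l\<in>{1..K}. eps p (t + int l) (al p l q)) = (\<Sum>f\<le>F. - (of_nat f * (Sc 1 (t + int f) * Gm p 1 f q)))"
    proof -
      have v: "vb (al p l q) \<le> F" for l unfolding F_def by (rule vb_al)
      let ?g = "\<lambda>l f. Sc 1 (t + int f) * al p l (Gm p 1 (f - l) q)"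
      have "(\<Sum>l\<in>{1..K}. eps p (t + int l) (al p l q)) = (\<Sum>l\<in>{1..K}. \<Sum>f\<le>F. if l \<le> f then ?g l f else 0)"
      proof (rule sum.cong[OF refl])
        fix l assume l: "l \<in> {1..K}"
        have e: "t + int l + int f = t + int (f + l)" for f by simp
        have "eps p (t + int l) (al p l q) = (\<Sum>f\<le>F. ?g l (f + l))"
          unfolding eps_sum[OF v] Gm_al e by simp
        also have "\<dots> = (\<Sum>f\<in>{l..F + l}. ?g l f)"
          by (rule sum.reindex_bij_witness[of _ "\<lambda>f. f - l" "\<lambda>f. f + l"]) auto
        also have "\<dots> = (\<Sum>f\<le>F + l. if l \<le> f then ?g l f else 0)"
          by (intro sum.mono_neutral_cong_left) auto
        also have "\<dots> = (\<Sum>f\<le>F. if l \<le> f then ?g l f else 0)"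
        proof (rule sum.mono_neutral_right)
          show "\<forall>f\<in>{..F + l} - {..F}. (if l \<le> f then ?g l f else 0) = 0"
          proof
            fix f assume "f \<in> {..F + l} - {..F}"
            then show "(if l \<le> f then ?g l f else 0) = 0" using al_Gm_zero[of q l "f - l" p 1] by (auto simp: F_def)
          qed
        qed auto
        finally show "eps p (t + int l) (al p l q) = (\<Sum>f\<le>F. if l \<le> f then ?g l f else 0)" .
      qed
      also have "\<dots> = (\<Sum>f\<le>F. \<Sum>l\<in>{1..K}. if l \<le> f then ?g l f else 0)" by (rule sum.swap)
      also have "\<dots> = (\<Sum>f\<le>F. - (of_nat f * (Sc 1 (t + int f) * Gm p 1 f q)))"
      proof (rule sum.cong[OF refl])
        fix f assume f: "f \<in> {..F}"
        have "(\<Sum>l\<in>{1..K}. if l \<le> f then ?g l f else 0) = (\<Sum>l\<in>{1..f}. ?g l f)"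
          using f K by (intro sum.mono_neutral_cong_right) auto
        also have "\<dots> = Sc 1 (t + int f) * - (of_nat f * Gm p 1 f q)"
          unfolding Gm_rec by (simp add: sum_distrib_left sum_negf)
        finally show "(\<Sum>l\<in>{1..K}. if l \<le> f then ?g l f else 0) = - (of_nat f * (Sc 1 (t + int f) * Gm p 1 f q))"
          by (simp add: mult.left_commute)
      qed
      finally show ?thesis .
    qed
    show ?thesis unfolding 1 2 sum.distrib[symmetric] unfolding eps_sum[OF order_refl, of p t q] F_def[symmetric] sum_distrib_left
      by (intro sum.cong refl) (simp add: algebra_simps)
  qed
  then show ?thesis by blast
qed

text \<open>The commutator [alpha(l), e^alpha(z)] = 2p z^l e^alpha(z): alpha(l) commutes with E^+
  and acts on E^- by \<open>al_Sc\<close>.\<close>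

lemma al_eps: assumes "l \<ge> 1" shows "al p l (eps p t q) = eps p t (al p l q) + Cn (tw p) * eps p (t - int l) q"
proof -
  have v: "vb (al p l q) \<le> vb q" by (rule vb_al)
  have t: "of_int (2 * int p * 1) = Cn (tw p)" by (simp add: tw_def Cn_mult Cn_of_nat Cn_numeral)
  have e: "t + int f - int l = t - int l + int f" for f by simp
  show ?thesis
    unfolding eps_sum[OF v] eps_sum[OF order_refl[of "vb q"]] al_sum al_mult al_Sc[OF assms] t Gm_al e
    by (simp add: sum.distrib sum_distrib_left mult_ac)
qed

section \<open>Degrees, and evaluation with all variables equal\<close>

lemma wd_eps: "wd I d q \<Longrightarrow> wd I (d + t) (eps p t q)"
proof -
  assume a: "wd I d q"
  have "wd I (d + t) (Sc 1 (t + int f) * Gm p 1 f q)" for f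
    using wd_mult[OF wd_Sc[of "t + int f" 1] wd_Gm[OF a, of f p 1]] by simp
  then show ?thesis unfolding eps_sum[OF order_refl] by (intro wd_sum)
qed

definition ev :: "complex \<Rightarrow> pol \<Rightarrow> complex" where "ev c = subst (\<lambda>x. x) (\<lambda>_. c)"

lemma ev_hom: "ev c 1 = 1" "ev c (q + r) = ev c q + ev c r" "ev c (q * r) = ev c q * ev c r" "ev c 0 = 0"
  unfolding ev_def using rhomD[OF rhom_subst[OF rhom_id]] by blast+
lemma ev_Cn [simp]: "ev c (Cn d) = d" by (simp add: ev_def subst_Cn rhom_id)
lemma ev_Xv [simp]: "ev c (Xv n) = c" by (simp add: ev_def subst_Xv rhom_id)
lemma ev_sum: "ev c (\<Sum>x\<in>A. q x) = (\<Sum>x\<in>A. ev c (q x))"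
  by (induction A rule: infinite_finite_induct) (auto simp: ev_hom)
lemma ev_of_int: "ev c (of_int n) = of_int n" using ev_Cn[of c "of_int n"] by (simp add: Cn_of_int)
lemma ev_uminus: "ev c (- q) = - ev c q"
  using ev_hom(2)[of c q "- q"] ev_hom(4)[of c] by (simp add: eq_neg_iff_add_eq_0 add.commute)

text \<open>On a monomial of degree d, the coefficient of z^(-d) must take the shift -2pk z^(-n)
  from every factor alpha(-n). So the last coefficient of E^+ is an evaluation.\<close>

lemma Gm_top:
  assumes "vin {1..} q" "wd {0} (int d) q"
  shows "Gm p k d q = Cn (ev (- of_int (2 * int p * k)) q)"
proof -
  define c :: complex where "c = - of_int (2 * int p * k)"
  have m: "Gm p k (deg nu) (Mo nu) = Cn (ev c (Mo nu))" if "pkeys nu \<subseteq> {1..}" for nu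
    using that
  proof (induction nu rule: mon_induct_in)
    case zero then show ?case by (simp add: Gm_1 ev_hom)
  next
    case (add n mu)
    have e: "Mo (mu + sgl n 1) = Xv n * Mo mu" by (simp add: Mo_add Xv_def mult.commute)
    have z: "Gm p k (deg mu + n) (Mo mu) = 0"
      using wd_neg[OF wd_Gm[OF wd_Mo, of mu "deg mu + n" p k]] add(1) by simp
    show ?case unfolding e deg_add deg_single Gm_Xv mult_1_right z ev_hom(3) ev_Xv Cn_mult
      using add by (simp add: c_def Cn_uminus Cn_of_int Cn_mult Cn_of_nat Cn_numeral)
  qed
  have "Gm p k d q = (\<Sum>nu\<in>pkeys q. Cn (lkp q nu) * Gm p k d (Mo nu))"
    by (subst pol_expand[of q]) (simp add: Gm_sum sgl_eq Gm_Cn_mult)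
  also have "\<dots> = (\<Sum>nu\<in>pkeys q. Cn (lkp q nu * ev c (Mo nu)))"
  proof (rule sum.cong[OF refl])
    fix nu assume nu: "nu \<in> pkeys q"
    then have "deg nu = d" "pkeys nu \<subseteq> {1..}" using assms by (auto simp: wd_def vin_def)
    then show "Cn (lkp q nu) * Gm p k d (Mo nu) = Cn (lkp q nu * ev c (Mo nu))" using m[of nu] by (simp add: Cn_mult)
  qed
  also have "\<dots> = Cn (ev c q)"
    by (subst (2) pol_expand[of q]) (simp add: ev_sum Cn_sum sgl_eq ev_hom)
  finally show ?thesis unfolding c_def .
qed

lemma wd_0_const: assumes "vin {1..} q" "wd {..0} 0 q" shows "q = Cn (lkp q 0)"
proof -
  have "nu = 0" if nu: "nu \<in> pkeys q" for nu
  proof -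
    have "deg nu = 0" using assms(2) nu by (auto simp: wd_def)
    then have "pkeys nu \<subseteq> {0}" using deg_ge'[of _ nu] by auto
    moreover have "pkeys nu \<subseteq> {1..}" using assms(1) nu by (auto simp: vin_def)
    ultimately have "pkeys nu = {}" by (metis One_nat_def atLeast_iff empty_iff equals0I insertE not_one_le_zero subsetD)
    then show ?thesis by simp
  qed
  then show ?thesis by (intro poly_mapping_eqI) (auto simp: Cn_def lookup_single when_def in_keys_iff)
qed

lemma eps_top:
  assumes "vin {1..} q" "wd {0} (int d) q"
  shows "eps p (- int d) q = Cn (ev (- tw p) q)"
proof -
  have "vb q \<le> d" using assms(2) by (auto simp: vb_le_iff wd_def)
  then have "eps p (- int d) q = (\<Sum>f\<le>d. Sc 1 (- int d + int f) * Gm p 1 f q)" by (rule eps_sum)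
  also have "\<dots> = (\<Sum>f\<le>d. if f = d then Gm p 1 d q else 0)"
    by (intro sum.cong) auto
  also have "\<dots> = Gm p 1 d q" by simp
  also have "\<dots> = Cn (ev (- tw p) q)" using Gm_top[OF assms, of p 1] by (simp add: tw_def)
  finally show ?thesis .
qed

text \<open>The mode \<open>e\<^sup>\<alpha>\<^sub>k\<close>; a vector is a family of polynomials indexed by the charge \<open>a\<close>,
  where \<open>a\<close> stands for \<open>(a/2p) \<alpha>\<close>.\<close>
definition EE :: "nat \<Rightarrow> int \<Rightarrow> (int \<Rightarrow> pol) \<Rightarrow> int \<Rightarrow> pol" where
  "EE p k v = (\<lambda>a. eps p (2 * int p - a - k - 1) (v (a - 2 * int p)))"

definition e0 :: "int \<Rightarrow> int \<Rightarrow> pol" where "e0 a = (\<lambda>a'. if a' = a then 1 else 0)"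

section \<open>Commuting modes of e^alpha\<close>

lemma EE_commute: "EE p k (EE p l v) = EE p l (EE p k v)"
proof
  fix a
  define T where "T = 4 * int p - a - 1"
  have "EE p k (EE p l v) a = eps p (T - k - 2 * int p) (eps p (T - l) (v (a - 2 * int p - 2 * int p)))" for k l
    by (simp add: EE_def T_def algebra_simps)
  then show "EE p k (EE p l v) a = EE p l (EE p k v) a" using eps_commute[of p "T - k" "T - l"] by simp
qed

lemma EE_pow_commute: "EE p k ((EE p l ^^ n) v) = (EE p l ^^ n) (EE p k v)"
proof (induction n)
  case (Suc n)
  have "EE p k ((EE p l ^^ Suc n) v) = EE p l (EE p k ((EE p l ^^ n) v))" by (simp, rule EE_commute)
  then show ?case by (simp add: Suc)
qed simp

text \<open>E_1 is the residue of z e^alpha(z), so this vector is an iterated residue in r + s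
  variables with the product of r of them inserted. These are the insertions in Aomoto's proof of
  Selberg's formula.\<close>

definition st :: "nat \<Rightarrow> int \<Rightarrow> nat \<Rightarrow> nat \<Rightarrow> int \<Rightarrow> pol" where
  "st p a r s = (EE p 1 ^^ r) ((EE p 0 ^^ s) (e0 a))"

lemma st_Suc_left: "st p a (Suc r) s = EE p 1 (st p a r s)" by (simp add: st_def)
lemma st_Suc_right: "st p a r (Suc s) = EE p 0 (st p a r s)"
  by (simp add: st_def EE_pow_commute)

lemma EE_scale: "EE p k (\<lambda>a. Cn c * v a) = (\<lambda>a. Cn c * EE p k v a)"
  by (simp add: EE_def eps_Cn_mult)
lemma EE_add: "EE p k (\<lambda>a. v a + w a) = (\<lambda>a. EE p k v a + EE p k w a)"
  by (simp add: EE_def eps_add)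
lemma EE_0: "EE p k (\<lambda>a. 0) = (\<lambda>a. 0)" by (simp add: EE_def)

lemma al_EE: assumes "l \<ge> 1"
  shows "(\<lambda>a. al p l (EE p k v a)) = (\<lambda>a. EE p k (\<lambda>a. al p l (v a)) a + Cn (tw p) * EE p (k + int l) v a)"
proof
  fix a
  have "2 * int p - a - k - 1 - int l = 2 * int p - a - (k + int l) - 1" by simp
  then show "al p l (EE p k v a) = EE p k (\<lambda>a. al p l (v a)) a + Cn (tw p) * EE p (k + int l) v a"
    by (simp only: EE_def al_eps[OF assms])
qed

text \<open>alpha(l) kills e_a and replaces a factor E_k by 2p E_(k+l). Since all modes commute, the
  replaced factor can be moved to the front, and equal factors give equal terms.\<close>

lemma al_st: assumes l: "l \<ge> 1"
  shows "(\<lambda>b. al p l (st p a r s b)) = (\<lambda>b. Cn (tw p * of_nat s) * EE p (int l) (st p a r (s - 1)) b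
     + Cn (tw p * of_nat r) * EE p (1 + int l) (st p a (r - 1) s) b)"
proof (induction r)
  case 0
  show ?case
  proof (induction s)
    case 0
    then show ?case by (auto simp: st_def e0_def)
  next
    case (Suc s)
    have "EE p 0 (\<lambda>b. al p l (st p a 0 s b)) = (\<lambda>b. Cn (tw p * of_nat s) * EE p (int l) (st p a 0 s) b)"
    proof (cases s)
      case 0 then show ?thesis unfolding Suc by (simp add: EE_0)
    next
      case (Suc s')
      then show ?thesis unfolding \<open>(\<lambda>b. al p l (st p a 0 s b)) = _\<close>
        by (simp add: EE_scale EE_commute[of p 0] st_Suc_right[symmetric])
    qed
    then show ?case unfolding st_Suc_right[of p a 0 s] al_EE[OF l]
      by (simp add: Cn_mult Cn_add algebra_simps)
  qed
next
  case (Suc r)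
  have 1: "EE p 1 (EE p (int l) (st p a r (s - 1))) = EE p (int l) (st p a (Suc r) (s - 1))"
    by (simp only: EE_commute[of p 1] st_Suc_left)
  have 2: "Cn (tw p * of_nat r) * EE p 1 (EE p (1 + int l) (st p a (r - 1) s)) b = Cn (tw p * of_nat r) * EE p (1 + int l) (st p a r s) b" for b
    by (cases r) (simp_all add: EE_commute[of p 1] st_Suc_left)
  have "EE p 1 (\<lambda>b. al p l (st p a r s b)) = (\<lambda>b. Cn (tw p * of_nat s) * EE p (int l) (st p a (Suc r) (s - 1)) b
     + Cn (tw p * of_nat r) * EE p (1 + int l) (st p a r s) b)"
    unfolding Suc EE_add EE_scale 1 2 ..
  then show ?case unfolding st_Suc_left[of p a r s] al_EE[OF l]
    by (simp add: st_Suc_left[symmetric] Cn_mult Cn_add algebra_simps)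
qed

text \<open>In the vanishing sum over all l of E_(k-l) E_(k+l) the terms for l and -l agree, so
  twice the half over l \<ge> 1 is minus the middle term. If the indices add up to 1, the symmetry
  has no fixed term and the half itself is 0; splitting off its first term gives the third
  identity.\<close>

lemma half_sums:
  assumes p: "p \<ge> 1"
  shows "\<exists>K0. \<forall>K\<ge>K0. (\<Sum>l\<in>{1..K}. EE p (1 - int l) (EE p (int l) v) a) = 0
      \<and> Cn 2 * (\<Sum>l\<in>{1..K}. EE p (k - int l) (EE p (k + int l) v) a) = - EE p k (EE p k v) a
      \<and> (\<Sum>l\<in>{1..K}. EE p (- int l) (EE p (1 + int l) v) a) = - EE p 0 (EE p 1 v) a"
proof -
  define T where "T = 4 * int p - a - 1"
  define q where "q = v (a - 2 * int p - 2 * int p)"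
  define D where "D = (\<lambda>k l. EE p k (EE p l v) a)"
  have D: "D k l = eps p (T - 2 * int p - k) (eps p (T - l) q)" for k l
    by (simp add: EE_def T_def q_def D_def algebra_simps)
  have sym: "D k l = D l k" for k l unfolding D_def by (subst EE_commute) simp
  obtain K1 where K1: "\<And>K. K \<ge> K1 \<Longrightarrow> (\<Sum>l\<in>{- int K..int K}. eps p (T - 2 * int p - k + l) (eps p (T - k - l) q)) = 0"
    using eps_eps_sum_zero[OF p] by blast
  obtain K2 where K2: "\<And>K. K \<ge> K2 \<Longrightarrow> (\<Sum>l\<in>{- int K..int K}. eps p (T - 2 * int p - 0 + l) (eps p (T - 1 - l) q)) = 0"
    using eps_eps_sum_zero[OF p] by blast
  define K0 where "K0 = K1 + K2 + nat \<bar>T\<bar> + vb q + 1"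
  have "(\<Sum>l\<in>{1..K}. D (1 - int l) (int l)) = 0 \<and> Cn 2 * (\<Sum>l\<in>{1..K}. D (k - int l) (k + int l)) = - D k k
     \<and> (\<Sum>l\<in>{1..K}. D (- int l) (1 + int l)) = - D 0 1" if K: "K \<ge> K0" for K
  proof (intro conjI)
    have split: "(\<Sum>l\<in>{- int K..int K}. f l) = f 0 + (\<Sum>l\<in>{1..K}. f (int l)) + (\<Sum>l\<in>{1..K}. f (- int l))" for f :: "int \<Rightarrow> pol"
    proof -
      have u: "{- int K..int K} = {0} \<union> (int ` {1..K} \<union> (\<lambda>l. - int l) ` {1..K})"
      proof (intro equalityI subsetI)
        fix x assume x: "x \<in> {- int K..int K}"
        consider "x = 0" | "x > 0" | "x < 0" by linarith
        then show "x \<in> {0} \<union> (int ` {1..K} \<union> (\<lambda>l. - int l) ` {1..K})"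
        proof cases
          case 2 then show ?thesis using x by (intro UnI2 UnI1 image_eqI[of _ _ "nat x"]) auto
        next
          case 3 then show ?thesis using x by (intro UnI2 image_eqI[of _ _ "nat (- x)"]) auto
        qed auto
      qed auto
      have "(\<Sum>l\<in>{- int K..int K}. f l) = (\<Sum>l\<in>{0}. f l) + ((\<Sum>l\<in>int ` {1..K}. f l) + (\<Sum>l\<in>(\<lambda>l. - int l) ` {1..K}. f l))"
        unfolding u by (subst sum.union_disjoint; (subst sum.union_disjoint)?) auto
      also have "(\<Sum>l\<in>int ` {1..K}. f l) = (\<Sum>l\<in>{1..K}. f (int l))" by (subst sum.reindex) auto
      also have "(\<Sum>l\<in>(\<lambda>l. - int l) ` {1..K}. f l) = (\<Sum>l\<in>{1..K}. f (- int l))" by (subst sum.reindex) (auto simp: inj_on_def)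
      finally show ?thesis by (simp add: add.assoc)
    qed
    have s1: "(\<Sum>l\<in>{- int K..int K}. D (k - l) (k + l)) = 0"
      using K1[of K] K unfolding D by (simp add: K0_def algebra_simps)
    have s2: "(\<Sum>l\<in>{- int K..int K}. D (- l) (1 + l)) = 0"
      using K2[of K] K unfolding D by (simp add: K0_def algebra_simps)
    have "D k k + (\<Sum>l\<in>{1..K}. D (k - int l) (k + int l)) + (\<Sum>l\<in>{1..K}. D (k - int l) (k + int l)) = 0"
      using s1 unfolding split by (simp add: sym[of "k + int _"])
    moreover have "y + y = - x" if "x + y + y = 0" for x y :: pol
    proof -
      have "y + y = (x + y + y) - x" by simp
      then show ?thesis unfolding that by simp
    qed
    ultimately show "Cn 2 * (\<Sum>l\<in>{1..K}. D (k - int l) (k + int l)) = - D k k"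
      by (simp only: Cn_numeral mult_2)
    let ?S = "\<Sum>l\<in>{1..K}. D (- int l) (1 + int l)"
    let ?R = "\<Sum>l\<in>{1..K}. D (1 - int l) (int l)"
    have z: "D (- int K) (1 + int K) = 0"
    proof -
      have "eps p (T - (1 + int K)) q = 0" using K by (intro eps_neg) (simp add: K0_def)
      then show ?thesis by (simp add: D)
    qed
    have "D 0 1 + ?S + (\<Sum>l\<in>{1..K}. D (int l) (1 - int l)) = 0" using s2 unfolding split by simp
    then have a1: "D 0 1 + ?S + ?R = 0" by (simp add: sym[of "int _"])
    \<comment> \<open>Both sides are the sum of D (-l) (1 + l) over l \<ge> 0, cut off at K and at K
      - 1; \<open>z\<close> says that the additional last term is 0.\<close>
    have a2: "?R = D 0 1 + ?S"
    proof -
      have "D 0 1 + ?S = (\<Sum>l\<in>{0..K}. D (- int l) (1 + int l))"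
        by (subst sum.atLeast_Suc_atMost) (auto simp: One_nat_def)
      also have "\<dots> = (\<Sum>l\<in>{0..<K}. D (- int l) (1 + int l))"
        using z by (simp add: sum.last_plus atLeastLessThanSuc_atLeastAtMost[symmetric])
      also have "\<dots> = ?R"
        by (rule sum.reindex_bij_witness[of _ "\<lambda>l. l - 1" Suc]) (auto simp: One_nat_def of_nat_diff algebra_simps)
      finally show ?thesis by simp
    qed
    have "?R + ?R = 0" using a1 unfolding a2[symmetric] .
    then have "Cn 2 * ?R = 0" by (simp only: Cn_numeral mult_2)
    then show r: "?R = 0" unfolding mult_eq_0_iff Cn_eq_0_iff by simp
    have "?S = (D 0 1 + ?S) - D 0 1" by simp
    then show "?S = - D 0 1" unfolding a2[symmetric] r by simp
  qed
  then show ?thesis unfolding D_def by blast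
qed

section \<open>Aomoto's recursion\<close>

lemma EE_Euler:
  shows "\<exists>K0. \<forall>K\<ge>K0. of_int (2 * int p - b - k - 1) * EE p k v b = (\<Sum>l\<in>{1..K}. Xv l * EE p (k + int l) v b)
     + (\<Sum>l\<in>{1..K}. EE p (k - int l) (\<lambda>a. al p l (v a)) b)"
proof -
  define t where "t = 2 * int p - b - k - 1"
  have e: "t - int l = 2 * int p - b - (k + int l) - 1" "t + int l = 2 * int p - b - (k - int l) - 1" for l
    by (auto simp: t_def)
  show ?thesis using eps_Euler[of t p "v (b - 2 * int p)"] unfolding e unfolding EE_def t_def .
qed

text \<open>The Euler identities for E_1 v and E_0 v contain the sums of x_l E_(1+l) v and of x_l
  E_l v. Evaluated at x_l = c these become c Z and c (ev c X + Z) with the same tail Z, and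
  subtraction removes Z. The terms with alpha(l) are turned by \<open>al_st\<close> and
  \<open>half_sums\<close> into multiples of X and Y.\<close>

lemma aomoto:
  assumes p: "p \<ge> 1" and b: "b = a + 2 * int p * (int r + 1 + int s)"
  defines "t \<equiv> of_int (2 * int p - b - 2) :: complex"
  shows "ev c (st p a (Suc r) s b) * (t + c + of_nat (p * r))
     = ev c (st p a r (Suc s) b) * (t + 1 + of_nat (p * s) + of_nat (2 * p * r))"
proof -
  define v where "v = st p a r s"
  define v0 where "v0 = st p a r (s - 1)"
  define v1 where "v1 = st p a (r - 1) s"
  define P :: complex where "P = of_nat p"
  have tw: "tw p = P * 2" by (simp add: tw_def P_def)
  have al: "EE p j (\<lambda>a. al p l (v a)) b = Cn (tw p * of_nat s) * EE p j (EE p (int l) v0) b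
     + Cn (tw p * of_nat r) * EE p j (EE p (1 + int l) v1) b" if "l \<ge> 1" for j l
    unfolding v_def al_st[OF that] v0_def v1_def EE_add EE_scale ..
  obtain K1 where K1: "\<And>K. K \<ge> K1 \<Longrightarrow> of_int (2 * int p - b - 1 - 1) * EE p 1 v b = (\<Sum>l\<in>{1..K}. Xv l * EE p (1 + int l) v b)
     + (\<Sum>l\<in>{1..K}. EE p (1 - int l) (\<lambda>a. al p l (v a)) b)" using EE_Euler by blast
  obtain K2 where K2: "\<And>K. K \<ge> K2 \<Longrightarrow> of_int (2 * int p - b - 0 - 1) * EE p 0 v b = (\<Sum>l\<in>{1..K}. Xv l * EE p (0 + int l) v b)
     + (\<Sum>l\<in>{1..K}. EE p (0 - int l) (\<lambda>a. al p l (v a)) b)" using EE_Euler by blast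
  obtain K3 where K3: "\<And>K. K \<ge> K3 \<Longrightarrow> (\<Sum>l\<in>{1..K}. EE p (1 - int l) (EE p (int l) v0) b) = 0
      \<and> Cn 2 * (\<Sum>l\<in>{1..K}. EE p (0 - int l) (EE p (0 + int l) v0) b) = - EE p 0 (EE p 0 v0) b
      \<and> (\<Sum>l\<in>{1..K}. EE p (- int l) (EE p (1 + int l) v0) b) = - EE p 0 (EE p 1 v0) b"
    using half_sums[OF p] by blast
  obtain K4 where K4: "\<And>K. K \<ge> K4 \<Longrightarrow> (\<Sum>l\<in>{1..K}. EE p (1 - int l) (EE p (int l) v1) b) = 0
      \<and> Cn 2 * (\<Sum>l\<in>{1..K}. EE p (1 - int l) (EE p (1 + int l) v1) b) = - EE p 1 (EE p 1 v1) b
      \<and> (\<Sum>l\<in>{1..K}. EE p (- int l) (EE p (1 + int l) v1) b) = - EE p 0 (EE p 1 v1) b"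
    using half_sums[OF p] by blast
  define K where "K = K1 + K2 + K3 + K4 + nat \<bar>2 * int p - b\<bar> + vb (v (b - 2 * int p)) + 1"
  have K: "K \<ge> K1" "K \<ge> K2" "K \<ge> K3" "K \<ge> K4" by (auto simp: K_def)
  define X where "X = EE p 1 v b"
  define Y where "Y = EE p 0 v b"
  have Xe: "X = st p a (Suc r) s b" by (simp add: X_def v_def st_Suc_left)
  have Ye: "Y = st p a r (Suc s) b" by (simp add: Y_def v_def st_Suc_right)
  have r1: "Cn (P * of_nat r) * EE p 1 (EE p 1 v1) b = Cn (P * of_nat r) * X"
    unfolding X_def v_def v1_def by (cases r) (simp_all add: st_Suc_left)
  have r2: "Cn (tw p * of_nat r) * EE p 0 (EE p 1 v1) b = Cn (tw p * of_nat r) * Y"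
    unfolding Y_def v_def v1_def by (cases r) (simp_all add: st_Suc_left)
  have r3: "Cn (P * of_nat s) * EE p 0 (EE p 0 v0) b = Cn (P * of_nat s) * Y"
    unfolding Y_def v_def v0_def by (cases s) (simp_all add: st_Suc_right)
  have tr: "Cn (tw p * of_nat n) = Cn (P * of_nat n) * Cn 2" for n unfolding tw Cn_mult by (simp only: mult_ac)
  have E1: "of_int (2 * int p - b - 1 - 1) * X = (\<Sum>l\<in>{1..K}. Xv l * EE p (1 + int l) v b) - Cn (P * of_nat r) * X"
  proof -
    have "(\<Sum>l\<in>{1..K}. EE p (1 - int l) (\<lambda>a. al p l (v a)) b)
      = Cn (tw p * of_nat s) * (\<Sum>l\<in>{1..K}. EE p (1 - int l) (EE p (int l) v0) b)
        + Cn (tw p * of_nat r) * (\<Sum>l\<in>{1..K}. EE p (1 - int l) (EE p (1 + int l) v1) b)"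
      using al by (simp add: sum.distrib sum_distrib_left)
    also have "\<dots> = Cn (P * of_nat r) * (Cn 2 * (\<Sum>l\<in>{1..K}. EE p (1 - int l) (EE p (1 + int l) v1) b))"
      using K3[OF K(3)] by (simp only: tr mult.assoc mult_zero_right add_0_left)
    also have "\<dots> = - (Cn (P * of_nat r) * X)" using K4[OF K(4)] r1 by (simp only: mult_minus_right)
    finally show ?thesis using K1[OF K(1)] unfolding X_def[symmetric] by simp
  qed
  have E0: "of_int (2 * int p - b - 0 - 1) * Y = (\<Sum>l\<in>{1..K}. Xv l * EE p (int l) v b) - Cn (P * of_nat s) * Y - Cn (tw p * of_nat r) * Y"
  proof -
    have "(\<Sum>l\<in>{1..K}. EE p (0 - int l) (\<lambda>a. al p l (v a)) b)
      = Cn (tw p * of_nat s) * (\<Sum>l\<in>{1..K}. EE p (0 - int l) (EE p (0 + int l) v0) b)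
        + Cn (tw p * of_nat r) * (\<Sum>l\<in>{1..K}. EE p (- int l) (EE p (1 + int l) v1) b)"
      using al by (simp add: sum.distrib sum_distrib_left)
    also have "\<dots> = Cn (P * of_nat s) * (Cn 2 * (\<Sum>l\<in>{1..K}. EE p (0 - int l) (EE p (0 + int l) v0) b))
        + Cn (tw p * of_nat r) * (\<Sum>l\<in>{1..K}. EE p (- int l) (EE p (1 + int l) v1) b)"
      by (simp only: tr[of s] mult.assoc)
    also have "\<dots> = - (Cn (P * of_nat s) * Y) - Cn (tw p * of_nat r) * Y"
      using K3[OF K(3)] K4[OF K(4)] r2 r3 by (simp only: mult_minus_right) simp
    finally show ?thesis using K2[OF K(2)] unfolding Y_def[symmetric] by simp
  qed
  define Z where "Z = (\<Sum>l\<in>{1..K}. ev c (EE p (1 + int l) v b))"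
  have Z0: "(\<Sum>l\<in>{1..K}. ev c (EE p (int l) v b)) = ev c X + Z"
  proof -
    have z: "EE p (1 + int K) v b = 0"
      unfolding EE_def by (rule eps_neg) (simp add: K_def)
    have "(\<Sum>l\<in>{1..K}. ev c (EE p (int l) v b)) = (\<Sum>l\<in>{0..<K}. ev c (EE p (1 + int l) v b))"
      by (rule sum.reindex_bij_witness[of _ Suc "\<lambda>l. l - 1"]) (auto simp: One_nat_def of_nat_diff)
    also have "\<dots> = (\<Sum>l\<in>{0..K}. ev c (EE p (1 + int l) v b))"
      by (rule sum.mono_neutral_left) (auto simp: z ev_hom)
    also have "\<dots> = ev c (EE p 1 v b) + Z"
      unfolding Z_def by (subst sum.atLeast_Suc_atMost) (auto simp: One_nat_def)
    finally show ?thesis by (simp add: X_def)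
  qed
  have sm: "ev c (x - y) = ev c x - ev c y" for x y
    using ev_hom(2)[of c x "- y"] by (simp add: ev_uminus)
  have F1: "t * ev c X = c * Z - P * of_nat r * ev c X"
  proof -
    have "ev c (of_int (2 * int p - b - 1 - 1) * X) = ev c ((\<Sum>l\<in>{1..K}. Xv l * EE p (1 + int l) v b) - Cn (P * of_nat r) * X)"
      by (simp only: E1)
    then show ?thesis unfolding ev_hom(3) ev_of_int sm ev_sum ev_Cn ev_Xv Z_def t_def by (simp add: sum_distrib_left)
  qed
  have F0: "(t + 1) * ev c Y = c * (ev c X + Z) - P * of_nat s * ev c Y - tw p * of_nat r * ev c Y"
  proof -
    have "ev c (of_int (2 * int p - b - 0 - 1) * Y) = ev c ((\<Sum>l\<in>{1..K}. Xv l * EE p (int l) v b) - Cn (P * of_nat s) * Y - Cn (tw p * of_nat r) * Y)"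
      by (simp only: E0)
    moreover have "of_int (2 * int p - b - 0 - 1) = t + 1" by (simp add: t_def)
    ultimately show ?thesis unfolding ev_hom(3) ev_of_int sm ev_sum ev_Cn ev_Xv Z0[symmetric]
      by (simp only: sum_distrib_left)
  qed
  have "t * ev c X - (t + 1) * ev c Y = - (c * ev c X) - P * of_nat r * ev c X + P * of_nat s * ev c Y + tw p * of_nat r * ev c Y"
    unfolding F1 F0 by (simp add: algebra_simps)
  then have "ev c X * (t + c + P * of_nat r) = ev c Y * (t + 1 + P * of_nat s + tw p * of_nat r)"
    by (simp add: algebra_simps) 
  then show ?thesis unfolding Xe Ye P_def tw_def by simp
qed

section \<open>Non-vanishing of the constants\<close>

lemma EE_app: "EE p k v a = eps p (2 * int p - a - k - 1) (v (a - 2 * int p))" by (simp add: EE_def)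

text \<open>A mode index and a charge enter \<open>EE\<close> only through their sum, so E_1
  starting from a does what E_0 does starting from a + 1. This turns the recursion in r into one in
  a.\<close>

lemma st_shift: "(EE p 1 ^^ s) (e0 a) b = (EE p 0 ^^ s) (e0 (a + 1)) (b + 1)"
proof (induction s arbitrary: b)
  case 0 then show ?case by (simp add: e0_def)
next
  case (Suc s)
  define w1 w2 where "w1 = (EE p 1 ^^ s) (e0 a)" and "w2 = (EE p 0 ^^ s) (e0 (a + 1))"
  have "w1 (b - 2 * int p) = w2 (b + 1 - 2 * int p)"
    using Suc[of "b - 2 * int p"] by (simp add: algebra_simps w1_def w2_def)
  moreover have "2 * int p - b - 1 - 1 = 2 * int p - (b + 1) - 0 - 1" by simp
  ultimately have "EE p 1 w1 b = EE p 0 w2 (b + 1)" by (simp only: EE_app)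
  then show ?case by (simp add: w1_def w2_def)
qed

text \<open>\<open>aomoto\<close> is run from r = 0 to r = \<sigma>. Its factors on the right are
  beta + p r > 0, those on the left are nonzero by hypothesis, and \<open>st_shift\<close> reads the
  end point r = \<sigma> as the start for a + 1. The number beta is the distance of a below the
  boundary value -1 - p (\<sigma> - 1).\<close>

lemma shift_step:
  assumes p: "p \<ge> 1" and beta: "beta \<ge> 1"
    and a: "a = - 1 - int p * (int \<sigma> - 1) - int beta"
    and c: "\<And>r. 1 \<le> r \<Longrightarrow> r \<le> \<sigma> \<Longrightarrow> of_int (int beta - 1 - int p * (int \<sigma> - int r)) + c \<noteq> 0"
  shows "ev c (st p a 0 \<sigma> (a + 2 * int p * int \<sigma>)) \<noteq> 0 \<longleftrightarrow> ev c (st p (a + 1) 0 \<sigma> (a + 1 + 2 * int p * int \<sigma>)) \<noteq> 0"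
proof -
  define b where "b = a + 2 * int p * int \<sigma>"
  have "ev c (st p a r (\<sigma> - r) b) \<noteq> 0 \<longleftrightarrow> ev c (st p a 0 \<sigma> b) \<noteq> 0" if "r \<le> \<sigma>" for r
    using that
  proof (induction r)
    case (Suc r)
    define s where "s = \<sigma> - Suc r"
    have s: "\<sigma> - r = Suc s" "int \<sigma> = int r + 1 + int s" using Suc.prems by (auto simp: s_def)
    have "ev c (st p a (Suc r) s b) * (of_int (2 * int p - b - 2) + c + of_nat (p * r))
      = ev c (st p a r (Suc s) b) * (of_int (2 * int p - b - 2) + 1 + of_nat (p * s) + of_nat (2 * p * r))"
      by (rule aomoto[OF p]) (simp add: b_def s(2))
    moreover have "of_int (2 * int p - b - 2) + c + of_nat (p * r) = of_int (int beta - 1 - int p * (int \<sigma> - int (Suc r))) + c"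
      unfolding b_def a by (simp add: algebra_simps)
    moreover have "of_int (2 * int p - b - 2) + 1 + of_nat (p * s) + of_nat (2 * p * r) = (of_nat (beta + p * r) :: complex)"
      unfolding b_def a s(2) by (simp add: algebra_simps)
    moreover have "of_nat (beta + p * r) \<noteq> (0::complex)" unfolding of_nat_eq_0_iff using beta by simp
    ultimately have "ev c (st p a (Suc r) s b) \<noteq> 0 \<longleftrightarrow> ev c (st p a r (Suc s) b) \<noteq> 0"
      using c[of "Suc r"] Suc.prems by (metis Suc_leI mult_eq_0_iff zero_less_Suc One_nat_def)
    then show ?case using Suc s(1) by (simp add: s_def)
  qed simp
  from this[of \<sigma>] have "ev c (st p a \<sigma> 0 b) \<noteq> 0 \<longleftrightarrow> ev c (st p a 0 \<sigma> b) \<noteq> 0" by simp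
  moreover have "st p a \<sigma> 0 b = st p (a + 1) 0 \<sigma> (b + 1)" by (simp add: st_def st_shift)
  ultimately show ?thesis unfolding b_def by (simp add: algebra_simps)
qed

text \<open>A screening of charge b changes the degree by -1 - b; adding this up over the charges a,
  a + 2p, ... gives the quadratic expression. It is zero at a = -1 - p (s - 1), the boundary value
  used below.\<close>

lemma st_wd: "wd {0} (- int s * (1 + a) - int p * int s * (int s - 1)) (st p a 0 s (a + 2 * int p * int s))"
proof (induction s)
  case 0 then show ?case using wd_Cn[of "{0}" 1] by (simp add: st_def e0_def)
next
  case (Suc s)
  have e: "a + 2 * int p * int (Suc s) - 2 * int p = a + 2 * int p * int s" by (simp add: algebra_simps)
  have "st p a 0 (Suc s) (a + 2 * int p * int (Suc s)) = eps p (- a - 2 * int p * int s - 1) (st p a 0 s (a + 2 * int p * int s))"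
    unfolding st_Suc_right EE_def e by (simp add: algebra_simps)
  then show ?case using wd_eps[OF Suc, of "- a - 2 * int p * int s - 1" p] by (simp add: algebra_simps)
qed

lemma st_vin: "vin {1..} (st p a 0 s b)"
  by (induction s arbitrary: b) (auto simp: st_def e0_def EE_def intro!: eps_vin)

text \<open>\<open>shift_step\<close> iterated downwards from the boundary value, where beta =
  0.\<close>

lemma st_nonzero_step:
  assumes p: "p \<ge> 1"
    and c: "\<And>beta' r. 1 \<le> beta' \<Longrightarrow> beta' \<le> beta \<Longrightarrow> 1 \<le> r \<Longrightarrow> r \<le> \<sigma> \<Longrightarrow> of_int (int beta' - 1 - int p * (int \<sigma> - int r)) + c \<noteq> 0"
    and nz: "ev c (st p (- 1 - int p * (int \<sigma> - 1)) 0 \<sigma> (- 1 - int p * (int \<sigma> - 1) + 2 * int p * int \<sigma>)) \<noteq> 0"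
  shows "ev c (st p (- 1 - int p * (int \<sigma> - 1) - int beta) 0 \<sigma> (- 1 - int p * (int \<sigma> - 1) - int beta + 2 * int p * int \<sigma>)) \<noteq> 0"
  using c
proof (induction beta)
  case 0 then show ?case using nz by simp
next
  case (Suc beta)
  define a where "a = - 1 - int p * (int \<sigma> - 1) - int (Suc beta)"
  have "ev c (st p a 0 \<sigma> (a + 2 * int p * int \<sigma>)) \<noteq> 0 \<longleftrightarrow> ev c (st p (a + 1) 0 \<sigma> (a + 1 + 2 * int p * int \<sigma>)) \<noteq> 0"
  proof (rule shift_step[OF p _ a_def])
    fix r assume "1 \<le> r" "r \<le> \<sigma>"
    then show "of_int (int (Suc beta) - 1 - int p * (int \<sigma> - int r)) + c \<noteq> 0" by (intro Suc.prems) auto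
  qed simp
  moreover have "a + 1 = - 1 - int p * (int \<sigma> - 1) - int beta" by (simp add: a_def)
  ultimately show ?case unfolding a_def[symmetric] using Suc by simp
qed

lemma st_base_const: "\<exists>d. st p (- 1 - int p * (int \<sigma> - 1)) 0 \<sigma> (- 1 - int p * (int \<sigma> - 1) + 2 * int p * int \<sigma>) = Cn d"
proof -
  define a where "a = - 1 - int p * (int \<sigma> - 1)"
  have e: "- int \<sigma> * (1 + a) - int p * int \<sigma> * (int \<sigma> - 1) = 0" by (simp add: a_def algebra_simps)
  have "wd {0} 0 (st p a 0 \<sigma> (a + 2 * int p * int \<sigma>))" using st_wd[of \<sigma> a p] unfolding e .
  then have "wd {..0} 0 (st p a 0 \<sigma> (a + 2 * int p * int \<sigma>))" by (auto simp: wd_def)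
  then show ?thesis using wd_0_const[OF st_vin] unfolding a_def by blast
qed

text \<open>At the boundary value for \<sigma> + 1 screenings, the first \<sigma> of them produce a
  homogeneous polynomial of degree p \<sigma>, and the last one evaluates it at -2p by
  \<open>eps_top\<close>. For \<sigma> screenings the same charge is p steps below their boundary
  value, and those steps are allowed: with beta' at most p the factors beta' - 1 - p (\<sigma> - r)
  - 2p are negative.\<close>

lemma st_base_nonzero: assumes p: "p \<ge> 1"
  shows "st p (- 1 - int p * (int \<sigma> - 1)) 0 \<sigma> (- 1 - int p * (int \<sigma> - 1) + 2 * int p * int \<sigma>) \<noteq> 0"
proof (induction \<sigma>)
  case 0 then show ?case by (simp add: st_def e0_def)
next
  case (Suc \<sigma>)
  define a where "a = - 1 - int p * int \<sigma>"
  define q where "q = st p a 0 \<sigma> (a + 2 * int p * int \<sigma>)"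
  have a': "a = - 1 - int p * (int \<sigma> - 1) - int p" by (simp add: a_def algebra_simps)
  have "ev (- tw p) q \<noteq> 0"
    unfolding q_def a'
  proof (rule st_nonzero_step[OF p])
    fix beta' r assume r: "1 \<le> beta'" "beta' \<le> p" "1 \<le> r" "r \<le> \<sigma>"
    have "int p * (int \<sigma> - int r) \<ge> 0" using r by simp
    then have "int beta' - 1 - int p * (int \<sigma> - int r) - 2 * int p < 0" using r by linarith
    then have "of_int (int beta' - 1 - int p * (int \<sigma> - int r) - 2 * int p) \<noteq> (0::complex)" by (simp only: of_int_eq_0_iff)
    then show "of_int (int beta' - 1 - int p * (int \<sigma> - int r)) + - tw p \<noteq> 0" by (simp add: tw_def)
  next
    obtain d where d: "st p (- 1 - int p * (int \<sigma> - 1)) 0 \<sigma> (- 1 - int p * (int \<sigma> - 1) + 2 * int p * int \<sigma>) = Cn d"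
      using st_base_const by blast
    then show "ev (- tw p) (st p (- 1 - int p * (int \<sigma> - 1)) 0 \<sigma> (- 1 - int p * (int \<sigma> - 1) + 2 * int p * int \<sigma>)) \<noteq> 0"
      using Suc by simp
  qed
  moreover have "eps p (- int (p * \<sigma>)) q = Cn (ev (- tw p) q)"
  proof (rule eps_top)
    show "vin {1..} q" unfolding q_def by (rule st_vin)
    have "- int \<sigma> * (1 + a) - int p * int \<sigma> * (int \<sigma> - 1) = int (p * \<sigma>)" by (simp add: a_def algebra_simps)
    then show "wd {0} (int (p * \<sigma>)) q" using st_wd[of \<sigma> a p] unfolding q_def by simp
  qed
  moreover have "st p a 0 (Suc \<sigma>) (a + 2 * int p * int (Suc \<sigma>)) = eps p (- int (p * \<sigma>)) q"
  proof -
    have e: "a + 2 * int p * int (Suc \<sigma>) - 2 * int p = a + 2 * int p * int \<sigma>" by (simp add: algebra_simps)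
    have e2: "2 * int p - (a + 2 * int p * int (Suc \<sigma>)) - 0 - 1 = - int (p * \<sigma>)" by (simp add: a_def algebra_simps)
    show ?thesis unfolding st_Suc_right EE_def e e2 q_def ..
  qed
  moreover have "- 1 - int p * (int (Suc \<sigma>) - 1) = a" by (simp add: a_def)
  ultimately show ?case by simp
qed

text \<open>At the point 2pn the factors of the recursion are beta' - 1 + p (2n - \<sigma> + r).
  They are positive because \<sigma> \<le> 2n, so no step of the descent from the boundary value can
  produce a zero.\<close>

theorem ev_st_nonzero:
  assumes p: "p \<ge> 1" and n: "\<sigma> \<le> 2 * n" and a: "a + 1 + int p * (int \<sigma> - 1) \<le> 0"
  shows "ev (of_nat (2 * p * n)) (st p a 0 \<sigma> (a + 2 * int p * int \<sigma>)) \<noteq> 0"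
proof -
  define beta where "beta = nat (- (a + 1 + int p * (int \<sigma> - 1)))"
  have ab: "a = - 1 - int p * (int \<sigma> - 1) - int beta" using a by (simp add: beta_def)
  show ?thesis unfolding ab
  proof (rule st_nonzero_step[OF p])
    fix beta' r assume r: "1 \<le> beta'" "beta' \<le> beta" "1 \<le> r" "r \<le> \<sigma>"
    have "int p * (2 * int n - int \<sigma> + int r) > 0" using r n p by (intro mult_pos_pos) auto
    then have "int beta' - 1 - int p * (int \<sigma> - int r) + 2 * int p * int n > 0" using r by (simp add: algebra_simps)
    then have "of_int (int beta' - 1 - int p * (int \<sigma> - int r) + 2 * int p * int n) \<noteq> (0::complex)" by (simp only: of_int_eq_0_iff)
    then show "of_int (int beta' - 1 - int p * (int \<sigma> - int r)) + of_nat (2 * p * n) \<noteq> (0::complex)" by simp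
  next
    obtain d where d: "st p (- 1 - int p * (int \<sigma> - 1)) 0 \<sigma> (- 1 - int p * (int \<sigma> - 1) + 2 * int p * int \<sigma>) = Cn d"
      using st_base_const by blast
    then show "ev (of_nat (2 * p * n)) (st p (- 1 - int p * (int \<sigma> - 1)) 0 \<sigma> (- 1 - int p * (int \<sigma> - 1) + 2 * int p * int \<sigma>)) \<noteq> 0"
      using st_base_nonzero[OF p, of \<sigma>] by simp
  qed
qed

section \<open>Comparison with the lattice vertex algebra\<close>

definition emb :: "int \<Rightarrow> pol \<Rightarrow> vec" where
  "emb a q = (\<lambda>(a', nu). if a' = a then lkp q nu else 0)"

lemma emb_apply: "emb a q (a', nu) = (if a' = a then lkp q nu else 0)" by (simp add: emb_def)
lemma emb_scale: "vscale c (emb a q) = emb a (Cn c * q)"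
  by (auto simp: vscale_def emb_def fun_eq_iff)
lemma emb_0: "emb a 0 = vzero" by (auto simp: vzero_def emb_def fun_eq_iff)
lemma bv_emb: "bv a nu = emb a (Mo nu)"
  by (auto simp: bv_def emb_def Mo_def lookup_single when_def fun_eq_iff)
lemma ee_emb: "ee a = emb a 1" by (simp add: ee_def bv_emb)
lemma emb_sum: "finite A \<Longrightarrow> emb a (\<Sum>x\<in>A. f x) y = (\<Sum>x\<in>A. emb a (f x) y)"
  by (cases y) (simp add: emb_apply lookup_sum)
lemma shift_emb: "shift b (emb a q) = emb (a + b) q"
  by (auto simp: shift_def emb_def fun_eq_iff)
lemma emb_support: "{x. emb a q x \<noteq> 0} = (\<lambda>nu. (a, nu)) ` pkeys q"
  by (auto simp: emb_def in_keys_iff image_iff split: if_splits)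

definition hop :: "nat \<Rightarrow> int \<Rightarrow> int \<Rightarrow> pol \<Rightarrow> pol" where
  "hop p a m q = (if m < 0 then Xv (nat (- m)) * q else al0 p a (nat m) q)"

lemma hop_add: "hop p a m (q + r) = hop p a m q + hop p a m r"
  by (simp add: hop_def al0_add distrib_left)
lemma hop_Cn_mult: "hop p a m (Cn c * q) = Cn c * hop p a m q"
  by (simp add: hop_def al0_Cn_mult mult.left_commute)
lemma hop_0 [simp]: "hop p a m 0 = 0" by (simp add: hop_def)
lemma hop_sum: "hop p a m (\<Sum>x\<in>A. q x) = (\<Sum>x\<in>A. hop p a m (q x))"
  by (induction A rule: infinite_finite_induct) (auto simp: hop_add)

lemma heis_basis: "(if m < 0 then bv a (nu + sgl (nat (- m)) 1)
     else if m = 0 then vscale (of_int a) (bv a nu)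
     else vscale (of_nat (2 * p * nat m * lkp nu (nat m))) (bv a (nu - sgl (nat m) 1))) = emb a (hop p a m (Mo nu))"
proof -
  have "al p c (Mo nu) = Cn (of_nat (2 * p * c * lkp nu c)) * Mo (nu - sgl c 1)" for c
    by (simp add: al_def Mo_def lext_single rhom_Cn)
  then show ?thesis
    by (auto simp: hop_def al0_def bv_emb emb_scale Mo_add Xv_def Cn_of_int mult.commute simp del: of_nat_mult)
qed

lemma heis_emb: "heis p m (emb a q) = emb a (hop p a m q)"
proof
  fix y
  have "heis p m (emb a q) y = (\<Sum>nu\<in>pkeys q. lkp q nu * emb a (hop p a m (Mo nu)) y)"
    unfolding heis_def lin_def emb_support
    by (subst sum.reindex) (auto simp: inj_on_def emb_apply heis_basis intro!: sum.cong)
  also have "\<dots> = (\<Sum>nu\<in>pkeys q. emb a (hop p a m (Cn (lkp q nu) * Mo nu)) y)"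
    by (simp add: hop_Cn_mult emb_scale[symmetric] vscale_def)
  also have "\<dots> = emb a (hop p a m q) y"
    by (subst (2) pol_expand[of q]) (simp add: hop_sum emb_sum sgl_eq)
  finally show "heis p m (emb a q) y = emb a (hop p a m q) y" .
qed

lemma apply_ops_emb: "apply_ops p ops (emb a q) = emb a (foldr (hop p a) ops q)"
  unfolding apply_ops_def by (induction ops) (auto simp: heis_emb)

text \<open>The summand of \<open>Ybasis\<close> for one choice of modes and exponent vectors, as a
  polynomial. There are two charges because annihilation operators act before e_beta and creation
  operators after it.\<close>

definition ybs :: "nat \<Rightarrow> int \<Rightarrow> int \<Rightarrow> int \<Rightarrow> nat list \<Rightarrow> int \<Rightarrow> pol \<Rightarrow> int list \<Rightarrow> mon \<Rightarrow> mon \<Rightarrow> pol" where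
  "ybs p k a a' ns N q cs lam kap =
     (if (\<Sum>i<length ns. - cs ! i - int (ns ! i)) - int (deg lam) + int (deg kap) + k * a = N
      then Cn ((\<Prod>i<length ns. (of_int (- cs ! i - 1) :: complex) gchoose (ns ! i - 1))
                * coe (of_int (- k)) lam * coe (of_int k) kap)
           * foldr (hop p a') (filter (\<lambda>c. c < 0) cs @ map (\<lambda>n. - int n) (factors kap))
                    (foldr (hop p a) (filter (\<lambda>c. 0 \<le> c) cs @ map int (factors lam)) q)
      else 0)"

definition lst :: "nat \<Rightarrow> nat \<Rightarrow> nat list \<Rightarrow> int list set" where
  "lst B D ns = {cs. length cs = length ns \<and> (\<forall>i<length ns. - (int (ns ! i) + int B) \<le> cs ! i \<and> cs ! i \<le> int D)}"

lemma lst_Nil [simp]: "lst B D [] = {[]}" by (auto simp: lst_def)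
lemma lst_Cons: "lst B D (n # ns) = (\<lambda>(c, cs). c # cs) ` ({- (int n + int B)..int D} \<times> lst B D ns)"
proof (intro equalityI subsetI)
  fix cs assume a: "cs \<in> lst B D (n # ns)"
  then obtain c cs' where cs: "cs = c # cs'" by (cases cs) (auto simp: lst_def)
  have "c \<in> {- (int n + int B)..int D}" using a unfolding lst_def cs by force
  moreover have "cs' \<in> lst B D ns" using a unfolding lst_def cs by fastforce
  ultimately show "cs \<in> (\<lambda>(c, cs). c # cs) ` ({- (int n + int B)..int D} \<times> lst B D ns)" using cs by auto
next
  fix cs assume "cs \<in> (\<lambda>(c, cs). c # cs) ` ({- (int n + int B)..int D} \<times> lst B D ns)"
  then show "cs \<in> lst B D (n # ns)" by (auto simp: lst_def nth_Cons split: nat.splits)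
qed
lemma finite_lst: "finite (lst B D ns)"
  by (induction ns) (auto simp: lst_Cons)

lemma Ybasis_emb: "Ybasis p (b, mu) (a, nu) N = emb (a + b)
   (let k = b div (2 * int p); ns = factors mu; D = deg nu; B = nat (N - k * a) + length ns * D + sum_list ns + D
    in \<Sum>cs\<in>lst B D ns. \<Sum>lam\<in>bnd D. \<Sum>kap\<in>bnd B. ybs p k a (a + b) ns N (Mo nu) cs lam kap)"
proof
  fix y
  define k where "k = b div (2 * int p)"
  define ns where "ns = factors mu"
  define D where "D = deg nu"
  define B where "B = nat (N - k * a) + length ns * D + sum_list ns + D"
  have tm: "(if (\<Sum>i<length ns. - cs ! i - int (ns ! i)) - int (deg lam) + int (deg kap) + k * a = N
             then (\<Prod>i<length ns. (of_int (- cs ! i - 1) :: complex) gchoose (ns ! i - 1))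
                * (\<Prod>n\<in>pkeys lam. (of_int (- k) / of_nat n) ^ lkp lam n / fact (lkp lam n))
                * (\<Prod>n\<in>pkeys kap. (of_int k / of_nat n) ^ lkp kap n / fact (lkp kap n))
                * apply_ops p (filter (\<lambda>c. c < 0) cs @ map (\<lambda>n. - int n) (factors kap))
                    (shift b (apply_ops p (filter (\<lambda>c. 0 \<le> c) cs @ map int (factors lam)) (bv a nu))) y
             else 0) = emb (a + b) (ybs p k a (a + b) ns N (Mo nu) cs lam kap) y" for cs lam kap
    unfolding ybs_def coe_def[symmetric] bv_emb apply_ops_emb shift_emb
    by (auto simp: emb_scale[symmetric] vscale_def emb_0 vzero_def)
  have "Ybasis p (b, mu) (a, nu) N y = (\<Sum>(cs, lam, kap)\<in>lst B D ns \<times> bnd D \<times> bnd B. emb (a + b) (ybs p k a (a + b) ns N (Mo nu) cs lam kap) y)"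
    unfolding Ybasis_def prod.case Let_def k_def[symmetric] ns_def[symmetric] D_def[symmetric] B_def[symmetric] lst_def[symmetric] tm ..
  also have "\<dots> = (\<Sum>cs\<in>lst B D ns. \<Sum>lam\<in>bnd D. \<Sum>kap\<in>bnd B. emb (a + b) (ybs p k a (a + b) ns N (Mo nu) cs lam kap) y)"
    by (simp add: sum.cartesian_product[symmetric])
  also have "\<dots> = emb (a + b) (\<Sum>cs\<in>lst B D ns. \<Sum>lam\<in>bnd D. \<Sum>kap\<in>bnd B. ybs p k a (a + b) ns N (Mo nu) cs lam kap) y"
    by (simp add: emb_sum finite_lst finite_bnd)
  finally show "Ybasis p (b, mu) (a, nu) N y = emb (a + b)
   (let k = b div (2 * int p); ns = factors mu; D = deg nu; B = nat (N - k * a) + length ns * D + sum_list ns + D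
    in \<Sum>cs\<in>lst B D ns. \<Sum>lam\<in>bnd D. \<Sum>kap\<in>bnd B. ybs p k a (a + b) ns N (Mo nu) cs lam kap) y"
    unfolding Let_def k_def ns_def D_def B_def .
qed

section \<open>The defining sum of \<open>Ybasis\<close> against the recursion
  \<open>Yl\<close>\<close>

lemma vin_al: assumes "vin A q" shows "vin A (al p c q)"
  unfolding al_def lext_def
proof (intro vin_sum vin_mult vin_Cn)
  fix nu assume "nu \<in> pkeys q"
  then have "pkeys nu \<subseteq> A" using assms by (auto simp: vin_def)
  moreover have "pkeys (nu - sgl c 1) \<subseteq> pkeys nu" by (auto simp: in_keys_iff lookup_sub_single split: if_splits)
  ultimately show "vin A (Mo (nu - sgl c 1))" by (intro vin_Mo) blast
qed
lemma vin_hop: "vin {1..} q \<Longrightarrow> vin {1..} (hop p a m q)"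
  using vin_mult[OF vin_Cn[of "{1..}" "of_int a"], of q]
  by (auto simp: hop_def al0_def Cn_of_int intro!: vin_mult vin_Xv vin_al)
lemma vin_foldr_hop: "vin {1..} q \<Longrightarrow> vin {1..} (foldr (hop p a) ops q)"
  by (induction ops) (auto intro: vin_hop)
lemma vin_ybs: "vin {1..} q \<Longrightarrow> vin {1..} (ybs p k a a' ns N q cs lam kap)"
  unfolding ybs_def by (auto intro!: vin_mult vin_foldr_hop)

lemma foldr_al_mset: "foldr (al p) ns q = fold_mset (al p) q (mset ns)"
proof (induction ns)
  case (Cons n ns)
  interpret comp_fun_commute "al p" by standard (auto simp: al_commute comp_def)
  show ?case using Cons by simp
qed simp

lemma foldr_al_Cn: "ns \<noteq> [] \<Longrightarrow> foldr (al p) ns (Cn c) = 0"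
proof (induction ns)
  case (Cons n ns) then show ?case by (cases ns) auto
qed simp
lemma foldr_al_add: "foldr (al p) ns (q + r) = foldr (al p) ns q + foldr (al p) ns r"
  by (induction ns) (auto simp: al_add)

text \<open>The Leibniz rule for a product of annihilation operators: at most one of them can be
  spent on the single variable \<open>Xv j\<close>, and every occurrence of j in the list may be the
  one.\<close>

lemma foldr_al_mult_eq: "foldr (al p) ns (Xv j * q) = Xv j * foldr (al p) ns q
   + of_nat (2 * p * j * count (mset ns) j) * foldr (al p) (remove1 j ns) q"
proof (induction ns)
  case (Cons n ns)
  have o: "al p n (of_nat c * x) = of_nat c * al p n x" for c x
    using al_of_int[of p n "int c" x] by simp
  show ?case
  proof (cases "n = j")
    case False
    then show ?thesis using Cons by (simp add: al_add al_Xv o del: of_nat_mult)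
  next
    case True
    have "al p j (foldr (al p) (remove1 j ns) q) = foldr (al p) ns q" if "j \<in> set ns"
    proof -
      have "foldr (al p) (j # remove1 j ns) q = foldr (al p) ns q"
        unfolding foldr_al_mset using that by simp
      then show ?thesis by simp
    qed
    then have m: "of_nat (2 * p * j * count (mset ns) j) * al p j (foldr (al p) (remove1 j ns) q) = of_nat (2 * p * j * count (mset ns) j) * foldr (al p) ns q"
      by (cases "j \<in> set ns") (auto simp: count_mset_0_iff simp del: of_nat_mult)
    have "foldr (al p) (j # ns) (Xv j * q) = al p j (Xv j * foldr (al p) ns q + of_nat (2 * p * j * count (mset ns) j) * foldr (al p) (remove1 j ns) q)"
      using Cons by (simp del: of_nat_mult)
    also have "\<dots> = Xv j * al p j (foldr (al p) ns q) + of_nat (2 * p * j) * foldr (al p) ns q + of_nat (2 * p * j * count (mset ns) j) * foldr (al p) ns q"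
      unfolding al_add al_Xv o[unfolded True] m by simp
    also have "\<dots> = Xv j * foldr (al p) (j # ns) q + of_nat (2 * p * j * count (mset (j # ns)) j) * foldr (al p) (remove1 j (j # ns)) q"
      by (simp add: algebra_simps)
    finally show ?thesis unfolding True .
  qed
qed simp

text \<open>The exponential of the commuting derivations - k alpha(n) z^(-n) / n is a ring
  homomorphism, namely the substitution behind \<open>Gm\<close>. In the induction step the
  multiplicity of j in \<open>lam\<close> cancels a factor of the factorial in \<open>coe\<close>,
  and removing one j from \<open>lam\<close> yields the shifted term of
  \<open>Gm_Xv\<close>.\<close>

lemma Gm_expand: "(\<Sum>lam\<in>mons f. Cn (coe (- of_int k) lam) * foldr (al p) (factors lam) q) = Gm p k f q"
proof (induction q arbitrary: f rule: pol_induct)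
  case (const c)
  have "factors lam \<noteq> []" if "lam \<in> mons f" "lam \<noteq> 0" for lam
  proof
    assume "factors lam = []"
    then have "lkp lam n = 0" for n using count_factors[of lam n] by simp
    then have "lam = 0" by (intro poly_mapping_eqI) simp
    then show False using that by simp
  qed
  then have "(\<Sum>lam\<in>mons f. Cn (coe (- of_int k) lam) * foldr (al p) (factors lam) (Cn c)) = (\<Sum>lam\<in>mons f. if lam = 0 then Cn c else 0)"
    by (intro sum.cong) (auto simp: foldr_al_Cn)
  also have "\<dots> = (if 0 \<in> mons f then Cn c else 0)" by simp
  finally show ?case by (auto simp: Gm_Cn mons_def)
next
  case (add q r) then show ?case by (simp add: foldr_al_add Gm_add distrib_left sum.distrib)
next
  case (mult j q)
  let ?D = "\<lambda>lam. foldr (al p) (factors lam)"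
  have "(\<Sum>lam\<in>mons f. Cn (coe (- of_int k) lam) * ?D lam (Xv j * q)) = Xv j * Gm p k f q
     + (\<Sum>lam\<in>mons f. Cn (coe (- of_int k) lam) * (of_nat (2 * p * j * lkp lam j) * foldr (al p) (remove1 j (factors lam)) q))"
    unfolding mult[of f, symmetric] foldr_al_mult_eq count_factors
    by (simp add: distrib_left sum.distrib sum_distrib_left mult.left_commute del: of_nat_mult)
  also have "(\<Sum>lam\<in>mons f. Cn (coe (- of_int k) lam) * (of_nat (2 * p * j * lkp lam j) * foldr (al p) (remove1 j (factors lam)) q))
     = - (if 1 \<le> j \<and> j \<le> f then of_int (2 * int p * k) * Gm p k (f - j) q else 0)"
  proof (cases "1 \<le> j \<and> j \<le> f")
    case False
    have "of_nat (2 * p * j * lkp lam j) = (0::pol)" if "lam \<in> mons f" for lam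
    proof -
      have "j = 0 \<or> lkp lam j = 0"
      proof (rule ccontr)
        assume "\<not> (j = 0 \<or> lkp lam j = 0)"
        then have "j \<in> pkeys lam" "j \<ge> 1" by (auto simp: in_keys_iff)
        then show False using deg_ge'[of j lam] that False by (auto simp: mons_def)
      qed
      then show ?thesis by auto
    qed
    then have "(\<Sum>lam\<in>mons f. Cn (coe (- of_int k) lam) * (of_nat (2 * p * j * lkp lam j) * foldr (al p) (remove1 j (factors lam)) q)) = 0"
      by (intro sum.neutral ballI) (simp only: mult_zero_left mult_zero_right)
    then show ?thesis using False by auto
  next
    case True
    have "(\<Sum>lam\<in>mons f. Cn (coe (- of_int k) lam) * (of_nat (2 * p * j * lkp lam j) * foldr (al p) (remove1 j (factors lam)) q))
      = (\<Sum>lam\<in>{lam \<in> mons f. lkp lam j \<noteq> 0}. Cn (coe (- of_int k) lam) * (of_nat (2 * p * j * lkp lam j) * foldr (al p) (remove1 j (factors lam)) q))"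
      by (intro sum.mono_neutral_right) auto
    also have "\<dots> = (\<Sum>mu\<in>mons (f - j). - (of_int (2 * int p * k) * (Cn (coe (- of_int k) mu) * ?D mu q)))"
    proof (rule sum.reindex_bij_witness[of _ "\<lambda>mu. mu + sgl j 1" "\<lambda>lam. lam - sgl j 1"])
      fix lam assume a: "lam \<in> {lam \<in> mons f. lkp lam j \<noteq> 0}"
      define mu where "mu = lam - sgl j 1"
      have l: "lam = mu + sgl j 1" using a sub_single_add[of lam j] by (simp add: mu_def)
      have c: "coe (- of_int k) lam * of_nat (lkp lam j) = (- of_int k) / of_nat j * coe (- of_int k) mu"
        using coe_add_single[of "- of_int k" mu j] unfolding l by (simp add: lookup_add add.commute)
      have "coe (- of_int k) lam * of_nat (2 * p * j * lkp lam j) = of_nat (2 * p * j) * (coe (- of_int k) lam * of_nat (lkp lam j))" by simp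
      also have "\<dots> = - (of_int (2 * int p * k) * coe (- of_int k) mu)" unfolding c using True by (simp add: field_simps)
      finally have "Cn (coe (- of_int k) lam) * of_nat (2 * p * j * lkp lam j) = - (of_int (2 * int p * k) * Cn (coe (- of_int k) mu))"
        by (simp only: Cn_mult[symmetric] Cn_of_nat[symmetric] Cn_of_int[symmetric] Cn_uminus[symmetric])
      moreover have "foldr (al p) (remove1 j (factors lam)) q = ?D mu q"
        unfolding foldr_al_mset l using mset_factors_add[of mu j] by simp
      ultimately show "- (of_int (2 * int p * k) * (Cn (coe (- of_int k) (lam - sgl j 1)) * ?D (lam - sgl j 1) q))
         = Cn (coe (- of_int k) lam) * (of_nat (2 * p * j * lkp lam j) * foldr (al p) (remove1 j (factors lam)) q)"
        unfolding mu_def[symmetric] by (simp only: mult.assoc[symmetric] mult_minus_left)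
      show "lam - sgl j 1 + sgl j 1 = lam" using l by (simp add: mu_def)
      have "deg lam = deg mu + j" unfolding l deg_add by simp
      moreover have "0 \<notin> pkeys mu" using a True by (auto simp: mu_def mons_def in_keys_iff lookup_sub_single)
      ultimately show "lam - sgl j 1 \<in> mons (f - j)" using a by (auto simp: mons_def mu_def)
    next
      fix mu assume a: "mu \<in> mons (f - j)"
      show "mu + sgl j 1 - sgl j 1 = mu" by simp
      show "mu + sgl j 1 \<in> {lam \<in> mons f. lkp lam j \<noteq> 0}"
        using a True by (auto simp: mons_def deg_add in_keys_iff lookup_add lookup_single when_def)
    qed
    also have "\<dots> = - (of_int (2 * int p * k) * Gm p k (f - j) q)"
      unfolding mult[of "f - j", symmetric] by (simp only: sum_negf sum_distrib_left)
    finally show ?thesis using True by simp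
  qed
  finally show ?case unfolding Gm_Xv by simp
qed

lemma set_factors: "set (factors mu) = pkeys mu"
  by (auto simp: factors_def in_keys_iff)

lemma foldr_hop_neg: "pkeys kap \<subseteq> {1..} \<Longrightarrow> foldr (hop p a) (map (\<lambda>n. - int n) (factors kap)) r = Mo kap * r"
proof -
  have l: "foldr (hop p a) (map (\<lambda>n. - int n) ns) r = prod_mset (image_mset Xv (mset ns)) * r" if "set ns \<subseteq> {1..}" for ns
    using that by (induction ns) (auto simp: hop_def mult.assoc)
  have m: "prod_mset (image_mset Xv (mset (factors kap))) = Mo kap"
    by (induction kap rule: mon_induct_in[OF subset_UNIV]) (simp_all only: mset_factors_add, auto simp: Mo_add Xv_def mult.commute)
  assume "pkeys kap \<subseteq> {1..}"
  then show ?thesis using l[of "factors kap"] by (simp add: set_factors m)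
qed

lemma foldr_hop_pos: "pkeys lam \<subseteq> {1..} \<Longrightarrow> foldr (hop p a) (map int (factors lam)) q = foldr (al p) (factors lam) q"
proof -
  have l: "foldr (hop p a) (map int ns) q = foldr (al p) ns q" if "set ns \<subseteq> {1..}" for ns
    using that by (induction ns) (auto simp: hop_def al0_def)
  assume "pkeys lam \<subseteq> {1..}"
  then show ?thesis using l[of "factors lam"] by (simp add: set_factors)
qed

lemma foldr_hop_commute: "\<forall>x\<in>set xs. 0 \<le> x \<Longrightarrow> foldr (hop p a) xs (al0 p a c q) = al0 p a c (foldr (hop p a) xs q)"
  by (induction xs) (auto simp: hop_def al0_commute)

lemma wd_foldr_al: "wd I d q \<Longrightarrow> wd I (d - int (sum_list ns)) (foldr (al p) ns q)"
proof (induction ns)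
  case (Cons n ns) then show ?case using wd_al[of I "d - int (sum_list ns)" "foldr (al p) ns q" n p] by (simp add: algebra_simps)
qed simp

lemma sum_list_factors: "sum_list (factors mu) = deg mu"
proof -
  have "sum_list ns = sum_mset (mset ns)" for ns :: "nat list" by (induction ns) auto
  moreover have "sum_mset (mset (factors mu)) = deg mu"
    by (induction mu rule: mon_induct_in[OF subset_UNIV]) (simp_all only: mset_factors_add deg_add, auto)
  ultimately show ?thesis by simp
qed

lemma bnd_keys: "lam \<in> bnd D \<Longrightarrow> pkeys lam \<subseteq> {1..}" by (auto simp: bnd_def)

definition TB :: "nat \<Rightarrow> int \<Rightarrow> int \<Rightarrow> int \<Rightarrow> nat \<Rightarrow> nat \<Rightarrow> nat list \<Rightarrow> int \<Rightarrow> pol \<Rightarrow> pol" where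
  "TB p k a a' B D ns N q = (\<Sum>cs\<in>lst B D ns. \<Sum>lam\<in>bnd D. \<Sum>kap\<in>bnd B. ybs p k a a' ns N q cs lam kap)"

text \<open>Only the exponentials are left. For each \<open>lam\<close> the sum over
  \<open>kap\<close> collects into \<open>Sc\<close>, and the sum over all \<open>lam\<close> of one
  degree collects into \<open>Gm\<close> by \<open>Gm_expand\<close>; degrees above \<open>D\<close>
  contribute nothing because they annihilate \<open>q\<close>.\<close>

lemma TB_Nil: assumes D: "vb q \<le> D" and B: "N - k * a + int D \<le> int B"
  shows "TB p k a a' B D [] N q = Yl p k a [] q $$ N"
proof -
  let ?g = "\<lambda>f. N - k * a + int f"
  have t: "ybs p k a a' [] N q [] lam kap = (if int (deg kap) = ?g (deg lam) then Cn (coe (- of_int k) lam) * (Cn (coe (of_int k) kap) * (Mo kap * foldr (al p) (factors lam) q)) else 0)"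
    if "lam \<in> bnd D" "kap \<in> bnd B" for lam kap
    using that by (auto simp: ybs_def foldr_hop_neg[OF bnd_keys] foldr_hop_pos[OF bnd_keys] Cn_mult mult.assoc)
  have kap: "(\<Sum>kap\<in>bnd B. if int (deg kap) = g then Cn (coe (of_int k) kap) * Mo kap else 0) = Sc k g" if "g \<le> int B" for g
  proof (cases "g < 0")
    case True then show ?thesis by (auto intro!: sum.neutral)
  next
    case False
    have "(\<Sum>kap\<in>bnd B. if int (deg kap) = g then Cn (coe (of_int k) kap) * Mo kap else 0) = (\<Sum>kap\<in>mons (nat g). Cn (coe (of_int k) kap) * Mo kap)"
    proof (rule sum.mono_neutral_cong_right)
      show "mons (nat g) \<subseteq> bnd B" using that by (intro mons_bnd) simp
      show "\<forall>i\<in>bnd B - mons (nat g). (if int (deg i) = g then Cn (coe (of_int k) i) * Mo i else 0) = 0"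
        using bnd_keys[of _ B] by (fastforce simp: mons_def)
    qed (use False in \<open>auto simp: finite_bnd mons_def\<close>)
    then show ?thesis using False by (simp add: Sc_def)
  qed
  have "TB p k a a' B D [] N q = (\<Sum>lam\<in>bnd D. \<Sum>kap\<in>bnd B. (if int (deg kap) = ?g (deg lam) then Cn (coe (- of_int k) lam) * (Cn (coe (of_int k) kap) * (Mo kap * foldr (al p) (factors lam) q)) else 0))"
    unfolding TB_def using t by simp
  also have "\<dots> = (\<Sum>lam\<in>bnd D. if deg lam \<le> D then Sc k (?g (deg lam)) * (Cn (coe (- of_int k) lam) * foldr (al p) (factors lam) q) else 0)"
  proof (rule sum.cong[OF refl])
    fix lam assume "lam \<in> bnd D"
    show "(\<Sum>kap\<in>bnd B. (if int (deg kap) = ?g (deg lam) then Cn (coe (- of_int k) lam) * (Cn (coe (of_int k) kap) * (Mo kap * foldr (al p) (factors lam) q)) else 0))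
      = (if deg lam \<le> D then Sc k (?g (deg lam)) * (Cn (coe (- of_int k) lam) * foldr (al p) (factors lam) q) else 0)"
    proof (cases "deg lam \<le> D")
      case True
      have "(\<Sum>kap\<in>bnd B. (if int (deg kap) = ?g (deg lam) then Cn (coe (- of_int k) lam) * (Cn (coe (of_int k) kap) * (Mo kap * foldr (al p) (factors lam) q)) else 0))
        = (\<Sum>kap\<in>bnd B. if int (deg kap) = ?g (deg lam) then Cn (coe (of_int k) kap) * Mo kap else 0) * (Cn (coe (- of_int k) lam) * foldr (al p) (factors lam) q)"
        unfolding sum_distrib_right by (intro sum.cong refl) (auto simp: mult_ac)
      then show ?thesis using True B kap[of "?g (deg lam)"] by simp
    next
      case False
      have "wd {..0} (int (vb q) - int (sum_list (factors lam))) (foldr (al p) (factors lam) q)" by (rule wd_foldr_al[OF wd_vb])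
      then have "foldr (al p) (factors lam) q = 0" using False D by (intro wd_neg) (auto simp: sum_list_factors)
      then show ?thesis using False by (auto intro!: sum.neutral)
    qed
  qed
  also have "\<dots> = (\<Sum>lam\<in>(\<Union>f\<in>{..D}. mons f). Sc k (?g (deg lam)) * (Cn (coe (- of_int k) lam) * foldr (al p) (factors lam) q))"
  proof (rule sum.mono_neutral_cong_right)
    show "(\<Union>f\<in>{..D}. mons f) \<subseteq> bnd D" using mons_bnd by blast
    show "\<forall>lam\<in>bnd D - (\<Union>f\<in>{..D}. mons f). (if deg lam \<le> D then Sc k (?g (deg lam)) * (Cn (coe (- of_int k) lam) * foldr (al p) (factors lam) q) else 0) = 0"
      using bnd_keys[of _ D] by (fastforce simp: mons_def)
  qed (auto simp: finite_bnd mons_def)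
  also have "\<dots> = (\<Sum>f\<le>D. \<Sum>lam\<in>mons f. Sc k (?g (deg lam)) * (Cn (coe (- of_int k) lam) * foldr (al p) (factors lam) q))"
    by (rule sum.UNION_disjoint) (auto simp: mons_def[abs_def] finite_mons[unfolded mons_def])
  also have "\<dots> = (\<Sum>f\<le>D. Sc k (?g f) * Gm p k f q)"
    unfolding Gm_expand[symmetric] sum_distrib_left by (intro sum.cong refl) (auto simp: mons_def)
  also have "\<dots> = (Em k * Ep p k q) $$ (N - k * a)"
  proof -
    have "Em k * Ep p k q = (\<Sum>f\<le>D. fls_const (Gm p k f q) * (zp (- int f) * Em k))"
      unfolding Ep_sum_vb[OF D] sum_distrib_left by (simp only: mult_ac)
    then have "(Em k * Ep p k q) $$ (N - k * a) = (\<Sum>f\<le>D. (fls_const (Gm p k f q) * (zp (- int f) * Em k)) $$ (N - k * a))"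
      by (simp only: fls_nth_sum)
    then show ?thesis unfolding fls_const_mult_nth zp_mult_nth by (simp add: mult.commute[of "Gm _ _ _ _"])
  qed
  finally show ?thesis by simp
qed

lemma ybs_Cons: "ybs p k a a' (n # ns) N q (c # cs) lam kap = Cn ((of_int (- c - 1)) gchoose (n - 1)) *
   (if c < 0 then Xv (nat (- c)) * ybs p k a a' ns (N + c + int n) q cs lam kap
    else ybs p k a a' ns (N + c + int n) (al0 p a (nat c) q) cs lam kap)"
proof -
  have s: "(\<Sum>i<length (n # ns). - (c # cs) ! i - int ((n # ns) ! i)) = - c - int n + (\<Sum>i<length ns. - cs ! i - int (ns ! i))"
    by (simp add: sum.lessThan_Suc_shift del: sum.lessThan_Suc)
  have pr: "(\<Prod>i<length (n # ns). (of_int (- (c # cs) ! i - 1) :: complex) gchoose ((n # ns) ! i - 1)) = ((of_int (- c - 1)) gchoose (n - 1)) * (\<Prod>i<length ns. (of_int (- cs ! i - 1)) gchoose (ns ! i - 1))"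
    by (simp add: prod.lessThan_Suc_shift del: prod.lessThan_Suc)
  have cond: "(- c - int n + S) - x + y + z = N \<longleftrightarrow> S - x + y + z = N + c + int n" for S x y z by auto
  have cm: "foldr (hop p a) (filter (\<lambda>c. 0 \<le> c) cs @ map int (factors lam)) (al0 p a (nat c) q) = al0 p a (nat c) (foldr (hop p a) (filter (\<lambda>c. 0 \<le> c) cs @ map int (factors lam)) q)"
    by (rule foldr_hop_commute) auto
  show ?thesis
  proof (cases "c < 0")
    case True
    then show ?thesis unfolding ybs_def s pr cond by (simp add: hop_def Cn_mult mult_ac)
  next
    case False
    then show ?thesis unfolding ybs_def s pr cond cm by (simp add: hop_def Cn_mult mult_ac)
  qed
qed

lemma TB_Cons: "TB p k a a' B D (n # ns) N q = (\<Sum>c\<in>{- (int n + int B)..int D}. Cn ((of_int (- c - 1)) gchoose (n - 1)) *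
   (if c < 0 then Xv (nat (- c)) * TB p k a a' B D ns (N + c + int n) q
    else TB p k a a' B D ns (N + c + int n) (al0 p a (nat c) q)))"
proof -
  have "TB p k a a' B D (n # ns) N q = (\<Sum>(c, cs)\<in>{- (int n + int B)..int D} \<times> lst B D ns. \<Sum>lam\<in>bnd D. \<Sum>kap\<in>bnd B. ybs p k a a' (n # ns) N q (c # cs) lam kap)"
    unfolding TB_def lst_Cons by (subst sum.reindex) (auto simp: inj_on_def case_prod_unfold)
  also have "\<dots> = (\<Sum>c\<in>{- (int n + int B)..int D}. \<Sum>cs\<in>lst B D ns. \<Sum>lam\<in>bnd D. \<Sum>kap\<in>bnd B. ybs p k a a' (n # ns) N q (c # cs) lam kap)"
    by (simp only: sum.cartesian_product[symmetric])
  also have "\<dots> = (\<Sum>c\<in>{- (int n + int B)..int D}. Cn ((of_int (- c - 1)) gchoose (n - 1)) *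
   (if c < 0 then Xv (nat (- c)) * TB p k a a' B D ns (N + c + int n) q
    else TB p k a a' B D ns (N + c + int n) (al0 p a (nat c) q)))"
    by (rule sum.cong[OF refl]) (simp add: ybs_Cons TB_def sum_distrib_left)
  finally show ?thesis .
qed

lemma Yl_Cons_nth: assumes "vb q \<le> D"
  shows "Yl p k a (n # ns) q $$ x = (Af n * Yl p k a ns q) $$ x + (\<Sum>c\<le>D. Cn (kp n c) * Yl p k a ns (al0 p a c q) $$ (x + int (c + n)))"
  unfolding Yl_Cons[OF assms] fls_plus_nth fls_nth_sum kc_mult_nth zp_mult_nth diff_minus_eq_add ..

text \<open>A bound for the order of the pole: the exponential reaches at most D below k a, and each
  factor alpha(-n) adds at most D + n. The bound B in \<open>Ybasis\<close> is made from these
  numbers.\<close>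

lemma Yl_lower: "vb q \<le> D \<Longrightarrow> x < k * a - int (length ns * D + sum_list ns + D) \<Longrightarrow> Yl p k a ns q $$ x = 0"
proof (induction ns arbitrary: q x)
  case Nil
  have "(Em k * Ep p k q) $$ (x - k * a) = (\<Sum>j\<in>{0..x - k * a - (- int D)}. Em k $$ j * Ep p k q $$ (x - k * a - j))"
  proof (rule fls_times_nth_lb)
    fix n assume "n < - int D" then show "Ep p k q $$ n = 0" using Nil by (auto simp: Ep_nth Gm_zero)
  qed simp
  then show ?case using Nil by simp
next
  case (Cons n ns)
  define l where "l = k * a - int (length ns * D + sum_list ns + D)"
  have IH: "Yl p k a ns q' $$ y = 0" if "vb q' \<le> D" "y < l" for q' y using Cons.IH that by (simp add: l_def)
  have "(Af n * Yl p k a ns q) $$ x = (\<Sum>j\<in>{0..x - l}. Af n $$ j * Yl p k a ns q $$ (x - j))"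
    by (rule fls_times_nth_lb) (auto simp: Af_nth IH Cons.prems)
  then have 1: "(Af n * Yl p k a ns q) $$ x = 0" using Cons.prems by (simp add: l_def)
  have 2: "Yl p k a ns (al0 p a c q) $$ (x + int (c + n)) = 0" if "c \<le> D" for c
    using that Cons.prems vb_al0[of p a c q] by (intro IH) (auto simp: l_def)
  show ?case unfolding Yl_Cons_nth[OF Cons.prems(1)] using 1 2 by simp
qed

text \<open>The same B and D serve for the whole list: removing the head n with mode c replaces N by
  N + c + n, and since c \<le> D this is compensated by the loss of D + n in the bound.\<close>

lemma TB_Yl: assumes "vb q \<le> D" "\<forall>n\<in>set ns. n \<ge> 1" "N - k * a + int (length ns * D + sum_list ns + D) \<le> int B"
  shows "TB p k a a' B D ns N q = Yl p k a ns q $$ N"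
  using assms
proof (induction ns arbitrary: q N)
  case Nil then show ?case by (intro TB_Nil) auto
next
  case (Cons n ns)
  have n: "n \<ge> 1" using Cons.prems by simp
  let ?G = "\<lambda>c. Cn ((of_int (- c - 1)) gchoose (n - 1)) *
   (if c < 0 then Xv (nat (- c)) * TB p k a a' B D ns (N + c + int n) q
    else TB p k a a' B D ns (N + c + int n) (al0 p a (nat c) q))"
  have neg: "sum ?G {- (int n + int B)..-1} = (Af n * Yl p k a ns q) $$ N"
  proof -
    have "(Af n * Yl p k a ns q) $$ N = (\<Sum>j\<in>{0..N - (N - int B)}. Af n $$ j * Yl p k a ns q $$ (N - j))"
    proof (rule fls_times_nth_lb)
      fix x assume "x < N - int B"
      then show "Yl p k a ns q $$ x = 0" using Cons.prems by (intro Yl_lower[OF Cons.prems(1)]) auto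
    qed (simp add: Af_nth)
    also have "\<dots> = sum ?G {- (int n + int B)..- int n}"
    proof (rule sum.reindex_bij_witness[of _ "\<lambda>c. - c - int n" "\<lambda>j. - (j + int n)"])
      fix j assume j: "j \<in> {0..N - (N - int B)}"
      define c where "c = - (j + int n)"
      have c0: "c < 0" using j n by (simp add: c_def)
      have nc: "nat (- c) = nat j + n" using j by (simp add: c_def nat_add_distrib)
      have e: "- c - 1 = int (nat j + n - 1)" using j n by (simp add: c_def of_nat_diff)
      have "(of_int (- c - 1) :: complex) gchoose (n - 1) = of_nat ((nat j + n - 1) choose (n - 1))"
        unfolding e by (simp add: binomial_gbinomial)
      moreover have "TB p k a a' B D ns (N + c + int n) q = Yl p k a ns q $$ (N - j)"
        using Cons.IH[of q "N + c + int n"] Cons.prems j by (simp add: c_def)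
      ultimately show "?G (- (j + int n)) = Af n $$ j * Yl p k a ns q $$ (N - j)"
        unfolding c_def[symmetric] using c0 j by (simp add: nc Af_nth Cn_of_nat mult.assoc)
    qed auto
    also have "\<dots> = sum ?G {- (int n + int B)..-1}"
    proof (rule sum.mono_neutral_left)
      show "\<forall>c\<in>{- (int n + int B)..-1} - {- (int n + int B)..- int n}. ?G c = 0"
      proof
        fix c assume c: "c \<in> {- (int n + int B)..-1} - {- (int n + int B)..- int n}"
        then have e: "- c - 1 = int (nat (- c - 1))" by simp
        have "(of_int (- c - 1) :: complex) gchoose (n - 1) = of_nat (nat (- c - 1) choose (n - 1))"
          by (subst e) (simp add: binomial_gbinomial)
        also have "nat (- c - 1) choose (n - 1) = 0" using c by (intro binomial_eq_0) auto
        finally show "?G c = 0" by simp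
      qed
    qed (use n in auto)
    finally show ?thesis by simp
  qed
  have pos: "sum ?G {0..int D} = (\<Sum>c\<le>D. Cn (kp n c) * Yl p k a ns (al0 p a c q) $$ (N + int (c + n)))"
  proof (rule sum.reindex_bij_witness[of _ int nat])
    fix c assume c: "c \<in> {0..int D}"
    define c' where "c' = nat c"
    have cc: "c = int c'" "c' \<le> D" using c by (auto simp: c'_def)
    have "TB p k a a' B D ns (N + int (c' + n)) (al0 p a c' q) = Yl p k a ns (al0 p a c' q) $$ (N + int (c' + n))"
      using Cons.prems cc vb_al0[of p a c' q] by (intro Cons.IH) auto
    then show "Cn (kp n (nat c)) * Yl p k a ns (al0 p a (nat c) q) $$ (N + int (nat c + n)) = ?G c"
      by (simp add: cc kp_def algebra_simps)
  qed auto
  have "{- (int n + int B)..int D} = {- (int n + int B)..-1} \<union> {0..int D}" using n by auto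
  then have "TB p k a a' B D (n # ns) N q = sum ?G ({- (int n + int B)..-1} \<union> {0..int D})" by (simp only: TB_Cons)
  also have "\<dots> = sum ?G {- (int n + int B)..-1} + sum ?G {0..int D}" by (rule sum.union_disjoint) auto
  finally show ?case unfolding neg pos Yl_Cons_nth[OF Cons.prems(1)] .
qed

lemma Ybasis_Yl: assumes "pkeys mu \<subseteq> {1..}"
  shows "Ybasis p (b, mu) (a, nu) N = emb (a + b) (Yl p (b div (2 * int p)) a (factors mu) (Mo nu) $$ N)"
  unfolding Ybasis_emb Let_def TB_def[symmetric]
  by (subst TB_Yl) (use assms vb_sgl[of nu 1] in \<open>auto simp: set_factors Mo_def\<close>)

section \<open>Components of a vector by charge\<close>

definition fin :: "vec \<Rightarrow> bool" where "fin v \<longleftrightarrow> finite {x. v x \<noteq> 0}"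

text \<open>Meaningful for vectors of finite support, where \<open>lookup_cmp\<close> makes it the
  inverse of \<open>emb\<close> on one charge.\<close>

definition cmp :: "vec \<Rightarrow> int \<Rightarrow> pol" where "cmp v a = Abs_poly_mapping (\<lambda>nu. v (a, nu))"

lemma lookup_cmp: assumes "fin v" shows "lkp (cmp v a) nu = v (a, nu)"
proof -
  have "finite ((\<lambda>nu. (a, nu)) -` {x. v x \<noteq> 0})"
    using assms unfolding fin_def by (intro finite_vimageI) (auto simp: inj_on_def)
  then have "finite {nu. v (a, nu) \<noteq> 0}" by (simp add: vimage_def)
  then show ?thesis by (simp add: cmp_def)
qed

lemma fin_emb: "fin (emb a q)" unfolding fin_def emb_support by simp
lemma cmp_emb: "cmp (emb a q) a' = (if a' = a then q else 0)"
  by (rule poly_mapping_eqI) (auto simp: lookup_cmp[OF fin_emb] emb_apply)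

text \<open>The bridge between the given model and the polynomial one: from here on modes are
  computed through \<open>Yp\<close>, one charge at a time.\<close>

lemma vmode_emb: assumes w: "fin w" and u: "vin {1..} u"
  shows "vmode p (emb b u) n w (a', nu') = lkp (Yp p (b div (2 * int p)) (a' - b) u (cmp w (a' - b)) $$ (- n - 1)) nu'"
proof -
  define k where "k = b div (2 * int p)"
  define a where "a = a' - b"
  define N where "N = - n - 1"
  have keys: "pkeys mu \<subseteq> {1..}" if "mu \<in> pkeys u" for mu using u that by (auto simp: vin_def)
  have "vmode p (emb b u) n w (a', nu') = (\<Sum>mu\<in>pkeys u. \<Sum>x\<in>{x. w x \<noteq> 0}. lkp u mu * w x * Ybasis p (b, mu) x N (a', nu'))"
    unfolding vmode_def Ycoef_def emb_support N_def[symmetric]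
    by (subst sum.reindex) (auto simp: inj_on_def emb_apply)
  also have "\<dots> = (\<Sum>mu\<in>pkeys u. \<Sum>nu\<in>pkeys (cmp w a). lkp u mu * lkp (cmp w a) nu * lkp (Yl p k a (factors mu) (Mo nu) $$ N) nu')"
  proof (rule sum.cong[OF refl])
    fix mu assume mu: "mu \<in> pkeys u"
    have "(\<Sum>x\<in>{x. w x \<noteq> 0}. lkp u mu * w x * Ybasis p (b, mu) x N (a', nu')) = (\<Sum>x\<in>(\<lambda>nu. (a, nu)) ` pkeys (cmp w a). lkp u mu * w x * Ybasis p (b, mu) x N (a', nu'))"
    proof (rule sum.mono_neutral_right)
      show "finite {x. w x \<noteq> 0}" using w by (simp add: fin_def)
      show "(\<lambda>nu. (a, nu)) ` pkeys (cmp w a) \<subseteq> {x. w x \<noteq> 0}" by (auto simp: in_keys_iff lookup_cmp[OF w])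
      show "\<forall>x\<in>{x. w x \<noteq> 0} - (\<lambda>nu. (a, nu)) ` pkeys (cmp w a). lkp u mu * w x * Ybasis p (b, mu) x N (a', nu') = 0"
      proof
        fix x assume x: "x \<in> {x. w x \<noteq> 0} - (\<lambda>nu. (a, nu)) ` pkeys (cmp w a)"
        obtain c nu where xc: "x = (c, nu)" by (cases x)
        have "c \<noteq> a" using x unfolding xc by (auto simp: in_keys_iff lookup_cmp[OF w])
        then show "lkp u mu * w x * Ybasis p (b, mu) x N (a', nu') = 0"
          unfolding xc Ybasis_Yl[OF keys[OF mu]] emb_apply by (simp add: a_def)
      qed
    qed
    also have "\<dots> = (\<Sum>nu\<in>pkeys (cmp w a). lkp u mu * lkp (cmp w a) nu * lkp (Yl p k a (factors mu) (Mo nu) $$ N) nu')"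
      by (subst sum.reindex)
         (auto simp: inj_on_def Ybasis_Yl[OF keys[OF mu]] emb_apply lookup_cmp[OF w] k_def a_def intro!: sum.cong)
    finally show "(\<Sum>x\<in>{x. w x \<noteq> 0}. lkp u mu * w x * Ybasis p (b, mu) x N (a', nu')) = (\<Sum>nu\<in>pkeys (cmp w a). lkp u mu * lkp (cmp w a) nu * lkp (Yl p k a (factors mu) (Mo nu) $$ N) nu')" .
  qed
  also have "\<dots> = lkp (Yp p k a u (cmp w a) $$ N) nu'"
  proof -
    have Y: "Yl p k a (factors mu) (cmp w a) = (\<Sum>nu\<in>pkeys (cmp w a). kc (lkp (cmp w a) nu) * Yl p k a (factors mu) (Mo nu))" for mu
    proof -
      have "Yl p k a ns (\<Sum>nu\<in>A. f nu) = (\<Sum>nu\<in>A. Yl p k a ns (f nu))" for ns A and f :: "mon \<Rightarrow> pol"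
        by (induction A rule: infinite_finite_induct) (auto simp: Yl_add)
      then show ?thesis by (subst pol_expand[of "cmp w a"]) (simp add: sgl_eq Yl_Cn_mult)
    qed
    show ?thesis unfolding Yp_def lext_def Y
      by (simp add: fls_nth_sum lookup_sum sum_distrib_left mult.assoc)
  qed
  finally show ?thesis unfolding k_def a_def N_def .
qed

section \<open>Raising the charge\<close>

lemma vec_eqI: assumes "fin v" "fin w" "\<And>a. cmp v a = cmp w a" shows "v = w"
proof
  fix x show "v x = w x" using lookup_cmp[OF assms(1)] lookup_cmp[OF assms(2)] assms(3) by (cases x) metis
qed

lemma vmode_emb_emb: assumes "vin {1..} u"
  shows "vmode p (emb b u) n (emb a q) = emb (a + b) (Yp p (b div (2 * int p)) a u q $$ (- n - 1))"
proof
  fix y :: "int \<times> mon"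
  obtain a' nu where y: "y = (a', nu)" by (cases y)
  show "vmode p (emb b u) n (emb a q) y = emb (a + b) (Yp p (b div (2 * int p)) a u q $$ (- n - 1)) y"
    unfolding y vmode_emb[OF fin_emb assms] cmp_emb emb_apply by (cases "a' = a + b") auto
qed

lemma Qscr_emb: assumes "p \<ge> 1" shows "Qscr p (emb a q) = emb (a + 2 * int p) (eps p (- 1 - a) q)"
  using assms unfolding Qscr_def ee_emb vmode_emb_emb[OF vin_1] by (simp add: Yp_1 eps_def)

text \<open>The s-fold screening on charge a with the charge stripped off. By \<open>Qi_st\<close>
  its value at 1 is the vector studied in Aomoto's recursion with r = 0.\<close>

primrec Qi :: "nat \<Rightarrow> int \<Rightarrow> nat \<Rightarrow> pol \<Rightarrow> pol" where
  "Qi p a 0 q = q"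
| "Qi p a (Suc s) q = eps p (- 1 - (a + 2 * int p * int s)) (Qi p a s q)"

lemma Qscr_pow: assumes "p \<ge> 1" shows "(Qscr p ^^ s) (emb a q) = emb (a + 2 * int p * int s) (Qi p a s q)"
  by (induction s) (auto simp: Qscr_emb[OF assms] algebra_simps)

lemma Qi_st: "Qi p a s 1 = st p a 0 s (a + 2 * int p * int s)"
proof (induction s)
  case (Suc s)
  have e: "a + 2 * int p * int (Suc s) - 2 * int p = a + 2 * int p * int s" by (simp add: algebra_simps)
  have e2: "2 * int p - (a + 2 * int p * int (Suc s)) - 0 - 1 = - 1 - (a + 2 * int p * int s)" by (simp add: algebra_simps)
  show ?case unfolding st_Suc_right EE_app e e2 by (simp add: Suc)
qed (simp add: st_def e0_def)

lemma Qi_vin: "vin {1..} (Qi p a s 1)" unfolding Qi_st by (rule st_vin)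
lemma Qi_wd: "wd {0} (- int s * (1 + a) - int p * int s * (int s - 1)) (Qi p a s 1)" unfolding Qi_st by (rule st_wd)
text \<open>The iteration of a derivation in abstract form. \<open>F s r\<close> stands for a
  coefficient of Y(Q^s u, z) Q^r w, and \<open>rec\<close> is the derivation rule solved for the
  term with one more Q on u; \<open>E\<close> is Q, whose effect depends on the charge and hence on
  s + r. Only the term with Q^\<sigma> w survives at the bottom, and its coefficients satisfy
  Pascal's rule with alternating signs.\<close>

lemma commutator_expansion:
  fixes F :: "nat \<Rightarrow> nat \<Rightarrow> pol"
  assumes rec: "\<And>s r. F (Suc s) r = E (s + r) (F s r) - F s (Suc r)"
    and E: "\<And>m c q. E m (Cn c * q) = Cn c * E m q" 
    and z: "\<And>j. j \<le> R \<Longrightarrow> j \<noteq> \<sigma> \<Longrightarrow> F 0 j = 0"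
    and Q: "QQ 0 = F 0 \<sigma>" "\<And>t. QQ (Suc t) = E (\<sigma> + t) (QQ t)"
  shows "s + r \<le> R \<Longrightarrow> F s r = (if r \<le> \<sigma> \<and> \<sigma> \<le> s + r then Cn ((-1) ^ (\<sigma> - r) * of_nat (s choose (\<sigma> - r))) * QQ (s + r - \<sigma>) else 0)"
proof (induction s arbitrary: r)
  case 0
  then show ?case using z[of r] Q(1) by (cases "r = \<sigma>") auto
next
  case (Suc s)
  have E0: "E m 0 = 0" for m using E[of m 0 0] by simp
  \<comment> \<open>From \<open>F (Suc s) r\<close> the recursion descends to the values
    \<open>F 0 j\<close> with j between r and s + r + 1. The cases are the positions of \<sigma>
    relative to this window and its two ends, where one of the two terms of Pascal's rule is
    missing.\<close>
  consider "r > \<sigma>" | "r = \<sigma>" | "r < \<sigma>" "\<sigma> \<le> s + r" | "r < \<sigma>" "\<sigma> = Suc (s + r)" | "\<sigma> > Suc (s + r)" by linarith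
  then show ?case
  proof cases
    case 1 then show ?thesis using Suc by (simp add: rec E0)
  next
    case 2
    then have "F s r = QQ s" "F s (Suc r) = 0" using Suc.IH[of r] Suc.IH[of "Suc r"] Suc.prems by auto
    then show ?thesis using 2 Q(2)[of s] by (simp add: rec add.commute)
  next
    case 3
    define d where "d = \<sigma> - Suc r"
    have d: "\<sigma> - r = Suc d" using 3 by (simp add: d_def)
    have t: "\<sigma> + (s + r - \<sigma>) = s + r" "s + Suc r - \<sigma> = Suc (s + r - \<sigma>)" "Suc s + r - \<sigma> = Suc (s + r - \<sigma>)" using 3 by auto
    have "F s r = Cn ((-1) ^ Suc d * of_nat (s choose Suc d)) * QQ (s + r - \<sigma>)"
      using Suc.IH[of r] Suc.prems 3 d by simp
    then have A: "E (s + r) (F s r) = Cn ((-1) ^ Suc d * of_nat (s choose Suc d)) * QQ (Suc (s + r - \<sigma>))"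
      using Q(2)[of "s + r - \<sigma>"] unfolding t by (simp only: E)
    have B: "F s (Suc r) = Cn ((-1) ^ d * of_nat (s choose d)) * QQ (Suc (s + r - \<sigma>))"
      using Suc.IH[of "Suc r"] Suc.prems 3 unfolding t d_def by simp
    have "F (Suc s) r = Cn ((-1) ^ Suc d * of_nat (s choose Suc d) - (-1) ^ d * of_nat (s choose d)) * QQ (Suc (s + r - \<sigma>))"
      unfolding rec A B Cn_diff left_diff_distrib ..
    also have "(-1) ^ Suc d * of_nat (s choose Suc d) - (-1) ^ d * of_nat (s choose d) = ((-1) ^ Suc d * of_nat (Suc s choose Suc d) :: complex)"
      by (simp add: algebra_simps)
    finally show ?thesis using 3 unfolding d t by simp
  next
    case 4
    have "F s r = 0" using Suc.IH[of r] Suc.prems 4 by simp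
    moreover have "F s (Suc r) = Cn ((-1) ^ s) * QQ 0" using Suc.IH[of "Suc r"] Suc.prems 4 by simp
    ultimately show ?thesis using 4 by (simp add: rec E0 Cn_uminus)
  next
    case 5
    then have "F s r = 0" "F s (Suc r) = 0" using Suc.IH[of r] Suc.IH[of "Suc r"] Suc.prems by auto
    then show ?thesis using 5 by (simp add: rec E0)
  qed
qed

text \<open>The counterpart of \<open>eps\<close> for e^(k alpha), used for the vectors e^(-n alpha)
  that lower the charge.\<close>

definition lo :: "nat \<Rightarrow> int \<Rightarrow> int \<Rightarrow> pol \<Rightarrow> pol" where "lo p k t q = (Em k * Ep p k q) $$ t"

lemma lo_sum: assumes "vb q \<le> F" shows "lo p k t q = (\<Sum>f\<le>F. Sc k (t + int f) * Gm p k f q)"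
proof -
  have "Em k * Ep p k q = (\<Sum>f\<le>F. fls_const (Gm p k f q) * (zp (- int f) * Em k))"
    unfolding Ep_sum_vb[OF assms] sum_distrib_left by (simp only: mult_ac)
  then have "lo p k t q = (\<Sum>f\<le>F. (fls_const (Gm p k f q) * (zp (- int f) * Em k)) $$ t)"
    by (simp only: lo_def fls_nth_sum)
  then show ?thesis unfolding fls_const_mult_nth zp_mult_nth by (simp add: mult.commute[of "Gm _ _ _ _"])
qed

lemma wd_lo: assumes "wd I d q" shows "wd I (d + t) (lo p k t q)"
proof -
  have "wd I (d + t) (Sc k (t + int f) * Gm p k f q)" for f
    using wd_mult[OF wd_Sc[of "t + int f" k] wd_Gm[OF assms, of f p k]] by simp
  then show ?thesis unfolding lo_sum[OF order_refl] by (intro wd_sum)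
qed

lemma lo_top: assumes "\<And>f'. f' > f \<Longrightarrow> Gm p k f' q = 0" shows "lo p k (- int f) q = Gm p k f q"
proof -
  have "lo p k (- int f) q = (\<Sum>f'\<le>max f (vb q). Sc k (- int f + int f') * Gm p k f' q)" by (rule lo_sum) simp
  also have "\<dots> = (\<Sum>f'\<le>max f (vb q). if f' = f then Gm p k f q else 0)"
  proof (rule sum.cong[OF refl])
    fix f'
    show "Sc k (- int f + int f') * Gm p k f' q = (if f' = f then Gm p k f q else 0)"
      using assms[of f'] by (cases f' f rule: linorder_cases) auto
  qed
  finally show ?thesis by simp
qed

lemma lo_0 [simp]: "lo p k t 0 = 0" by (simp add: lo_def)
lemma lo_Cn: "lo p k 0 (Cn c) = Cn c" using lo_top[of 0 p k "Cn c"] by (simp add: Gm_Cn)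

lemma vmode_ee: assumes "fin w" "p \<ge> 1"
  shows "vmode p (ee (2 * int p * k)) n w (a', nu') = lkp (lo p k (- n - 1 - k * (a' - 2 * int p * k)) (cmp w (a' - 2 * int p * k))) nu'"
  using assms(2) unfolding ee_emb vmode_emb[OF assms(1) vin_1] by (simp add: Yp_1 lo_def)

text \<open>Condition \<open>C\<close> puts the starting charge at or below the boundary value for
  \<sigma> screenings, so that Q^\<sigma> e^(a0) has nonnegative degree and
  \<open>ev_st_nonzero\<close> applies. Condition \<open>S\<close> disposes of the indices above
  \<sigma>: either none occurs up to 2n, or the higher powers of Q vanish on the starting vector for
  reasons of degree. The number \<open>b1\<close> is the charge reached by e^(-n alpha) from
  Q^\<sigma> e^(a0).\<close>

theorem raising:
  assumes p: "p \<ge> 1" and n: "\<sigma> \<le> 2 * n" and C: "a0 + 1 + int p * (int \<sigma> - 1) \<le> 0"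
    and S: "\<sigma> = 2 * n \<or> - (1 + a0) - int p * int \<sigma> < 0"
    and b1: "b1 = a0 - 2 * int p * int n + 2 * int p * int \<sigma>"
  shows "\<exists>c m. c \<noteq> 0 \<and> vmode p ((Qscr p ^^ (2 * n)) (ee (- 2 * int p * int n))) m (ee a0)
     = vscale c ((Qscr p ^^ (2 * n - \<sigma>)) (ee b1))"
proof -
  define b where "b = - 2 * int p * int n"
  define x0 where "x0 = a0 + b"
  define d where "d = (\<lambda>j::nat. - int j * (1 + a0) - int p * int j * (int j - 1))"
  \<comment> \<open>The exponent at which the term with j = \<sigma> has degree exactly 0, so that
    only the last coefficient of E^+ remains. The product with n is the exponent of z^(beta(0)) for
    beta = -n alpha.\<close>
  define M where "M = - d \<sigma> - int n * (a0 + 2 * int p * int \<sigma>)"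
  define F where "F = (\<lambda>s r. Yp p (int s - int n) (a0 + 2 * int p * int r) (Qi p b s 1) (Qi p a0 r 1) $$ M)"
  define E where "E = (\<lambda>m. eps p (- 1 - (x0 + 2 * int p * int m)))"
  have rec: "F (Suc s) r = E (s + r) (F s r) - F s (Suc r)" for s r
  proof -
    define k where "k = int s - int n"
    define a where "a = a0 + 2 * int p * int r"
    have e: "- 1 - (x0 + 2 * int p * int (s + r)) = - 1 - (a + 2 * int p * k)" "int (Suc s) - int n = k + 1"
       "a0 + 2 * int p * int (Suc r) = a + 2 * int p" "- 1 - (b + 2 * int p * int s) = - 1 - 2 * int p * k"
      by (simp_all add: x0_def a_def k_def b_def algebra_simps)
    have "E (s + r) (F s r) = F (Suc s) r + F s (Suc r)"
      using eps_derivation[OF Qi_vin[of p b s], of p a k "Qi p a0 r 1" M]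
      unfolding E_def F_def Qi.simps e k_def[symmetric] a_def[symmetric] .
    then show ?thesis by simp
  qed
  have F0: "F 0 j = lo p (- int n) (M + int n * (a0 + 2 * int p * int j)) (Qi p a0 j 1)" for j
    by (simp add: F_def Yp_1 lo_def)
  have neg: "F 0 j = 0" if "j \<le> 2 * n" "j \<noteq> \<sigma>" for j
  proof (cases "j < \<sigma>")
    case True
    have "wd {0} (d j + (M + int n * (a0 + 2 * int p * int j))) (F 0 j)"
      unfolding F0 d_def by (rule wd_lo[OF Qi_wd])
    moreover have "d j + (M + int n * (a0 + 2 * int p * int j)) < 0"
    proof -
      \<comment> \<open>The degree is a quadratic polynomial in j that vanishes at \<sigma>. The
        cofactor of j - \<sigma> is positive by \<open>C\<close> and j < \<sigma> \<le> 2n, so terms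
        below \<sigma> have negative degree.\<close>
      have e: "d j + (M + int n * (a0 + 2 * int p * int j)) = (int j - int \<sigma>) * (- (1 + a0) - int p * (int j + int \<sigma> - 1) + 2 * int p * int n)"
        by (simp add: d_def M_def algebra_simps)
      have "int p * (2 * int n - int j) > 0" using p True n by (intro mult_pos_pos) auto
      then have "- (1 + a0) - int p * (int j + int \<sigma> - 1) + 2 * int p * int n > 0" using C by (simp add: algebra_simps)
      then show ?thesis unfolding e using True by (intro mult_neg_pos) auto
    qed
    ultimately show ?thesis by (intro wd_neg) auto
  next
    case False
    then have j: "j > \<sigma>" "\<sigma> \<noteq> 2 * n" using that by auto
    have "wd {0} (d j) (Qi p a0 j 1)" unfolding d_def by (rule Qi_wd)
    moreover have "d j < 0"
    proof -
      have "int p * (int \<sigma>) \<le> int p * (int j - 1)" using j by (intro mult_left_mono) auto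
      then have "- (1 + a0) - int p * (int j - 1) < 0" using S j by linarith
      then have "int j * (- (1 + a0) - int p * (int j - 1)) < 0" using j by (intro mult_pos_neg) auto
      then show ?thesis by (simp add: d_def algebra_simps)
    qed
    ultimately have "Qi p a0 j 1 = 0" by (intro wd_neg) auto
    then show ?thesis by (simp add: F0)
  qed
  define c0 where "c0 = ev (of_nat (2 * p * n)) (Qi p a0 \<sigma> 1)"
  have c0: "c0 \<noteq> 0" unfolding c0_def Qi_st by (rule ev_st_nonzero[OF p n C])
  have top: "F 0 \<sigma> = Cn c0"
  proof -
    have d0: "d \<sigma> \<ge> 0"
    proof -
      have "int \<sigma> * (- (1 + a0) - int p * (int \<sigma> - 1)) \<ge> 0" using C by (intro mult_nonneg_nonneg) auto
      then show ?thesis by (simp add: d_def algebra_simps)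
    qed
    have w: "wd {0} (int (nat (d \<sigma>))) (Qi p a0 \<sigma> 1)" using Qi_wd[of \<sigma> a0 p] d0 by (simp add: d_def)
    have "F 0 \<sigma> = lo p (- int n) (- int (nat (d \<sigma>))) (Qi p a0 \<sigma> 1)" using d0 by (simp add: F0 M_def)
    also have "\<dots> = Gm p (- int n) (nat (d \<sigma>)) (Qi p a0 \<sigma> 1)"
    proof (rule lo_top)
      fix f' assume "f' > nat (d \<sigma>)"
      then show "Gm p (- int n) f' (Qi p a0 \<sigma> 1) = 0"
        by (intro wd_neg[OF wd_Gm[OF w]]) auto
    qed
    also have "\<dots> = Cn c0" using Gm_top[OF Qi_vin w, of p "- int n"] by (simp add: c0_def)
    finally show ?thesis .
  qed
  have QQ: "Cn c0 * Qi p b1 (Suc t) 1 = E (\<sigma> + t) (Cn c0 * Qi p b1 t 1)" for t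
  proof -
    have "- 1 - (x0 + 2 * int p * int (\<sigma> + t)) = - 1 - (b1 + 2 * int p * int t)" by (simp add: x0_def b_def b1 algebra_simps)
    then show ?thesis by (simp only: E_def eps_Cn_mult Qi.simps)
  qed
  have main: "F (2 * n) 0 = Cn ((-1) ^ \<sigma> * of_nat ((2 * n) choose \<sigma>)) * (Cn c0 * Qi p b1 (2 * n - \<sigma>) 1)"
    using commutator_expansion[of F E "2 * n" \<sigma> "\<lambda>t. Cn c0 * Qi p b1 t 1", OF rec _ neg _ QQ, of "2 * n" 0] n top
    by (simp add: E_def eps_Cn_mult)
  define c where "c = ((-1) ^ \<sigma> * of_nat ((2 * n) choose \<sigma>)) * c0"
  have "c \<noteq> 0" using c0 n by (simp add: c_def binomial_eq_0_iff)
  have dv: "(b + 2 * int p * int (2 * n)) div (2 * int p) = int n"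
  proof -
    have "b + 2 * int p * int (2 * n) = int n * (2 * int p)" by (simp add: b_def algebra_simps)
    then have "(b + 2 * int p * int (2 * n)) div (2 * int p) = int n * (2 * int p) div (2 * int p)" by (simp only:)
    then show ?thesis using p by simp
  qed
  have "vmode p ((Qscr p ^^ (2 * n)) (ee b)) (- M - 1) (ee a0) = emb (a0 + (b + 2 * int p * int (2 * n))) (F (2 * n) 0)"
    unfolding ee_emb Qscr_pow[OF p] vmode_emb_emb[OF Qi_vin] dv by (simp add: F_def)
  also have "\<dots> = vscale c ((Qscr p ^^ (2 * n - \<sigma>)) (ee b1))"
  proof -
    have "a0 + (b + 2 * int p * int (2 * n)) = b1 + 2 * int p * int (2 * n - \<sigma>)" using n by (simp add: b_def b1 of_nat_diff algebra_simps)
    then show ?thesis unfolding ee_emb Qscr_pow[OF p] emb_scale main c_def by (simp only: Cn_mult mult.assoc)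
  qed
  finally show ?thesis using \<open>c \<noteq> 0\<close> unfolding b_def by blast
qed

section \<open>Irreducibility\<close>

text \<open>The invariant carried through spans and submodules. The type \<open>vec\<close> contains
  functions of infinite support, for which the sums in \<open>Ycoef\<close> do not have their
  intended meaning.\<close>

definition good :: "int set \<Rightarrow> vec \<Rightarrow> bool" where
  "good A w \<longleftrightarrow> fin w \<and> (\<forall>a nu. w (a, nu) \<noteq> 0 \<longrightarrow> 0 \<notin> pkeys nu \<and> a \<in> A)"

lemma goodD: assumes "good A w"
  shows "fin w" "vin {1..} (cmp w a)" "a \<notin> A \<Longrightarrow> cmp w a = 0"
proof -
  show f: "fin w" using assms by (simp add: good_def)
  show "vin {1..} (cmp w a)" unfolding vin_def
  proof
    fix nu assume "nu \<in> pkeys (cmp w a)"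
    then have "0 \<notin> pkeys nu" using assms by (auto simp: good_def in_keys_iff lookup_cmp[OF f])
    then show "pkeys nu \<subseteq> {1..}" by (metis One_nat_def Suc_le_eq atLeast_iff gr0I subsetI)
  qed
  show "a \<notin> A \<Longrightarrow> cmp w a = 0"
    using assms by (intro poly_mapping_eqI) (auto simp: good_def lookup_cmp[OF f])
qed

lemma good_zero: "good A vzero" by (simp add: good_def fin_def vzero_def)

lemma good_add: assumes "good A v" "good A w" shows "good A (vadd v w)"
proof -
  have "{x. vadd v w x \<noteq> 0} \<subseteq> {x. v x \<noteq> 0} \<union> {x. w x \<noteq> 0}" by (auto simp: vadd_def)
  then have "fin (vadd v w)" using assms finite_subset unfolding good_def fin_def by blast
  moreover have "v (a, nu) \<noteq> 0 \<or> w (a, nu) \<noteq> 0" if "vadd v w (a, nu) \<noteq> 0" for a nu using that by (auto simp: vadd_def)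
  ultimately show ?thesis using assms unfolding good_def by blast
qed

lemma good_scale: assumes "good A v" shows "good A (vscale c v)"
proof -
  have "{x. vscale c v x \<noteq> 0} \<subseteq> {x. v x \<noteq> 0}" by (auto simp: vscale_def)
  then show ?thesis using assms finite_subset unfolding good_def fin_def by (auto simp: vscale_def)
qed

lemma good_emb: assumes "vin {1..} q" "a \<in> A" shows "good A (emb a q)"
  using assms fin_emb[of a q] unfolding good_def vin_def emb_apply
  by (auto simp: in_keys_iff split: if_splits) (metis atLeast_iff in_keys_iff not_one_le_zero subsetD)

lemma good_sum: assumes "finite I" "\<And>i. i \<in> I \<Longrightarrow> good A (f i)" shows "good A (\<lambda>y. \<Sum>i\<in>I. c i * f i y)"
  using assms
proof (induction I rule: finite_induct)
  case empty then show ?case using good_zero by (simp add: vzero_def)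
next
  case (insert i I)
  have "(\<lambda>y. \<Sum>i\<in>insert i I. c i * f i y) = vadd (vscale (c i) (f i)) (\<lambda>y. \<Sum>i\<in>I. c i * f i y)"
    using insert by (auto simp: vadd_def vscale_def)
  then show ?case using insert by (simp add: good_add good_scale)
qed

lemma good_vmode:
  assumes w: "good A w" and u: "\<And>b mu a. u (b, mu) \<noteq> 0 \<Longrightarrow> a \<in> A \<Longrightarrow> a + b \<in> A"
  shows "good A (vmode p u n w)"
proof (cases "fin u")
  case False
  \<comment> \<open>A sum over an infinite set is 0 by convention.\<close>
  then have "vmode p u n w = vzero" by (auto simp: vmode_def Ycoef_def vzero_def fin_def)
  then show ?thesis using good_zero by simp
next
  case True
  have fw: "finite {x. w x \<noteq> 0}" using w by (simp add: good_def fin_def)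
  have "good A (\<lambda>y. \<Sum>(x, x')\<in>{x. u x \<noteq> 0} \<times> {x. w x \<noteq> 0}. (u x * w x') * Ybasis p x x' (- n - 1) y)"
    unfolding case_prod_unfold
  proof (rule good_sum)
    show "finite ({x. u x \<noteq> 0} \<times> {x. w x \<noteq> 0})" using True fw by (simp add: fin_def)
    fix z assume "z \<in> {x. u x \<noteq> 0} \<times> {x. w x \<noteq> 0}"
    then obtain b mu a nu where z: "z = ((b, mu), (a, nu))" "u (b, mu) \<noteq> 0" "w (a, nu) \<noteq> 0" by auto
    then have "0 \<notin> pkeys nu" "a \<in> A" using w by (auto simp: good_def)
    then have "vin {1..} (Mo nu)" "a + b \<in> A" using u z by (auto intro!: vin_Mo simp: Suc_le_eq One_nat_def) (metis gr0I)
    then show "good A (Ybasis p (fst z) (snd z) (- n - 1))"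
      unfolding z(1) fst_conv snd_conv Ybasis_emb Let_def by (intro good_emb vin_sum vin_ybs)
  qed
  also have "(\<lambda>y. \<Sum>(x, x')\<in>{x. u x \<noteq> 0} \<times> {x. w x \<noteq> 0}. (u x * w x') * Ybasis p x x' (- n - 1) y) = vmode p u n w"
    unfolding vmode_def Ycoef_def by (simp add: sum.cartesian_product)
  finally show ?thesis .
qed

lemma good_Qscr: "p \<ge> 1 \<Longrightarrow> a + 2 * int p * int s \<in> A \<Longrightarrow> good A ((Qscr p ^^ s) (ee a))"
  unfolding ee_emb Qscr_pow by (intro good_emb Qi_vin)

lemma triplet_good: assumes "p \<ge> 1" "v \<in> triplet p" shows "good UNIV v"
  using assms(2) unfolding triplet_def
proof (induction rule: vir_span.induct)
  case (base v) then show ?case using good_Qscr[OF assms(1)] by auto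
next
  case (vir v n) then show ?case unfolding Vir_def by (intro good_vmode) auto
qed (auto intro: good_zero good_add good_scale)

lemma tripletA_charge: assumes p: "p \<ge> 1" and m: "m \<ge> 1" and u: "u \<in> tripletA p m" "u (b, mu) \<noteq> 0"
  shows "2 * int p * int m dvd b"
proof -
  have "sigma p m u (b, mu) = u (b, mu)" using u by (simp add: tripletA_def)
  then have "cis (pi * of_int b / (of_nat p * of_nat m)) = 1" using u(2) by (simp add: sigma_def)
  then have "cos (pi * of_int b / (of_nat p * of_nat m)) = 1" by (metis cis.simps(1) one_complex.simps(1))
  then obtain x :: int where "pi * of_int b / (of_nat p * of_nat m) = of_int x * 2 * pi" using cos_one_2pi_int by blast
  then have "of_int b = (of_int x * 2 * (of_nat p * of_nat m) :: real)" using p m by (simp add: field_simps)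
  then have "b = x * 2 * (int p * int m)" by (metis (mono_tags) of_int_eq_iff of_int_mult of_int_numeral of_int_of_nat_eq)
  then show ?thesis by simp
qed

definition cls :: "nat \<Rightarrow> nat \<Rightarrow> int \<Rightarrow> int set" where "cls p m r = {a. 2 * int p * int m dvd a - r}"

lemma good_cls_mode: assumes "p \<ge> 1" "m \<ge> 1" "u \<in> tripletA p m" "good (cls p m r) w"
  shows "good (cls p m r) (vmode p u n w)"
proof (rule good_vmode[OF assms(4)])
  fix b mu a assume "u (b, mu) \<noteq> 0" "a \<in> cls p m r"
  then have "2 * int p * int m dvd b" "2 * int p * int m dvd a - r" using tripletA_charge[OF assms(1-3)] by (auto simp: cls_def)
  then have "2 * int p * int m dvd (a - r) + b" by (rule dvd_add[rotated])
  then show "a + b \<in> cls p m r" by (simp add: cls_def algebra_simps)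
qed

lemma sigma_emb: assumes "p \<ge> 1" "m \<ge> 1" "2 * int p * int m dvd a" shows "sigma p m (emb a q) = emb a q"
proof
  fix y
  obtain x where x: "a = 2 * int p * int m * x" using assms(3) by (auto elim: dvdE)
  have "pi * of_int a / (of_nat p * of_nat m) = 2 * pi * of_int x" using assms(1,2) by (simp add: x field_simps)
  then have "cis (pi * of_int a / (of_nat p * of_nat m)) = 1" by (simp add: cis_multiple_2pi)
  then show "sigma p m (emb a q) y = emb a q y" by (cases y) (auto simp: sigma_def emb_apply)
qed

text \<open>The vector Q^i e^(-n alpha) has charge (i - n) alpha, and \<open>sigma\<close> acts on
  it by a root of unity that is 1 exactly when m divides i - n.\<close>

lemma tripletA_gen: assumes "p \<ge> 1" "m \<ge> 1" "i \<le> 2 * n" "int m dvd int i - int n"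
  shows "(Qscr p ^^ i) (ee (- 2 * int p * int n)) \<in> tripletA p m"
proof -
  have "(Qscr p ^^ i) (ee (- 2 * int p * int n)) \<in> triplet p"
    unfolding triplet_def using assms(3) by (intro vir_span.base) blast
  moreover have "sigma p m ((Qscr p ^^ i) (ee (- 2 * int p * int n))) = (Qscr p ^^ i) (ee (- 2 * int p * int n))"
    unfolding ee_emb Qscr_pow[OF assms(1)]
  proof (rule sigma_emb[OF assms(1,2)])
    have "- 2 * int p * int n + 2 * int p * int i = 2 * int p * (int i - int n)" by (simp add: algebra_simps)
    then show "2 * int p * int m dvd - 2 * int p * int n + 2 * int p * int i" using assms(4) by (simp add: mult_dvd_mono)
  qed
  ultimately show ?thesis by (simp add: tripletA_def)
qed

lemma al_all_zero: assumes "p \<ge> 1" "vin {1..} q" "\<And>c. c \<ge> 1 \<Longrightarrow> al p c q = 0" shows "q = Cn (lkp q 0)"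
proof -
  have L: "lkp (al p c q) nu = of_nat (2 * p * c * (lkp nu c + 1)) * lkp q (nu + sgl c 1)" for c nu
  proof (induction q rule: pol_add_induct)
    case (single mu d)
    have "al p c (sgl mu d) = sgl (mu - sgl c 1) (d * of_nat (2 * p * c * lkp mu c))"
      by (simp add: al_def lext_single rhom_Cn Mo_def Cn_mult_single Cn_mult[symmetric] mult.assoc[symmetric])
    moreover have "mu - sgl c 1 = nu \<longleftrightarrow> mu = nu + sgl c 1" if "lkp mu c \<noteq> 0"
      using sub_single_add[OF that] by auto
    ultimately show ?case by (cases "lkp mu c = 0") (auto simp: lookup_single when_def lookup_add)
  next
    case (add q r) then show ?case by (simp add: al_add lookup_add distrib_left)
  qed
  have "lkp q nu = 0" if "nu \<noteq> 0" for nu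
  proof (rule ccontr)
    assume a: "lkp q nu \<noteq> 0"
    obtain c where c: "c \<in> pkeys nu" using \<open>nu \<noteq> 0\<close> by (metis all_not_in_conv keys_eq_empty)
    have "nu \<in> pkeys q" using a by (simp add: in_keys_iff)
    then have c1: "c \<ge> 1" using assms(2) c by (auto simp: vin_def)
    have "lkp nu c \<noteq> 0" using c by (simp add: in_keys_iff)
    then have e: "lkp (al p c q) (nu - sgl c 1) = of_nat (2 * p * c * (lkp (nu - sgl c 1) c + 1)) * lkp q nu"
      using L[of c "nu - sgl c 1"] sub_single_add[of nu c] by simp
    have nz: "of_nat (2 * p * c * (lkp (nu - sgl c 1) c + 1)) \<noteq> (0::complex)"
      unfolding of_nat_eq_0_iff using c1 assms(1) by simp
    have "of_nat (2 * p * c * (lkp (nu - sgl c 1) c + 1)) * lkp q nu = 0"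
      unfolding e[symmetric] assms(3)[OF c1] by simp
    then show False using nz a unfolding mult_eq_0_iff by blast
  qed
  then show ?thesis by (intro poly_mapping_eqI) (auto simp: Cn_def lookup_single when_def)
qed

text \<open>If all positive coefficients of E^+ vanish on q, then \<open>Gm_rec\<close> at index c
  leaves only alpha(c) q. So every derivative of q is zero.\<close>

lemma Gm_const: assumes "p \<ge> 1" "k \<noteq> 0" "vin {1..} q" "\<And>f. f \<ge> 1 \<Longrightarrow> Gm p k f q = 0" shows "q = Cn (lkp q 0)"
proof (rule al_all_zero[OF assms(1,3)])
  fix c assume c: "c \<ge> (1::nat)"
  have "(\<Sum>d\<in>{1..c}. al p d (Gm p k (c - d) q)) = (\<Sum>d\<in>{1..c}. if d = c then al p c q else 0)"
    using assms(4) by (intro sum.cong) (auto simp: Gm_zero_idx)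
  also have "\<dots> = al p c q" using c by simp
  finally have "- of_int k * al p c q = 0" using Gm_rec[of c p k q] assms(4)[OF c] by simp
  then show "al p c q = 0" using assms(2) by simp
qed

section \<open>From a nonzero submodule to its vectors e^a\<close>

lemma submodD: assumes "is_submod p U N"
  shows "vzero \<in> N" "v \<in> N \<Longrightarrow> w \<in> N \<Longrightarrow> vadd v w \<in> N" "v \<in> N \<Longrightarrow> vscale c v \<in> N"
    "u \<in> U \<Longrightarrow> v \<in> N \<Longrightarrow> vmode p u n v \<in> N"
  using assms by (auto simp: is_submod_def)

lemma ee_lower_mem: assumes "p \<ge> 1" "m \<ge> 1" shows "ee (2 * int p * (- int m)) \<in> tripletA p m"
  using tripletA_gen[OF assms, of 0 m] by simp

lemma cmp_lower: assumes p: "p \<ge> 1" and v: "fin v" and w: "fin (vmode p (ee (2 * int p * k)) n v)"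
  shows "cmp (vmode p (ee (2 * int p * k)) n v) (a + 2 * int p * k) = lo p k (- n - 1 - k * a) (cmp v a)"
  by (rule poly_mapping_eqI) (simp add: lookup_cmp[OF w] vmode_ee[OF v p])

lemma vb_Gm_less: assumes "Gm p k f q \<noteq> 0" "f \<ge> 1" shows "vb (Gm p k f q) < vb q"
proof -
  have w: "wd {..0} (int (vb q) - int f) (Gm p k f q)" by (rule wd_Gm[OF wd_vb])
  then have "int (vb q) - int f \<ge> 0" using assms(1) wd_neg[OF w] by force
  moreover have "vb (Gm p k f q) \<le> nat (int (vb q) - int f)" unfolding vb_le_iff using w by (auto simp: wd_def)
  ultimately show ?thesis using assms(2) by linarith
qed

text \<open>Choose an element whose component of highest charge has least possible degree. If that
  component were not constant, E^+ of e^(-m alpha) would have a nonzero positive coefficient on it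
  by \<open>Gm_const\<close>, and the mode selecting the last one would produce a highest component
  of smaller degree.\<close>

lemma ex_top_const:
  assumes p: "p \<ge> 1" and m: "m \<ge> 1" and N: "is_submod p (tripletA p m) N" and g: "\<And>v. v \<in> N \<Longrightarrow> good A v"
    and nz: "v0 \<in> N" "v0 \<noteq> vzero"
  shows "\<exists>v\<in>N. \<exists>a c. c \<noteq> 0 \<and> cmp v a = Cn c \<and> (\<forall>a'>a. cmp v a' = 0)"
proof -
  define P where "P = (\<lambda>d. \<exists>v\<in>N. \<exists>a. cmp v a \<noteq> 0 \<and> (\<forall>a'>a. cmp v a' = 0) \<and> vb (cmp v a) = d)"
  have "\<exists>d. P d"
  proof -
    have f: "fin v0" using g[OF nz(1)] by (simp add: good_def)
    define S where "S = fst ` {x. v0 x \<noteq> 0}"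
    have fS: "finite S" using f by (simp add: S_def fin_def)
    have "S \<noteq> {}" using nz(2) by (auto simp: S_def vzero_def fun_eq_iff)
    then have M: "Max S \<in> S" using fS by (rule Max_in[rotated])
    then obtain nu where "v0 (Max S, nu) \<noteq> 0" by (auto simp: S_def)
    then have "cmp v0 (Max S) \<noteq> 0" using lookup_cmp[OF f, of "Max S" nu] by auto
    moreover have "cmp v0 a' = 0" if "a' > Max S" for a'
    proof -
      have "a' \<notin> S" using that fS Max_ge leD by blast
      then have "v0 (a', nu) = 0" for nu by (force simp: S_def)
      then show ?thesis by (intro poly_mapping_eqI) (simp add: lookup_cmp[OF f])
    qed
    ultimately show ?thesis using nz(1) unfolding P_def by blast
  qed
  then have L: "P (LEAST d. P d)" by (rule LeastI_ex)
  obtain v a where v: "v \<in> N" "cmp v a \<noteq> 0" "\<forall>a'>a. cmp v a' = 0" "vb (cmp v a) = (LEAST d. P d)"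
    using L[unfolded P_def] by (auto simp: P_def[symmetric])
  define q where "q = cmp v a"
  define k where "k = - int m"
  have k0: "k \<noteq> 0" using m by (simp add: k_def)
  have vq: "vin {1..} q" unfolding q_def by (rule goodD[OF g[OF v(1)]])
  have fv: "fin v" by (rule goodD(1)[OF g[OF v(1)]])
  have "Gm p k f q = 0" if f1: "f \<ge> 1" for f
  proof (rule ccontr)
    assume nzf: "Gm p k f q \<noteq> 0"
    define S where "S = {f. Gm p k f q \<noteq> 0}"
    have "S \<subseteq> {..vb q}" using Gm_zero by (auto simp: S_def not_less[symmetric])
    then have fS: "finite S" using finite_subset by blast
    define f' where "f' = Max S"
    have "f' \<in> S" using nzf fS unfolding f'_def by (intro Max_in) (auto simp: S_def)
    then have nz': "Gm p k f' q \<noteq> 0" by (simp add: S_def)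
    have "f \<le> f'" using nzf fS unfolding f'_def by (intro Max_ge) (auto simp: S_def)
    then have f1': "f' \<ge> 1" using f1 by simp
    have above: "Gm p k h q = 0" if "h > f'" for h
    proof (rule ccontr)
      assume "Gm p k h q \<noteq> 0"
      then have "h \<le> f'" unfolding f'_def by (intro Max_ge[OF fS]) (simp add: S_def)
      then show False using that by simp
    qed
    \<comment> \<open>On charge a this mode selects the exponent -f'. As f' is the last nonzero
      coefficient of E^+, only the constant term of E^- can contribute.\<close>
    define n where "n = - 1 - k * a + int f'"
    define w where "w = vmode p (ee (2 * int p * k)) n v"
    have wN: "w \<in> N" unfolding w_def k_def by (rule submodD(4)[OF N ee_lower_mem[OF p m] v(1)])
    have fw: "fin w" by (rule goodD(1)[OF g[OF wN]])
    have "- n - 1 - k * a = - int f'" by (simp add: n_def)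
    then have c1: "cmp w (a + 2 * int p * k) = Gm p k f' q"
      using cmp_lower[OF p fv fw[unfolded w_def], of a] lo_top[of f' p k q] above unfolding w_def q_def by simp
    have c2: "cmp w a' = 0" if "a' > a + 2 * int p * k" for a'
      using cmp_lower[OF p fv fw[unfolded w_def], of "a' - 2 * int p * k"] v(3) that unfolding w_def by simp
    have "P (vb (Gm p k f' q))" unfolding P_def using wN c1 c2 nz' by metis
    then have "(LEAST d. P d) \<le> vb (Gm p k f' q)" by (rule Least_le)
    then show False using vb_Gm_less[OF nz' f1'] v(4) unfolding q_def by simp
  qed
  then have "q = Cn (lkp q 0)" by (rule Gm_const[OF p k0 vq])
  moreover have "lkp q 0 \<noteq> 0" using v(2) calculation unfolding q_def by (metis Cn_0)
  ultimately show ?thesis using v unfolding q_def by metis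
qed

lemma ee_step: assumes p: "p \<ge> 1" and m: "m \<ge> 1" and N: "is_submod p (tripletA p m) N" and e: "ee x \<in> N"
  shows "ee (x - 2 * int p * int m) \<in> N"
proof -
  have dv: "2 * int p * (- int m) div (2 * int p) = - int m" using p nonzero_mult_div_cancel_left[of "2 * int p" "- int m"] by simp
  have "Yp p (- int m) x 1 1 $$ (- (- 1 + int m * x) - 1) = lo p (- int m) 0 1"
    by (simp add: Yp_1 lo_def)
  also have "\<dots> = 1" using lo_Cn[of p "- int m" 1] by simp
  finally have "vmode p (ee (2 * int p * (- int m))) (- 1 + int m * x) (ee x) = ee (x - 2 * int p * int m)"
    unfolding ee_emb vmode_emb_emb[OF vin_1] dv by simp
  then show ?thesis using submodD(4)[OF N ee_lower_mem[OF p m] e] by metis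
qed

text \<open>The mode of e^(-m alpha) that keeps the constant on the highest charge a selects on
  charge a' < a the exponent m (a' - a) < 0 and hence lowers the degree there. Repetition kills all
  lower components and leaves a multiple of one e^s.\<close>

lemma ex_ee:
  assumes p: "p \<ge> 1" and m: "m \<ge> 1" and N: "is_submod p (tripletA p m) N" and g: "\<And>v. v \<in> N \<Longrightarrow> good A v"
    and nz: "v0 \<in> N" "v0 \<noteq> vzero"
  shows "\<exists>a. ee a \<in> N"
proof -
  obtain v a c where v: "v \<in> N" "c \<noteq> 0" "cmp v a = Cn c" "\<And>a'. a' > a \<Longrightarrow> cmp v a' = 0"
    using ex_top_const[OF p m N g nz] by blast
  \<comment> \<open>The degrees of the lower components are at most D - 1, so D = 0 means that these
    components are zero.\<close>
  have "\<exists>s. ee s \<in> N" if "v \<in> N" "cmp v a = Cn c" "\<And>a'. a' > a \<Longrightarrow> cmp v a' = 0" "\<And>a'. a' < a \<Longrightarrow> wd {..0} (int D - 1) (cmp v a')" for D v a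
    using that
  proof (induction D arbitrary: v a)
    case 0
    have fv: "fin v" by (rule goodD(1)[OF g[OF 0(1)]])
    have "v = emb a (Cn c)"
    proof (rule vec_eqI[OF fv fin_emb])
      fix a' show "cmp v a' = cmp (emb a (Cn c)) a'"
        using 0 wd_neg[OF 0(4)[of a']] by (cases a' a rule: linorder_cases) (auto simp: cmp_emb)
    qed
    then have "vscale (1 / c) v = ee a" using v(2) by (simp add: emb_scale Cn_mult[symmetric] ee_emb)
    then show ?case using submodD(3)[OF N 0(1)] by metis
  next
    case (Suc D)
    define k where "k = - int m"
    define n where "n = - 1 - k * a"
    define w where "w = vmode p (ee (2 * int p * k)) n v"
    have fv: "fin v" by (rule goodD(1)[OF g[OF Suc.prems(1)]])
    have wN: "w \<in> N" unfolding w_def k_def by (rule submodD(4)[OF N ee_lower_mem[OF p m] Suc.prems(1)])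
    have fw: "fin w" by (rule goodD(1)[OF g[OF wN]])
    have cw: "cmp w (a' + 2 * int p * k) = lo p k (int m * (a' - a)) (cmp v a')" for a'
      using cmp_lower[OF p fv fw[unfolded w_def], of a'] unfolding w_def by (simp add: n_def k_def algebra_simps)
    have cw': "cmp w b = lo p k (int m * (b - 2 * int p * k - a)) (cmp v (b - 2 * int p * k))" for b
      using cw[of "b - 2 * int p * k"] by simp
    show ?case
    proof (rule Suc.IH[OF wN])
      show "cmp w (a + 2 * int p * k) = Cn c" unfolding cw Suc.prems(2) by (simp add: lo_Cn)
      show "cmp w a' = 0" if "a' > a + 2 * int p * k" for a'
        unfolding cw' using Suc.prems(3)[of "a' - 2 * int p * k"] that by simp
      show "wd {..0} (int D - 1) (cmp w a')" if "a' < a + 2 * int p * k" for a'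
      proof -
        define t where "t = int m * (a' - 2 * int p * k - a)"
        have t: "t \<le> -1"
        proof -
          have "int m * (a' - 2 * int p * k - a) \<le> int m * (-1)" using that by (intro mult_left_mono) auto
          then show ?thesis using m by (simp add: t_def)
        qed
        have "wd {..0} (int (Suc D) - 1 + t) (cmp w a')"
          unfolding cw' t_def using that by (intro wd_lo Suc.prems(4)) auto
        then show ?thesis using t by (fastforce simp: wd_def)
      qed
    qed
  qed
  moreover have "\<exists>D. \<forall>a'. wd {..0} (int D - 1) (cmp v a')"
  proof -
    have fv: "fin v" by (rule goodD(1)[OF g[OF v(1)]])
    define D where "D = (\<Sum>x\<in>{x. v x \<noteq> 0}. deg (snd x)) + 1"
    have "deg nu \<le> D - 1" if "nu \<in> pkeys (cmp v a')" for nu a'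
    proof -
      have "(a', nu) \<in> {x. v x \<noteq> 0}" using that by (simp add: in_keys_iff lookup_cmp[OF fv])
      then have "deg (snd (a', nu)) \<le> (\<Sum>x\<in>{x. v x \<noteq> 0}. deg (snd x))"
        using fv by (intro member_le_sum) (auto simp: fin_def)
      then show ?thesis by (simp add: D_def)
    qed
    moreover have "D \<ge> 1" by (simp add: D_def)
    ultimately have "wd {..0} (int D - 1) (cmp v a')" for a' unfolding wd_def by (fastforce simp: of_nat_diff)
    then show ?thesis by blast
  qed
  ultimately show ?thesis using v by blast
qed

text \<open>\<open>ee_step\<close> descends by m alpha at a time, so the vector can be found
  arbitrarily far down; \<open>plus_mem\<close> uses this to get n \<ge> j.\<close>

lemma ex_ee_class:
  assumes p: "p \<ge> 1" and m: "m \<ge> 1" and N: "is_submod p (tripletA p m) N" and g: "\<And>v. v \<in> N \<Longrightarrow> good (cls p m r) v"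
    and nz: "v0 \<in> N" "v0 \<noteq> vzero"
  shows "\<exists>s\<ge>K. ee (r - 2 * int p * int (m * s)) \<in> N"
proof -
  obtain a where a: "ee a \<in> N" using ex_ee[OF p m N g nz] by blast
  have "a \<in> cls p m r"
  proof (rule ccontr)
    assume "a \<notin> cls p m r"
    then have "cmp (ee a) a = 0" by (rule goodD(3)[OF g[OF a]])
    then show False by (simp add: ee_emb cmp_emb)
  qed
  then obtain x where x: "a = r + 2 * int p * int m * x" by (auto simp: cls_def elim!: dvdE) (metis diff_add_cancel add.commute)
  have st: "ee (a - 2 * int p * int m * int t) \<in> N" for t
  proof (induction t)
    case (Suc t)
    have "a - 2 * int p * int m * int t - 2 * int p * int m = a - 2 * int p * int m * int (Suc t)" by (simp add: algebra_simps)
    then show ?case using ee_step[OF p m N Suc] by (simp only:)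
  qed (simp add: a)
  define s where "s = K + nat (- x)"
  define t where "t = nat (int s + x)"
  have "int t = int s + x" by (simp add: t_def s_def)
  then have "a - 2 * int p * int m * int t = r - 2 * int p * int (m * s)" by (simp add: x algebra_simps)
  then show ?thesis using st[of t] by (intro exI[of _ s]) (simp add: s_def)
qed

lemma mem_of_scale: assumes "is_submod p U N" "c \<noteq> 0" "vscale c v \<in> N" shows "v \<in> N"
proof -
  have "vscale (1 / c) (vscale c v) = v" using assms(2) by (simp add: vscale_def)
  then show ?thesis using submodD(3)[OF assms(1,3), of "1 / c"] by simp
qed

lemma raise_mem:
  assumes p: "p \<ge> 1" and m: "m \<ge> 1" and N: "is_submod p (tripletA p m) N" and e: "ee a0 \<in> N"
    and n: "int m dvd int n" "\<sigma> \<le> 2 * n" and C: "a0 + 1 + int p * (int \<sigma> - 1) \<le> 0"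
    and S: "\<sigma> = 2 * n \<or> - (1 + a0) - int p * int \<sigma> < 0"
    and b1: "b1 = a0 - 2 * int p * int n + 2 * int p * int \<sigma>"
  shows "(Qscr p ^^ (2 * n - \<sigma>)) (ee b1) \<in> N"
proof -
  obtain c k where c: "c \<noteq> 0" "vmode p ((Qscr p ^^ (2 * n)) (ee (- 2 * int p * int n))) k (ee a0)
     = vscale c ((Qscr p ^^ (2 * n - \<sigma>)) (ee b1))"
    using raising[OF p n(2) C S b1] by blast
  have "(Qscr p ^^ (2 * n)) (ee (- 2 * int p * int n)) \<in> tripletA p m" using n(1) by (intro tripletA_gen[OF p m]) auto
  then have "vscale c ((Qscr p ^^ (2 * n - \<sigma>)) (ee b1)) \<in> N"
    unfolding c(2)[symmetric] by (rule submodD(4)[OF N _ e])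
  then show ?thesis by (rule mem_of_scale[OF N c(1)])
qed

text \<open>With \<sigma> = 2n condition \<open>C\<close> of \<open>raising\<close> reads i \<le> p
  + 2pj. The lemma also covers j = 0 and, for even m, j = m/2, hence three of the four
  families.\<close>

lemma minus_mem:
  assumes p: "p \<ge> 1" and m: "m \<ge> 1" and i: "i \<le> p" and N: "is_submod p (tripletA p m) N"
    and g: "\<And>v. v \<in> N \<Longrightarrow> good (cls p m (- 2 * int p * int j + int i - 1)) v" and nz: "N \<noteq> {vzero}"
  shows "ee (- 2 * int p * int j + int i - 1) \<in> N"
proof -
  define r where "r = - 2 * int p * int j + int i - 1"
  obtain v0 where v0: "v0 \<in> N" "v0 \<noteq> vzero" using nz submodD(1)[OF N] by blast
  obtain s where s: "ee (r - 2 * int p * int (m * s)) \<in> N"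
    using ex_ee_class[OF p m N g[folded r_def] v0, of 0] by blast
  define n where "n = m * s"
  have pj: "2 * int p * int j \<ge> 0" by simp
  have "(Qscr p ^^ (2 * n - 2 * n)) (ee r) \<in> N"
  proof (rule raise_mem[OF p m N s])
    show "r - 2 * int p * int (m * s) + 1 + int p * (int (2 * n) - 1) \<le> 0"
    proof -
      have "r - 2 * int p * int (m * s) + 1 + int p * (int (2 * n) - 1) = int i - int p - 2 * int p * int j"
        by (simp add: n_def r_def algebra_simps)
      then show ?thesis using i pj by linarith
    qed
  qed (auto simp: n_def algebra_simps)
  then show ?thesis by (simp add: r_def)
qed

text \<open>With \<sigma> = 2n - 2j condition \<open>C\<close> reads i \<le> p and condition
  \<open>S\<close> reads i > 0: the range of i is exactly what both require.\<close>

lemma plus_mem: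
  assumes p: "p \<ge> 1" and m: "m \<ge> 1" and i: "1 \<le> i" "i \<le> p" and N: "is_submod p (tripletA p m) N"
    and g: "\<And>v. v \<in> N \<Longrightarrow> good (cls p m (2 * int p * int j + int i - 1)) v" and nz: "N \<noteq> {vzero}"
  shows "(Qscr p ^^ (2 * j)) (ee (- 2 * int p * int j + int i - 1)) \<in> N"
proof -
  define r where "r = 2 * int p * int j + int i - 1"
  obtain v0 where v0: "v0 \<in> N" "v0 \<noteq> vzero" using nz submodD(1)[OF N] by blast
  obtain s where s: "ee (r - 2 * int p * int (m * s)) \<in> N" "s \<ge> j"
    using ex_ee_class[OF p m N g[folded r_def] v0, of j] by blast
  define n where "n = m * s"
  have "s \<le> n" using m by (simp add: n_def)
  then have nj: "n \<ge> j" using s by simp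
  define \<sigma> where "\<sigma> = 2 * n - 2 * j"
  have sg: "int \<sigma> = 2 * int n - 2 * int j" "2 * n - \<sigma> = 2 * j" using nj by (auto simp: \<sigma>_def of_nat_diff)
  have "(Qscr p ^^ (2 * n - \<sigma>)) (ee (- 2 * int p * int j + int i - 1)) \<in> N"
  proof (rule raise_mem[OF p m N s(1)])
    show "r - 2 * int p * int (m * s) + 1 + int p * (int \<sigma> - 1) \<le> 0"
      using i unfolding sg n_def[symmetric] by (simp add: r_def algebra_simps)
    show "\<sigma> = 2 * n \<or> - (1 + (r - 2 * int p * int (m * s))) - int p * int \<sigma> < 0"
      using i unfolding sg n_def[symmetric] by (simp add: r_def algebra_simps)
    show "- 2 * int p * int j + int i - 1 = r - 2 * int p * int (m * s) - 2 * int p * int n + 2 * int p * int \<sigma>"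
      unfolding sg n_def[symmetric] by (simp add: r_def algebra_simps)
    show "int m dvd int n" by (simp add: n_def)
    show "\<sigma> \<le> 2 * n" by (simp add: \<sigma>_def)
  qed
  then show ?thesis unfolding sg .
qed

text \<open>A cyclic module is irreducible once its generator can be recovered from every nonzero
  submodule. The class of the charges modulo 2pm is the only information about the ambient module
  that the recovery receives.\<close>

lemma irreducible_gen_sub:
  assumes p: "p \<ge> 1" and m: "m \<ge> 1" and w: "good (cls p m r) w" "w \<noteq> vzero"
    and mem: "\<And>N. is_submod p (tripletA p m) N \<Longrightarrow> (\<And>v. v \<in> N \<Longrightarrow> good (cls p m r) v) \<Longrightarrow> N \<noteq> {vzero} \<Longrightarrow> w \<in> N"
  shows "irreducible_mod p (tripletA p m) (gen_sub p (tripletA p m) w)"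
proof -
  let ?M = "gen_sub p (tripletA p m) w"
  have sub: "is_submod p (tripletA p m) ?M"
    unfolding is_submod_def by (auto intro: gen_sub.intros)
  have good: "good (cls p m r) v" if "v \<in> ?M" for v
    using that
  proof (induction rule: gen_sub.induct)
    case (mode u v n) then show ?case by (intro good_cls_mode[OF p m])
  qed (auto intro: w good_zero good_add good_scale)
  have "N = {vzero} \<or> N = ?M" if N: "N \<subseteq> ?M" "is_submod p (tripletA p m) N" for N
  proof (cases "N = {vzero}")
    case False
    have wN: "w \<in> N" using N good False by (intro mem) auto
    have "v \<in> N" if "v \<in> ?M" for v
      using that
    proof (induction rule: gen_sub.induct)
      case (mode u v n) then show ?case using submodD(4)[OF N(2)] by blast
    qed (auto intro: wN submodD[OF N(2)])
    then show ?thesis using N by blast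
  qed simp
  moreover have "?M \<noteq> {vzero}" using w(2) gen_sub.base[of w p "tripletA p m"] by auto
  ultimately show ?thesis using sub by (simp add: irreducible_mod_def)
qed

text \<open>The creation property: every mode alpha(c) with c \<ge> 0 kills the vacuum and E^+ fixes
  it, so only nonnegative powers of z remain, with u as constant term.\<close>

lemma Yp_vac: assumes "vin {1..} u"
  shows "Yp p k 0 u 1 $$ 0 = u \<and> (\<forall>N<0. Yp p k 0 u 1 $$ N = 0)"
  using assms
proof (induction u rule: pol_induct_in)
  case (const d)
  have "Ep p k 1 = 1" by (auto simp: fls_eq_iff Ep_nth Gm_1)
  then show ?case by (simp add: Yp_Cn)
next
  case (add q r) then show ?case by (simp add: Yp_add_left)
next
  case (mult n u)
  have z: "al0 p 0 c 1 = 0" for c by (simp add: al0_def)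
  have nth: "(Af n * Yp p k 0 u 1) $$ N = (\<Sum>j\<in>{0..N - 0}. Af n $$ j * Yp p k 0 u 1 $$ (N - j))" for N
    using mult by (intro fls_times_nth_lb) (auto simp: Af_nth)
  have "Yp p k 0 (Xv n * u) 1 = Af n * Yp p k 0 u 1" by (simp add: Yp_Xv[OF order_refl] z)
  then show ?case using mult by (simp add: nth Af_nth)
qed

lemma mode_vac: assumes p: "p \<ge> 1" and u: "good A u" and A: "\<And>a. a \<in> A \<Longrightarrow> 2 * int p dvd a" and f: "fin (vmode p u (-1) (ee 0))"
  shows "vmode p u (-1) (ee 0) = u"
proof (rule vec_eqI[OF f goodD(1)[OF u]])
  fix a
  have fu: "finite {x. u x \<noteq> 0}" using goodD(1)[OF u] by (simp add: fin_def)
  have s: "{x'. ee 0 x' \<noteq> 0} = {(0, 0)}" by (auto simp: ee_def bv_def)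
  show "cmp (vmode p u (-1) (ee 0)) a = cmp u a"
  proof (rule poly_mapping_eqI)
    fix nu
    have "lkp (cmp (vmode p u (-1) (ee 0)) a) nu = (\<Sum>x\<in>{x. u x \<noteq> 0}. u x * Ybasis p x (0, 0) 0 (a, nu))"
    proof -
      have "vmode p u (-1) (ee 0) (a, nu) = (\<Sum>x\<in>{x. u x \<noteq> 0}. u x * Ybasis p x (0, 0) 0 (a, nu))"
        unfolding vmode_def Ycoef_def s by (simp add: ee_def bv_def)
      then show ?thesis unfolding lookup_cmp[OF f] .
    qed
    also have "\<dots> = (\<Sum>x\<in>{x. u x \<noteq> 0}. if x = (a, nu) then u (a, nu) else 0)"
    proof (rule sum.cong[OF refl])
      fix x assume x: "x \<in> {x. u x \<noteq> 0}"
      obtain b mu where xb: "x = (b, mu)" by (cases x)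
      have "0 \<notin> pkeys mu" using x u unfolding xb good_def by auto
      then have k: "pkeys mu \<subseteq> {1..}" by (metis One_nat_def Suc_le_eq atLeast_iff gr0I subsetI)
      have "Yl p (b div (2 * int p)) 0 (factors mu) 1 = Yp p (b div (2 * int p)) 0 (Mo mu) 1"
        unfolding Yp_def Mo_def lext_single[OF kc_hom] by simp
      then have "Ybasis p x (0, 0) 0 = emb b (Mo mu)"
        unfolding xb Ybasis_Yl[OF k] using Yp_vac[OF vin_Mo[OF k]] by simp
      then show "u x * Ybasis p x (0, 0) 0 (a, nu) = (if x = (a, nu) then u (a, nu) else 0)"
        unfolding xb by (auto simp: emb_apply Mo_def lookup_single when_def)
    qed
    also have "\<dots> = lkp (cmp u a) nu" unfolding lookup_cmp[OF goodD(1)[OF u]] using fu by simp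
    finally show "lkp (cmp (vmode p u (-1) (ee 0)) a) nu = lkp (cmp u a) nu" .
  qed
qed

lemma tripletA_good: assumes "p \<ge> 1" "m \<ge> 1" "u \<in> tripletA p m" shows "good (cls p m 0) u"
proof -
  have "good UNIV u" using triplet_good[OF assms(1)] assms(3) by (auto simp: tripletA_def)
  moreover have "b \<in> cls p m 0" if "u (b, mu) \<noteq> 0" for b mu
    using tripletA_charge[OF assms that] by (simp add: cls_def)
  ultimately show ?thesis unfolding good_def by blast
qed

text \<open>A nonzero ideal contains the vacuum by \<open>minus_mem\<close> with i = 1 and j = 0,
  and then every u, because u is its own mode u_(-1) applied to the vacuum.\<close>

lemma simple_tripletA: assumes p: "p \<ge> 1" and m: "m \<ge> 1" shows "simple_va p (tripletA p m)"
proof -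
  have e0: "ee 0 \<in> tripletA p m" using tripletA_gen[OF p m, of 0 0] by simp
  moreover have "ee 0 \<noteq> vzero" by (auto simp: ee_def bv_def vzero_def fun_eq_iff)
  ultimately have "tripletA p m \<noteq> {vzero}" by auto
  moreover have "I = {vzero} \<or> I = tripletA p m" if I: "I \<subseteq> tripletA p m" "is_submod p (tripletA p m) I" for I
  proof (cases "I = {vzero}")
    case False
    have r: "- 2 * int p * int 0 + int 1 - 1 = 0" by simp
    have "ee (- 2 * int p * int 0 + int 1 - 1) \<in> I"
      by (rule minus_mem[OF p m p I(2) _ False]) (use I tripletA_good[OF p m] in \<open>auto simp: r\<close>)
    then have "ee 0 \<in> I" by simp
    then have m1: "vmode p u (-1) (ee 0) \<in> I" if "u \<in> tripletA p m" for u using that submodD(4)[OF I(2)] by blast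
    have "u \<in> I" if u: "u \<in> tripletA p m" for u
    proof -
      \<comment> \<open>Finiteness of the support comes from membership in the ideal, all of whose
        elements lie in \<open>tripletA p m\<close>.\<close>
      have f: "fin (vmode p u (-1) (ee 0))" using m1[OF u] I(1) tripletA_good[OF p m] goodD(1) by blast
      have "vmode p u (-1) (ee 0) = u"
      proof (rule mode_vac[OF p tripletA_good[OF p m u] _ f])
        fix a assume "a \<in> cls p m 0"
        then show "2 * int p dvd a" by (auto simp: cls_def elim: dvd_mult_left)
      qed
      then show ?thesis using m1[OF u] by simp
    qed
    then show ?thesis using I by blast
  qed simp
  ultimately show ?thesis by (simp add: simple_va_def)
qed

theorem mainTheorem9:
  fixes p m i :: nat
  assumes "p \<ge> 2" and "m \<ge> 1" and "1 \<le> i" and "i \<le> p"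
  shows "irreducible_mod p (tripletA p m) (gen_sub p (tripletA p m) (ee (int i - 1)))
    \<and> (\<forall>j::nat. 1 \<le> j \<and> j \<le> (m - 1) div 2 \<longrightarrow>
         irreducible_mod p (tripletA p m)
           (gen_sub p (tripletA p m) (ee (- 2 * int p * int j + int i - 1)))
       \<and> irreducible_mod p (tripletA p m)
           (gen_sub p (tripletA p m) ((Qscr p ^^ (2 * j)) (ee (- 2 * int p * int j + int i - 1)))))
    \<and> (even m \<longrightarrow> irreducible_mod p (tripletA p m)
           (gen_sub p (tripletA p m) (ee (- int p * int m + int i - 1))))
    \<and> simple_va p (tripletA p m)"
proof -
  have p: "p \<ge> 1" using assms(1) by simp
  note m = assms(2)
  have nz: "emb a q \<noteq> vzero" if "q \<noteq> 0" for a q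
  proof
    assume "emb a q = vzero"
    then have "cmp (emb a q) a = cmp (emb a 0) a" by (simp add: emb_0)
    then show False using that by (simp add: cmp_emb)
  qed
  have minus: "irreducible_mod p (tripletA p m) (gen_sub p (tripletA p m) (ee (- 2 * int p * int j + int i - 1)))" for j
  proof (rule irreducible_gen_sub[OF p m])
    show "good (cls p m (- 2 * int p * int j + int i - 1)) (ee (- 2 * int p * int j + int i - 1))"
      unfolding ee_emb by (intro good_emb) (auto simp: cls_def)
    show "ee (- 2 * int p * int j + int i - 1) \<noteq> vzero" unfolding ee_emb by (rule nz) simp
  qed (rule minus_mem[OF p m assms(4)])
  have plus: "irreducible_mod p (tripletA p m) (gen_sub p (tripletA p m) ((Qscr p ^^ (2 * j)) (ee (- 2 * int p * int j + int i - 1))))" for j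
  proof (rule irreducible_gen_sub[OF p m])
    define b where "b = - 2 * int p * int j + int i - 1"
    show "good (cls p m (2 * int p * int j + int i - 1)) ((Qscr p ^^ (2 * j)) (ee (- 2 * int p * int j + int i - 1)))"
      by (intro good_Qscr[OF p]) (auto simp: cls_def algebra_simps)
    \<comment> \<open>One nonzero value suffices. The point 2pj is the one at which
      \<open>ev_st_nonzero\<close> admits 2j screenings, and its condition on the charge becomes i
      \<le> p.\<close>
    have "ev (of_nat (2 * p * j)) (Qi p b (2 * j) 1) \<noteq> 0"
      unfolding Qi_st by (rule ev_st_nonzero[OF p]) (use assms(4) in \<open>auto simp: b_def algebra_simps\<close>)
    then have "Qi p b (2 * j) 1 \<noteq> 0" using ev_hom(4) by metis
    then show "(Qscr p ^^ (2 * j)) (ee (- 2 * int p * int j + int i - 1)) \<noteq> vzero"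
      unfolding ee_emb Qscr_pow[OF p] b_def by (rule nz)
  qed (rule plus_mem[OF p m assms(3,4)])
  have even: "irreducible_mod p (tripletA p m) (gen_sub p (tripletA p m) (ee (- int p * int m + int i - 1)))" if ev_m: "even m"
  proof -
    obtain j where "m = 2 * j" using ev_m by (auto elim: evenE)
    then have "- int p * int m + int i - 1 = - 2 * int p * int j + int i - 1" by simp
    then show ?thesis using minus[of j] by (simp only:)
  qed
  show ?thesis using minus[of 0] minus plus even simple_tripletA[OF p m] by simp
qed

end
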